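(* Let $\{\lambda,\underline m\}$ be a pointed knapsack partition of $n$ with $m>0$, where $\lambda$ has $k$ parts. The top homology group $\widetilde H_{k-1}(\Delta(\Pi^\bullet_{\{\lambda,\underline m\}}-\{\hat 1\}))$ is isomorphic, as an $\mathfrak S_n$-module, to the direct sum of Specht modules $\bigoplus_{\vec d\in V(\lambda,\underline m)}S^{B(\vec d)}$.
   Context: An integer partition $\lambda=\{\lambda_1^{e_1},\dots,\lambda_q^{e_q}\}$ ($\lambda_i$ distinct) is a knapsack partition if the sums $\sum_i f_i\lambda_i$, $0\le f_i\le e_i$, are pairwise distinct; a pointed knapsack partition $\{\lambda,\underline m\}$ of $n$ is such a $\lambda$ with an integer $m\ge0$, total $n$. A pointed set partition of $[n]$ is $\{B_1,\dots,B_j,\underline Z\}$, $Z\subseteq[n]$ possibly empty (pointed block), $B_i$ nonempty partitioning $[n]\setminus Z$; type = multiset $\{|B_i|\}$ with pointed number $|Z|$; $\Pi^\bullet_n$ is ordered by $\pi\le\pi'$ iff each non-pointed block of $\pi$ lies in a block of $\pi'$ and the pointed block of $\pi$ lies in that of $\pi'$. $\Pi^\bullet_{\{\lambda,\underline m\}}$ is the filter of $\Pi^\bullet_n$ generated by pointed set partitions of type $\{\lambda,\underline m\}$, with maximum $\hat 1=\{\underline{[n]}\}$; $\Delta(P)$ is the order complex; $\mathfrak S_n$ acts by relabeling; reduced homology with coefficients in a fixed field. Pointed compositions $(c_1,\dots,c_r)$ ($c_i\ge1$ for $i<r$, $c_r\ge0$, sum $n$) are ordered by $\vec c\le\vec d$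 iff $\vec d$ arises by replacing runs of consecutive entries by their sums; type = multiset $\{c_1,\dots,c_{r-1}\}$ with pointed $c_r$. With $F$ the filter generated by compositions of type $\{\lambda,\underline m\}$, $V(\lambda,\underline m)$ is the set of $\vec d=(d_1,\dots,d_r)\in F$ with $d_r=m$ and each $d_i$ ($i<r$) a sum of parts of $\lambda$ of pairwise distinct values. $B(\vec d)$ is the border strip of $\vec d$: the connected skew shape with no $2\times2$ square having $r$ rows, the $i$-th from the bottom with $d_i$ boxes. For a shape $B$ with $n$ boxes, tableaux are bijective fillings by $[n]$, tabloids are row-equivalence classes, $M^B$ is spanned by tabloids, ${\bf e}_t=\sum_{\gamma\in C_t}\operatorname{sign}(\gamma)\gamma\{t\}$ with $C_t$ the column stabilizer of $t$, and the Specht module $S^B$ is spanned by the ${\bf e}_t$.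
   Formalization: The fixed coefficient field is required to have n! invertible (characteristic 0 or greater than n); over other fields the isomorphism can fail, e.g. for λ={1,2}, m=1, n=4 over F_2. *)

theory Defs
  imports "HOL.Vector_Spaces" "HOL-Library.Poly_Mapping" "HOL-Library.FuncSet" "HOL-Library.Multiset"
    "HOL-Library.Disjoint_Sets" "HOL-Combinatorics.Permutations"
begin

section \<open>Free vector spaces\<close>

text \<open>The vector space with basis \<open>'x\<close> over the field \<open>'k\<close> is \<open>'x \<Rightarrow>\<^sub>0 'k\<close>; the basis vector
  belonging to \<open>x\<close> is \<open>Poly_Mapping.single x 1\<close>.\<close>

definition fscale :: "'k::field \<Rightarrow> ('x \<Rightarrow>\<^sub>0 'k) \<Rightarrow> ('x \<Rightarrow>\<^sub>0 'k)"
  where "fscale c v = Poly_Mapping.map ((*) c) v"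

lemma lookup_fscale [simp]: "Poly_Mapping.lookup (fscale c v) x = c * Poly_Mapping.lookup v x"
  by (auto simp: fscale_def Poly_Mapping.map.rep_eq when_def)

global_interpretation free_vs: vector_space "fscale :: 'k::field \<Rightarrow> ('x \<Rightarrow>\<^sub>0 'k) \<Rightarrow> _"
  by unfold_locales (auto intro!: poly_mapping_eqI simp: lookup_add algebra_simps)

text \<open>The linear map that sends each basis vector \<open>x\<close> to \<open>f x\<close>.\<close>

definition lin_ext :: "('x \<Rightarrow> ('y \<Rightarrow>\<^sub>0 'k)) \<Rightarrow> ('x \<Rightarrow>\<^sub>0 'k::field) \<Rightarrow> ('y \<Rightarrow>\<^sub>0 'k)"
  where "lin_ext f v = (\<Sum>x\<in>Poly_Mapping.keys v. fscale (Poly_Mapping.lookup v x) (f x))"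

definition basis_map :: "('x \<Rightarrow> 'y) \<Rightarrow> ('x \<Rightarrow>\<^sub>0 'k::field) \<Rightarrow> ('y \<Rightarrow>\<^sub>0 'k)"
  where "basis_map f = lin_ext (\<lambda>x. Poly_Mapping.single (f x) 1)"


section \<open>Modules over the symmetric group\<close>

text \<open>The symmetric group on \<open>{1..n}\<close> consists of the functions \<open>p\<close> with \<open>p permutes {1..n}\<close>.
  The operations of a module matter only on its carrier \<open>space\<close>.\<close>

record ('k, 'v) sym_module =
  space :: "'v set"
  add :: "'v \<Rightarrow> 'v \<Rightarrow> 'v"
  scale :: "'k \<Rightarrow> 'v \<Rightarrow> 'v"
  act :: "(nat \<Rightarrow> nat) \<Rightarrow> 'v \<Rightarrow> 'v"

definition sym_module_iso :: "nat \<Rightarrow> ('k::field, 'v) sym_module \<Rightarrow> ('k, 'w) sym_module \<Rightarrow> bool"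
  where "sym_module_iso n M N \<longleftrightarrow> (\<exists>f. bij_betw f (space M) (space N) \<and>
    (\<forall>x\<in>space M. \<forall>y\<in>space M. f (add M x y) = add N (f x) (f y)) \<and>
    (\<forall>c. \<forall>x\<in>space M. f (scale M c x) = scale N c (f x)) \<and>
    (\<forall>p. p permutes {1..n} \<longrightarrow> (\<forall>x\<in>space M. f (act M p x) = act N p (f x))))"

text \<open>Every family of modules to which this is applied is indexed by a finite set, so that the
  direct sum is the full product.\<close>

definition direct_sum :: "'i set \<Rightarrow> ('i \<Rightarrow> ('k::field, 'v) sym_module) \<Rightarrow> ('k, 'i \<Rightarrow> 'v) sym_module"
  where "direct_sum I M = \<lparr>
    space = (\<Pi>\<^sub>E i\<in>I. space (M i)),
    add = (\<lambda>x y. \<lambda>i\<in>I. add (M i) (x i) (y i)),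
    scale = (\<lambda>c x. \<lambda>i\<in>I. scale (M i) c (x i)),
    act = (\<lambda>p x. \<lambda>i\<in>I. act (M i) p (x i))\<rparr>"

text \<open>The quotient of the subspace \<open>U\<close> of a free vector space by the subspace \<open>W\<close>, with the action
  induced by \<open>a\<close>; its elements are the cosets \<open>z + W\<close>. The summand \<open>w\<close> in the scalar multiplication
  gives \<open>0 * (z + W) = W\<close>.\<close>

definition quotient_module ::
    "('x \<Rightarrow>\<^sub>0 'k::field) set \<Rightarrow> ('x \<Rightarrow>\<^sub>0 'k) set \<Rightarrow> ((nat \<Rightarrow> nat) \<Rightarrow> ('x \<Rightarrow>\<^sub>0 'k) \<Rightarrow> ('x \<Rightarrow>\<^sub>0 'k))
      \<Rightarrow> ('k, ('x \<Rightarrow>\<^sub>0 'k) set) sym_module"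
  where "quotient_module U W a = \<lparr>
    space = {{z + w |w. w \<in> W} |z. z \<in> U},
    add = (\<lambda>X Y. {x + y |x y. x \<in> X \<and> y \<in> Y}),
    scale = (\<lambda>c X. {fscale c x + w |x w. x \<in> X \<and> w \<in> W}),
    act = (\<lambda>p X. a p ` X)\<rparr>"


section \<open>Reduced homology of order complexes\<close>

text \<open>A simplex of dimension \<open>p\<close> of the order complex of the poset \<open>P\<close> with order \<open>le\<close> is a chain
  with \<open>p + 1\<close> elements, here written, and oriented, as the increasing list of its elements. The
  empty chain is the simplex of dimension \<open>-1\<close>, so the homology below is reduced.\<close>

definition order_simplices :: "'a set \<Rightarrow> ('a \<Rightarrow> 'a \<Rightarrow> bool) \<Rightarrow> int \<Rightarrow> 'a list set"
  where "order_simplices P le p =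
    {xs. set xs \<subseteq> P \<and> sorted_wrt (\<lambda>x y. le x y \<and> x \<noteq> y) xs \<and> int (length xs) = p + 1}"

definition chain_space :: "'a set \<Rightarrow> ('a \<Rightarrow> 'a \<Rightarrow> bool) \<Rightarrow> int \<Rightarrow> ('a list \<Rightarrow>\<^sub>0 'k::field) set"
  where "chain_space P le p = {c. Poly_Mapping.keys c \<subseteq> order_simplices P le p}"

definition boundary :: "('a list \<Rightarrow>\<^sub>0 'k::field) \<Rightarrow> ('a list \<Rightarrow>\<^sub>0 'k)"
  where "boundary = lin_ext
    (\<lambda>xs. \<Sum>i<length xs. Poly_Mapping.single (take i xs @ drop (Suc i) xs) ((- 1) ^ i))"

text \<open>The symmetric group acts on the elements of the poset by \<open>a\<close>.\<close>

definition reduced_homology ::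
    "'a set \<Rightarrow> ('a \<Rightarrow> 'a \<Rightarrow> bool) \<Rightarrow> ((nat \<Rightarrow> nat) \<Rightarrow> 'a \<Rightarrow> 'a) \<Rightarrow> int
      \<Rightarrow> ('k::field, ('a list \<Rightarrow>\<^sub>0 'k) set) sym_module"
  where "reduced_homology P le a p = quotient_module
    {c \<in> chain_space P le p. boundary c = 0}
    (boundary ` chain_space P le (p + 1))
    (\<lambda>g. basis_map (map (a g)))"


section \<open>Pointed set partitions\<close>

definition pointed_knapsack :: "nat multiset \<Rightarrow> nat \<Rightarrow> nat \<Rightarrow> bool"
  where "pointed_knapsack lam m n \<longleftrightarrow>
    0 \<notin># lam \<and> inj_on sum_mset {A. A \<subseteq># lam} \<and> sum_mset lam + m = n"

text \<open>The pair \<open>(Bs, Z)\<close> consists of the set of non-pointed blocks and the pointed block.\<close>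

type_synonym pset_partition = "nat set set \<times> nat set"

definition pset_partitions :: "nat \<Rightarrow> pset_partition set"
  where "pset_partitions n = {(Bs, Z). Z \<subseteq> {1..n} \<and> partition_on ({1..n} - Z) Bs}"

definition pset_type :: "pset_partition \<Rightarrow> nat multiset \<times> nat"
  where "pset_type = (\<lambda>(Bs, Z). (image_mset card (mset_set Bs), card Z))"

definition pset_le :: "pset_partition \<Rightarrow> pset_partition \<Rightarrow> bool"
  where "pset_le = (\<lambda>(Bs, Z) (Bs', Z'). (\<forall>B\<in>Bs. \<exists>B'\<in>insert Z' Bs'. B \<subseteq> B') \<and> Z \<subseteq> Z')"

definition pset_filter :: "nat multiset \<Rightarrow> nat \<Rightarrow> nat \<Rightarrow> pset_partition set"
  where "pset_filter lam m n =
    {\<pi> \<in> pset_partitions n. \<exists>\<rho>\<in>pset_partitions n. pset_type \<rho> = (lam, m) \<and> pset_le \<rho> \<pi>}"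

definition pset_top :: "nat \<Rightarrow> pset_partition"
  where "pset_top n = ({}, {1..n})"

definition pset_act :: "(nat \<Rightarrow> nat) \<Rightarrow> pset_partition \<Rightarrow> pset_partition"
  where "pset_act p = (\<lambda>(Bs, Z). ((`) p ` Bs, p ` Z))"


section \<open>Pointed compositions\<close>

definition pcompositions :: "nat \<Rightarrow> nat list set"
  where "pcompositions n = {c. c \<noteq> [] \<and> 0 \<notin> set (butlast c) \<and> sum_list c = n}"

definition pcomp_type :: "nat list \<Rightarrow> nat multiset \<times> nat"
  where "pcomp_type c = (mset (butlast c), last c)"

definition pcomp_le :: "nat list \<Rightarrow> nat list \<Rightarrow> bool"
  where "pcomp_le c d \<longleftrightarrow> (\<exists>runs. [] \<notin> set runs \<and> concat runs = c \<and> map sum_list runs = d)"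

definition pcomp_filter :: "nat multiset \<Rightarrow> nat \<Rightarrow> nat \<Rightarrow> nat list set"
  where "pcomp_filter lam m n =
    {d \<in> pcompositions n. \<exists>c\<in>pcompositions n. pcomp_type c = (lam, m) \<and> pcomp_le c d}"

definition V_comps :: "nat multiset \<Rightarrow> nat \<Rightarrow> nat \<Rightarrow> nat list set"
  where "V_comps lam m n = {d \<in> pcomp_filter lam m n. last d = m \<and>
    (\<forall>x\<in>set (butlast d). \<exists>S\<subseteq>set_mset lam. x = \<Sum>S)}"


section \<open>Border strips\<close>

text \<open>A cell is a pair (row, column), where the rows are numbered from the bottom, starting with 0.
  Read upwards, a skew shape in English notation moves to the right.\<close>

type_synonym shape = "(nat \<times> nat) set"

definition skew_shape :: "shape \<Rightarrow> bool"
  where "skew_shape B \<longleftrightarrow> (\<exists>r mu nu.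
    (\<forall>i<r. mu i \<le> nu i) \<and> (\<forall>i j. i \<le> j \<and> j < r \<longrightarrow> mu i \<le> mu j \<and> nu i \<le> nu j) \<and>
    B = {(i, j). i < r \<and> mu i \<le> j \<and> j < nu i})"

definition adjacent_cells :: "shape \<Rightarrow> ((nat \<times> nat) \<times> (nat \<times> nat)) set"
  where "adjacent_cells B = {((i, j), (i', j')). (i, j) \<in> B \<and> (i', j') \<in> B \<and>
    (i = i' \<and> (j' = Suc j \<or> j = Suc j') \<or> j = j' \<and> (i' = Suc i \<or> i = Suc i'))}"

definition connected_shape :: "shape \<Rightarrow> bool"
  where "connected_shape B \<longleftrightarrow> (\<forall>x\<in>B. \<forall>y\<in>B. (x, y) \<in> (adjacent_cells B)\<^sup>*)"

definition is_border_strip :: "nat list \<Rightarrow> shape \<Rightarrow> bool"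
  where "is_border_strip d B \<longleftrightarrow> skew_shape B \<and> connected_shape B \<and>
    (\<nexists>i j. {(i, j), (i, Suc j), (Suc i, j), (Suc i, Suc j)} \<subseteq> B) \<and>
    (\<forall>i. card {j. (i, j) \<in> B} = (if i < length d then d ! i else 0))"

text \<open>The normal form of the border strip, which is determined only up to translation: the bottom
  row starts in column 0 and each further row starts in the column where the row below it ends.\<close>

definition row_start :: "nat list \<Rightarrow> nat \<Rightarrow> nat"
  where "row_start d i = (\<Sum>l<i. d ! l - 1)"

definition border_strip :: "nat list \<Rightarrow> shape"
  where "border_strip d =
    {(i, j). i < length d \<and> row_start d i \<le> j \<and> j < row_start d i + d ! i}"

lemma row_start_Suc: "row_start d (Suc i) = row_start d i + (d ! i - 1)"
  by (simp add: row_start_def)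

lemma adjacent_cells_sym: "(x, y) \<in> (adjacent_cells B)\<^sup>* \<Longrightarrow> (y, x) \<in> (adjacent_cells B)\<^sup>*"
proof -
  have "sym (adjacent_cells B)"
    by (auto simp: sym_def adjacent_cells_def)
  then show "(x, y) \<in> (adjacent_cells B)\<^sup>* \<Longrightarrow> (y, x) \<in> (adjacent_cells B)\<^sup>*"
    by (meson sym_rtrancl symD)
qed

lemma is_border_strip_border_strip:
  assumes pos: "0 \<notin> set d"
  shows "is_border_strip d (border_strip d)"
proof -
  let ?B = "border_strip d"
  have d_pos: "0 < d ! i" if "i < length d" for i
    using that pos by (metis gr0I nth_mem)
  have start_mono: "row_start d i \<le> row_start d j" if "i \<le> j" for i j
    unfolding row_start_def by (rule sum_mono2) (use that in auto)
  have end_Suc: "row_start d i + d ! i \<le> row_start d (Suc i) + d ! Suc i" if "Suc i < length d" for i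
    using d_pos[of i] d_pos[of "Suc i"] that unfolding row_start_Suc by linarith
  have end_mono: "row_start d i + d ! i \<le> row_start d j + d ! j" if "i \<le> j" "j < length d" for i j
    using that
  proof (induction j rule: dec_induct)
    case (step j)
    then show ?case using end_Suc[of j] by linarith
  qed simp
  have skew: "skew_shape ?B"
    unfolding skew_shape_def border_strip_def
    by (intro exI[of _ "length d"] exI[of _ "row_start d"]
        exI[of _ "\<lambda>i. row_start d i + d ! i"] conjI allI impI refl)
      (simp_all add: start_mono end_mono)
  have row: "((i, row_start d i), (i, row_start d i + j)) \<in> (adjacent_cells ?B)\<^sup>*"
    if "i < length d" "j < d ! i" for i j
    using that(2)
  proof (induction j)
    case (Suc j)
    then have "((i, row_start d i + j), (i, row_start d i + Suc j)) \<in> adjacent_cells ?B"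
      using that(1) by (auto simp: adjacent_cells_def border_strip_def)
    with Suc show ?case
      by (simp add: rtrancl.rtrancl_into_rtrancl)
  qed auto
  have start: "((0, 0), (i, row_start d i)) \<in> (adjacent_cells ?B)\<^sup>*" if "i < length d" for i
    using that
  proof (induction i)
    case 0
    then show ?case by (simp add: row_start_def)
  next
    case (Suc i)
    have "((i, row_start d i), (i, row_start d (Suc i))) \<in> (adjacent_cells ?B)\<^sup>*"
      using row[of i "d ! i - 1"] Suc.prems d_pos[of i] by (simp add: row_start_Suc)
    moreover have "((i, row_start d (Suc i)), (Suc i, row_start d (Suc i))) \<in> adjacent_cells ?B"
      using Suc.prems d_pos[of i] d_pos[of "Suc i"]
      by (auto simp: adjacent_cells_def border_strip_def row_start_Suc)
    ultimately show ?case
      using Suc.IH Suc.prems rtrancl_trans rtrancl.rtrancl_into_rtrancl by fastforce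
  qed
  have "((0, 0), x) \<in> (adjacent_cells ?B)\<^sup>*" if "x \<in> ?B" for x
  proof -
    obtain i j where x: "x = (i, j)" by force
    then have ij: "i < length d" "row_start d i \<le> j" "j - row_start d i < d ! i"
      using that by (auto simp: border_strip_def)
    show ?thesis
      using rtrancl_trans[OF start[OF ij(1)] row[OF ij(1) ij(3)]] ij(2) x by simp
  qed
  then have conn: "connected_shape ?B"
    unfolding connected_shape_def by (blast intro: rtrancl_trans adjacent_cells_sym)
  have square: "\<nexists>i j. {(i, j), (i, Suc j), (Suc i, j), (Suc i, Suc j)} \<subseteq> ?B"
    by (auto simp: border_strip_def row_start_Suc)
  have "{j. (i, j) \<in> ?B} = (if i < length d then {row_start d i..<row_start d i + d ! i} else {})" for i
    by (auto simp: border_strip_def)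
  with skew conn square show ?thesis
    by (auto simp: is_border_strip_def)
qed

lemma is_border_strip_unique:
  assumes pos: "0 \<notin> set d" and B: "is_border_strip d B"
  shows "\<exists>a. B = (\<lambda>(i, j). (i, a + j)) ` border_strip d"
proof -
  have d_pos: "0 < d ! i" if "i < length d" for i
    using that pos by (metis gr0I nth_mem)
  obtain r mu nu where le: "\<And>i. i < r \<Longrightarrow> mu i \<le> nu i"
    and mono: "\<And>i j. i \<le> j \<Longrightarrow> j < r \<Longrightarrow> mu i \<le> mu j \<and> nu i \<le> nu j"
    and B_eq: "B = {(i, j). i < r \<and> mu i \<le> j \<and> j < nu i}"
    using B unfolding is_border_strip_def skew_shape_def by blast
  have conn: "connected_shape B"
    and square: "\<And>i j. \<not> {(i, j), (i, Suc j), (Suc i, j), (Suc i, Suc j)} \<subseteq> B"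
    and rows: "\<And>i. card {j. (i, j) \<in> B} = (if i < length d then d ! i else 0)"
    using B unfolding is_border_strip_def by blast+
  have row_set: "{j. (i, j) \<in> B} = (if i < r then {mu i..<nu i} else {})" for i
    by (auto simp: B_eq)
  have in_B: "i < length d" if "(i, j) \<in> B" for i j
    using rows[of i] that row_set[of i] by (auto split: if_splits)
  have i_less: "i < r" and nu: "nu i = mu i + d ! i" if "i < length d" for i
    using rows[of i] row_set[of i] d_pos[OF that] that le[of i] by (auto split: if_splits)
  have cell: "(i, mu i) \<in> B" if "i < length d" for i
    using i_less[OF that] nu[OF that] d_pos[OF that] by (auto simp: B_eq)
  have step: "mu (Suc i) = mu i + (d ! i - 1)" if i: "Suc i < length d" for i
  proof -
    have "((i, mu i), (Suc i, mu (Suc i))) \<in> (adjacent_cells B)\<^sup>*"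
      using conn cell[of i] cell[of "Suc i"] i by (auto simp: connected_shape_def)
    moreover have "fst y \<le> i \<or> (\<exists>j. (i, j) \<in> B \<and> (Suc i, j) \<in> B)"
      if "((i, mu i), y) \<in> (adjacent_cells B)\<^sup>*" for y
      using that
    proof (induction rule: rtrancl_induct)
      case (step y z)
      then show ?case
        by (auto simp: adjacent_cells_def not_less_eq_eq le_Suc_eq)
    qed simp
    ultimately obtain j where j: "(i, j) \<in> B" "(Suc i, j) \<in> B"
      by fastforce
    have m: "mu i \<le> mu (Suc i)" "nu i \<le> nu (Suc i)"
      using mono[of i "Suc i"] i_less[OF i] by auto
    have "\<not> Suc (mu (Suc i)) < nu i"
    proof
      assume "Suc (mu (Suc i)) < nu i"
      then have "{(i, mu (Suc i)), (i, Suc (mu (Suc i))), (Suc i, mu (Suc i)),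
          (Suc i, Suc (mu (Suc i)))} \<subseteq> B"
        using m i_less[OF i] by (auto simp: B_eq)
      with square show False by blast
    qed
    with j nu[of i] i show ?thesis
      by (auto simp: B_eq)
  qed
  have mu: "mu i = mu 0 + row_start d i" if "i < length d" for i
    using that by (induction i) (auto simp: row_start_Suc step, simp add: row_start_def)
  have "B = (\<lambda>(i, j). (i, mu 0 + j)) ` border_strip d"
  proof (intro equalityI subsetI)
    fix x assume x: "x \<in> B"
    obtain i j where ij: "x = (i, j)" by force
    have i: "i < length d" using in_B x ij by simp
    have "(i, j - mu 0) \<in> border_strip d" "j = mu 0 + (j - mu 0)"
      using x ij i mu[OF i] nu[OF i] by (auto simp: B_eq border_strip_def)
    then show "x \<in> (\<lambda>(i, j). (i, mu 0 + j)) ` border_strip d"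
      using ij by force
  next
    fix x assume "x \<in> (\<lambda>(i, j). (i, mu 0 + j)) ` border_strip d"
    then show "x \<in> B"
      using mu nu i_less by (fastforce simp: B_eq border_strip_def)
  qed
  then show ?thesis ..
qed


section \<open>Specht modules\<close>

definition tableaux :: "nat \<Rightarrow> shape \<Rightarrow> (nat \<times> nat \<Rightarrow> nat) set"
  where "tableaux n B = {t \<in> extensional B. bij_betw t B {1..n}}"

definition row_cells :: "shape \<Rightarrow> nat \<Rightarrow> (nat \<times> nat) set"
  where "row_cells B i = {x \<in> B. fst x = i}"

definition column_cells :: "shape \<Rightarrow> nat \<Rightarrow> (nat \<times> nat) set"
  where "column_cells B j = {x \<in> B. snd x = j}"

text \<open>The row equivalence class of \<open>t\<close>. The module $M^B$ is the subspace of \<open>tabloid \<Rightarrow>\<^sub>0 'k\<close> spanned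
  by the basis vectors belonging to the tabloids of shape \<open>B\<close>.\<close>

type_synonym tabloid = "(nat \<times> nat \<Rightarrow> nat) set"

definition tabloid :: "nat \<Rightarrow> shape \<Rightarrow> (nat \<times> nat \<Rightarrow> nat) \<Rightarrow> tabloid"
  where "tabloid n B t = {s \<in> tableaux n B. \<forall>i. s ` row_cells B i = t ` row_cells B i}"

definition tabloid_act :: "shape \<Rightarrow> (nat \<Rightarrow> nat) \<Rightarrow> tabloid \<Rightarrow> tabloid"
  where "tabloid_act B p T = compose B p ` T"

definition column_stabilizer :: "nat \<Rightarrow> shape \<Rightarrow> (nat \<times> nat \<Rightarrow> nat) \<Rightarrow> (nat \<Rightarrow> nat) set"
  where "column_stabilizer n B t = {p. p permutes {1..n} \<and>
    (\<forall>j. p ` t ` column_cells B j = t ` column_cells B j)}"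

definition polytabloid :: "nat \<Rightarrow> shape \<Rightarrow> (nat \<times> nat \<Rightarrow> nat) \<Rightarrow> (tabloid \<Rightarrow>\<^sub>0 'k::field)"
  where "polytabloid n B t = (\<Sum>p\<in>column_stabilizer n B t.
    Poly_Mapping.single (tabloid_act B p (tabloid n B t)) (of_int (sign p)))"

definition specht_module :: "nat \<Rightarrow> shape \<Rightarrow> ('k::field, tabloid \<Rightarrow>\<^sub>0 'k) sym_module"
  where "specht_module n B = \<lparr>
    space = free_vs.span (polytabloid n B ` tableaux n B),
    add = (+),
    scale = fscale,
    act = (\<lambda>p. basis_map (tabloid_act B p))\<rparr>"

end

theory Submission
  imports Defs
begin

text \<open>Ordered pointed set partitions, together with the maps that merge two adjacent blocks, form a bar
  complex. An ordered partition is sent to the signed sum of the chains that arise by merging adjacent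
  blocks one after another. On cycles of top degree this is an isomorphism onto the top homology
  group; its inverse reads off, up to a sign, the coefficients of the chains along which the pointed
  block absorbs the other blocks one by one.

  A cycle of top degree has a component for each word \<open>w\<close> in the parts of \<open>\<lambda>\<close>. An element \<open>d\<close> of \<open>V\<close>
  amounts to a word together with a decomposition into strictly increasing runs, and merging the
  component of the word along these runs gives a map to ordered partitions of type \<open>d\<close>. If the elements
  of \<open>V\<close> are ordered by the number of inversions of the word and then by the number of runs, these maps
  define a filtration with factors the common kernels of the merging maps on ordered partitions of
  type \<open>d\<close>, and it splits by Maschke's theorem. Such a kernel is the Specht module of \<open>B(d)\<close>, because
  the leading term of any of its elements is the leading term of a standard polytabloid.\<close>

text \<open>The face of a chain that drops its first element forgets which block was split, and only
  the block sizes can tell. Distinct submultisets of \<lambda> have distinct sums, so that the sizes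
  determine which block of a merged partition has to be split; the single condition that such a face
  puts on a top cycle then becomes a separate condition for each merging position. The same
  injectivity lets a composition in V determine its word and its runs.

  A chain that joins two non-pointed blocks does not record their order. In a chain along which the
  pointed block absorbs the others the whole order is visible, which is why the coefficients of
  these chains can serve as coordinates. The price is that the two orders of a joined pair always
  occur together, so that a factor 2 has to be removed. This and the cancellation of sums that equal
  their own negatives are, besides the averaging in Maschke's theorem, the places where the
  invertibility of n! is used.\<close>

section \<open>Linear maps between free vector spaces\<close>

abbreviation flin :: "(('x \<Rightarrow>\<^sub>0 'k::field) \<Rightarrow> ('y \<Rightarrow>\<^sub>0 'k)) \<Rightarrow> bool"
  where "flin \<equiv> Vector_Spaces.linear fscale fscale"

lemma flinI:
  assumes "\<And>v w. f (v + w) = f v + f w" "\<And>c v. f (fscale c v) = fscale c (f v)"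
  shows "flin f"
  unfolding linear_iff_module_hom module_hom_def module_hom_axioms_def
  using assms by (auto intro: free_vs.module_axioms)

lemma flin_add: "flin f \<Longrightarrow> f (v + w) = f v + f w"
  and flin_scale: "flin f \<Longrightarrow> f (fscale c v) = fscale c (f v)"
  and flin_0: "flin f \<Longrightarrow> f 0 = 0"
  and flin_diff: "flin f \<Longrightarrow> f (v - w) = f v - f w"
  and flin_neg: "flin f \<Longrightarrow> f (- v) = - f v"
  and flin_sum: "flin f \<Longrightarrow> f (sum h I) = (\<Sum>i\<in>I. f (h i))"
  unfolding linear_iff_module_hom
  by (simp_all add: module_hom.add module_hom.scale module_hom.zero module_hom.diff
      module_hom.neg module_hom.sum)

lemma fscale_simps [simp]: "fscale 0 v = 0" "fscale 1 v = v" "fscale c 0 = 0"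
  "fscale (- c) v = - fscale c v" "fscale c (fscale b v) = fscale (c * b) v"
  by (rule poly_mapping_eqI; simp)+

lemma fscale_single [simp]: "fscale c (Poly_Mapping.single x b) = Poly_Mapping.single x (c * b)"
  by (rule poly_mapping_eqI) (simp add: lookup_single when_def)

lemma lookup_sum': "Poly_Mapping.lookup (sum h I) x = (\<Sum>i\<in>I. Poly_Mapping.lookup (h i) x)"
  by (induction I rule: infinite_finite_induct) (auto simp: lookup_add)

lemma lin_ext_superset:
  assumes "finite A" "Poly_Mapping.keys v \<subseteq> A"
  shows "lin_ext f v = (\<Sum>x\<in>A. fscale (Poly_Mapping.lookup v x) (f x))"
  unfolding lin_ext_def using assms
  by (intro sum.mono_neutral_left) (auto simp: in_keys_iff)

lemma flin_lin_ext [simp]: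
  fixes f :: "'x \<Rightarrow> ('y \<Rightarrow>\<^sub>0 'b::field)"
  shows "flin (lin_ext f)"
proof (rule flinI)
  fix v w :: "'x \<Rightarrow>\<^sub>0 'b"
  let ?A = "Poly_Mapping.keys v \<union> Poly_Mapping.keys w"
  have "finite ?A" "Poly_Mapping.keys (v + w) \<subseteq> ?A"
    by (simp_all add: Poly_Mapping.keys_add)
  then show "lin_ext f (v + w) = lin_ext f v + lin_ext f w"
    by (simp add: lin_ext_superset[of ?A] lookup_add free_vs.scale_left_distrib sum.distrib)
next
  fix c :: 'b and v :: "'x \<Rightarrow>\<^sub>0 'b"
  have "Poly_Mapping.keys (fscale c v) \<subseteq> Poly_Mapping.keys v"
    by (auto simp: in_keys_iff)
  then show "lin_ext f (fscale c v) = fscale c (lin_ext f v)"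
    by (simp add: lin_ext_superset[of "Poly_Mapping.keys v"] free_vs.scale_sum_right)
qed

lemma flin_basis_map [simp]: "flin (basis_map f)"
  by (simp add: basis_map_def)

lemmas lin_ext_simps = flin_add[OF flin_lin_ext] flin_scale[OF flin_lin_ext] flin_0[OF flin_lin_ext]
  flin_diff[OF flin_lin_ext] flin_neg[OF flin_lin_ext] flin_sum[OF flin_lin_ext]

lemmas basis_map_simps = flin_add[OF flin_basis_map] flin_scale[OF flin_basis_map]
  flin_0[OF flin_basis_map] flin_diff[OF flin_basis_map] flin_neg[OF flin_basis_map]
  flin_sum[OF flin_basis_map]

lemma lin_ext_single [simp]: "lin_ext f (Poly_Mapping.single x c) = fscale c (f x)"
  using lin_ext_superset[of "{x}" "Poly_Mapping.single x c" f] by simp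

lemma basis_map_single [simp]: "basis_map f (Poly_Mapping.single x c) = Poly_Mapping.single (f x) c"
  by (simp add: basis_map_def)

lemma lin_ext_cong:
  "v = w \<Longrightarrow> (\<And>x. x \<in> Poly_Mapping.keys w \<Longrightarrow> f x = g x) \<Longrightarrow> lin_ext f v = lin_ext g w"
  by (simp add: lin_ext_def)

lemma basis_map_cong:
  "v = w \<Longrightarrow> (\<And>x. x \<in> Poly_Mapping.keys w \<Longrightarrow> f x = g x) \<Longrightarrow> basis_map f v = basis_map g w"
  by (simp add: basis_map_def lin_ext_def)

lemma poly_mapping_sum_single:
  assumes "finite A" "Poly_Mapping.keys v \<subseteq> A"
  shows "v = (\<Sum>x\<in>A. Poly_Mapping.single x (Poly_Mapping.lookup v x))"
proof (rule poly_mapping_eqI)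
  fix y
  show "Poly_Mapping.lookup v y =
      Poly_Mapping.lookup (\<Sum>x\<in>A. Poly_Mapping.single x (Poly_Mapping.lookup v x)) y"
    using assms by (auto simp: lookup_sum' lookup_single when_def in_keys_iff sum.delta')
qed

lemma flin_eqI:
  fixes f g :: "('x \<Rightarrow>\<^sub>0 'k::field) \<Rightarrow> ('y \<Rightarrow>\<^sub>0 'k)"
  assumes f: "flin f" and g: "flin g"
    and eq: "\<And>x. x \<in> Poly_Mapping.keys v \<Longrightarrow> f (Poly_Mapping.single x 1) = g (Poly_Mapping.single x 1)"
  shows "f v = g v"
proof -
  let ?K = "Poly_Mapping.keys v"
  have v: "v = (\<Sum>x\<in>?K. fscale (Poly_Mapping.lookup v x) (Poly_Mapping.single x 1))"
    using poly_mapping_sum_single[of ?K v] by simp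
  show ?thesis
    by (subst (1 2) v) (simp only: flin_sum[OF f] flin_sum[OF g] flin_scale[OF f] flin_scale[OF g] eq
        cong: sum.cong)
qed

lemma flin_compose: "flin f \<Longrightarrow> flin g \<Longrightarrow> flin (\<lambda>v. f (g v))"
  by (rule flinI) (simp_all add: flin_add flin_scale)

lemma flin_id [simp]: "flin (\<lambda>v. v)"
  by (rule flinI) simp_all

lemma lin_ext_lin_ext: "lin_ext f (lin_ext g v) = lin_ext (\<lambda>x. lin_ext f (g x)) v"
  by (rule flin_eqI[where f = "\<lambda>v. lin_ext f (lin_ext g v)"]) (simp_all add: flin_compose)

lemma lin_ext_basis_map: "lin_ext f (basis_map g v) = lin_ext (\<lambda>x. f (g x)) v"
  by (simp add: basis_map_def lin_ext_lin_ext)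

lemma basis_map_lin_ext: "basis_map f (lin_ext g v) = lin_ext (\<lambda>x. basis_map f (g x)) v"
  by (simp add: basis_map_def lin_ext_lin_ext)

lemma basis_map_basis_map: "basis_map f (basis_map g v) = basis_map (\<lambda>x. f (g x)) v"
  by (simp add: basis_map_def lin_ext_lin_ext)

lemma basis_map_id: "basis_map (\<lambda>x. x) v = v"
  by (rule flin_eqI) simp_all

lemma lookup_lin_ext:
  assumes "finite A" "Poly_Mapping.keys v \<subseteq> A"
  shows "Poly_Mapping.lookup (lin_ext f v) y
    = (\<Sum>x\<in>A. Poly_Mapping.lookup v x * Poly_Mapping.lookup (f x) y)"
  by (simp add: lin_ext_superset[OF assms] lookup_sum')

lemma lookup_basis_map:
  assumes "finite A" "Poly_Mapping.keys v \<subseteq> A"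
  shows "Poly_Mapping.lookup (basis_map f v) y = (\<Sum>x | x \<in> A \<and> f x = y. Poly_Mapping.lookup v x)"
proof -
  have "Poly_Mapping.lookup (basis_map f v) y
      = (\<Sum>x\<in>A. if f x = y then Poly_Mapping.lookup v x else 0)"
    unfolding basis_map_def lookup_lin_ext[OF assms]
    by (intro sum.cong) (auto simp: lookup_single when_def)
  also have "\<dots> = (\<Sum>x | x \<in> A \<and> f x = y. Poly_Mapping.lookup v x)"
    using assms(1) by (simp add: sum.inter_filter)
  finally show ?thesis .
qed

lemma keys_lin_ext: "Poly_Mapping.keys (lin_ext f v) \<subseteq> (\<Union>x\<in>Poly_Mapping.keys v. Poly_Mapping.keys (f x))"
proof
  fix y assume "y \<in> Poly_Mapping.keys (lin_ext f v)"
  then have "(\<Sum>x\<in>Poly_Mapping.keys v. Poly_Mapping.lookup v x * Poly_Mapping.lookup (f x) y) \<noteq> 0"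
    using lookup_lin_ext[of "Poly_Mapping.keys v" v f y] by (simp add: in_keys_iff)
  then obtain x where "x \<in> Poly_Mapping.keys v"
    "Poly_Mapping.lookup v x * Poly_Mapping.lookup (f x) y \<noteq> 0"
    by (rule sum.not_neutral_contains_not_neutral)
  then show "y \<in> (\<Union>x\<in>Poly_Mapping.keys v. Poly_Mapping.keys (f x))"
    by (auto simp: in_keys_iff)
qed

lemma keys_basis_map: "Poly_Mapping.keys (basis_map f v) \<subseteq> f ` Poly_Mapping.keys v"
  unfolding basis_map_def using keys_lin_ext[of "\<lambda>x. Poly_Mapping.single (f x) 1" v] by auto

lemma lookup_basis_map_inj:
  assumes "inj f"
  shows "Poly_Mapping.lookup (basis_map f v) (f x) = Poly_Mapping.lookup v x"
proof -
  have "{y \<in> insert x (Poly_Mapping.keys v). f y = f x} = {x}"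
    using assms by (auto dest: injD)
  then show ?thesis
    using lookup_basis_map[of "insert x (Poly_Mapping.keys v)" v f "f x"] by auto
qed

section \<open>Submodules, isomorphisms and direct sums\<close>

definition fmodule :: "('x \<Rightarrow>\<^sub>0 'k::field) set \<Rightarrow> ((nat \<Rightarrow> nat) \<Rightarrow> ('x \<Rightarrow>\<^sub>0 'k) \<Rightarrow> ('x \<Rightarrow>\<^sub>0 'k))
    \<Rightarrow> ('k, 'x \<Rightarrow>\<^sub>0 'k) sym_module"
  where "fmodule U a = \<lparr>space = U, add = (+), scale = fscale, act = a\<rparr>"

lemma fmodule_sel [simp]: "space (fmodule U a) = U" "add (fmodule U a) = (+)"
  "scale (fmodule U a) = fscale" "act (fmodule U a) = a"
  by (simp_all add: fmodule_def)

lemma direct_sum_sel [simp]: "space (direct_sum I M) = (\<Pi>\<^sub>E i\<in>I. space (M i))"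
  "add (direct_sum I M) = (\<lambda>x y. \<lambda>i\<in>I. add (M i) (x i) (y i))"
  "scale (direct_sum I M) = (\<lambda>c x. \<lambda>i\<in>I. scale (M i) c (x i))"
  "act (direct_sum I M) = (\<lambda>p x. \<lambda>i\<in>I. act (M i) p (x i))"
  by (simp_all add: direct_sum_def)

text \<open>Nothing in \<open>sym_module\<close> forces the operations to stay in the carrier, and
  the inverse of an isomorphism is compatible with them only where they do.\<close>

definition closed_module :: "nat \<Rightarrow> ('k::field, 'v) sym_module \<Rightarrow> bool"
  where "closed_module n M \<longleftrightarrow> (\<forall>x\<in>space M. \<forall>y\<in>space M. add M x y \<in> space M) \<and>
    (\<forall>c. \<forall>x\<in>space M. scale M c x \<in> space M) \<and>
    (\<forall>p. p permutes {1..n} \<longrightarrow> (\<forall>x\<in>space M. act M p x \<in> space M))"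

lemma sym_module_iso_trans:
  assumes "sym_module_iso n M N" "sym_module_iso n N L"
  shows "sym_module_iso n M L"
proof -
  obtain f where f: "bij_betw f (space M) (space N)"
    "\<forall>x\<in>space M. \<forall>y\<in>space M. f (add M x y) = add N (f x) (f y)"
    "\<forall>c. \<forall>x\<in>space M. f (scale M c x) = scale N c (f x)"
    "\<forall>p. p permutes {1..n} \<longrightarrow> (\<forall>x\<in>space M. f (act M p x) = act N p (f x))"
    using assms(1) unfolding sym_module_iso_def by blast
  obtain g where g: "bij_betw g (space N) (space L)"
    "\<forall>x\<in>space N. \<forall>y\<in>space N. g (add N x y) = add L (g x) (g y)"
    "\<forall>c. \<forall>x\<in>space N. g (scale N c x) = scale L c (g x)"
    "\<forall>p. p permutes {1..n} \<longrightarrow> (\<forall>x\<in>space N. g (act N p x) = act L p (g x))"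
    using assms(2) unfolding sym_module_iso_def by blast
  have "f x \<in> space N" if "x \<in> space M" for x
    using f(1) that by (auto simp: bij_betw_def)
  then show ?thesis
    unfolding sym_module_iso_def using f g
    by (intro exI[of _ "g \<circ> f"] conjI) (auto intro: bij_betw_trans)
qed

lemma sym_module_iso_sym:
  assumes "sym_module_iso n M N" "closed_module n M"
  shows "sym_module_iso n N M"
proof -
  obtain f where f: "bij_betw f (space M) (space N)"
    "\<forall>x\<in>space M. \<forall>y\<in>space M. f (add M x y) = add N (f x) (f y)"
    "\<forall>c. \<forall>x\<in>space M. f (scale M c x) = scale N c (f x)"
    "\<forall>p. p permutes {1..n} \<longrightarrow> (\<forall>x\<in>space M. f (act M p x) = act N p (f x))"
    using assms(1) unfolding sym_module_iso_def by blast
  let ?g = "the_inv_into (space M) f"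
  have inj: "inj_on f (space M)" and gin: "\<And>x. x \<in> space N \<Longrightarrow> ?g x \<in> space M"
    and fg: "\<And>x. x \<in> space N \<Longrightarrow> f (?g x) = x"
    using f(1) by (auto simp: bij_betw_def the_inv_into_into f_the_inv_into_f)
  have eq: "?g y = x" if "x \<in> space M" "f x = y" for x y
    using the_inv_into_f_f[OF inj that(1)] that(2) by simp
  show ?thesis
    unfolding sym_module_iso_def
  proof (intro exI[of _ ?g] conjI ballI allI impI)
    show "bij_betw ?g (space N) (space M)"
      by (rule bij_betw_the_inv_into[OF f(1)])
  qed (use assms(2) f(2-4) gin fg in \<open>auto simp: closed_module_def intro!: eq\<close>)
qed

lemma sym_module_iso_direct_sum:
  assumes "\<And>i. i \<in> I \<Longrightarrow> sym_module_iso n (M i) (N i)"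
    and "\<And>i. i \<in> I \<Longrightarrow> closed_module n (M i)"
  shows "sym_module_iso n (direct_sum I M) (direct_sum I N)"
proof -
  have "\<forall>i\<in>I. \<exists>f. bij_betw f (space (M i)) (space (N i)) \<and>
    (\<forall>x\<in>space (M i). \<forall>y\<in>space (M i). f (add (M i) x y) = add (N i) (f x) (f y)) \<and>
    (\<forall>c. \<forall>x\<in>space (M i). f (scale (M i) c x) = scale (N i) c (f x)) \<and>
    (\<forall>p. p permutes {1..n} \<longrightarrow> (\<forall>x\<in>space (M i). f (act (M i) p x) = act (N i) p (f x)))"
    using assms(1) by (simp add: sym_module_iso_def)
  from bchoice[OF this] obtain f where "\<forall>i\<in>I. bij_betw (f i) (space (M i)) (space (N i)) \<and>
    (\<forall>x\<in>space (M i). \<forall>y\<in>space (M i). f i (add (M i) x y) = add (N i) (f i x) (f i y)) \<and>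
    (\<forall>c. \<forall>x\<in>space (M i). f i (scale (M i) c x) = scale (N i) c (f i x)) \<and>
    (\<forall>p. p permutes {1..n} \<longrightarrow> (\<forall>x\<in>space (M i). f i (act (M i) p x) = act (N i) p (f i x)))"
    by (elim exE)
  then have f: "\<And>i. i \<in> I \<Longrightarrow> bij_betw (f i) (space (M i)) (space (N i))"
    "\<And>i x y. i \<in> I \<Longrightarrow> x\<in>space (M i) \<Longrightarrow> y\<in>space (M i) \<Longrightarrow> f i (add (M i) x y) = add (N i) (f i x) (f i y)"
    "\<And>i c x. i \<in> I \<Longrightarrow> x\<in>space (M i) \<Longrightarrow> f i (scale (M i) c x) = scale (N i) c (f i x)"
    "\<And>i p x. i \<in> I \<Longrightarrow> p permutes {1..n} \<Longrightarrow> x\<in>space (M i) \<Longrightarrow> f i (act (M i) p x) = act (N i) p (f i x)"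
    by simp_all
  have "bij_betw (\<lambda>x. \<lambda>i\<in>I. f i (x i)) (\<Pi>\<^sub>E i\<in>I. space (M i)) (\<Pi>\<^sub>E i\<in>I. space (N i))"
  proof (rule bij_betw_byWitness[where f' = "\<lambda>y. \<lambda>i\<in>I. the_inv_into (space (M i)) (f i) (y i)"])
    show "\<forall>a\<in>\<Pi>\<^sub>E i\<in>I. space (M i).
       (\<lambda>i\<in>I. the_inv_into (space (M i)) (f i) ((\<lambda>i\<in>I. f i (a i)) i)) = a"
      using f(1) by (auto simp: bij_betw_def PiE_def Pi_def extensional_def the_inv_into_f_f)
    show "\<forall>a\<in>\<Pi>\<^sub>E i\<in>I. space (N i).
       (\<lambda>i\<in>I. f i ((\<lambda>i\<in>I. the_inv_into (space (M i)) (f i) (a i)) i)) = a"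
      using f(1) by (auto simp: bij_betw_def PiE_def Pi_def extensional_def f_the_inv_into_f)
    show "(\<lambda>x. \<lambda>i\<in>I. f i (x i)) ` (\<Pi>\<^sub>E i\<in>I. space (M i)) \<subseteq> (\<Pi>\<^sub>E i\<in>I. space (N i))"
      using f(1) by (fastforce simp: PiE_def Pi_def dest: bij_betw_apply)
    show "(\<lambda>y. \<lambda>i\<in>I. the_inv_into (space (M i)) (f i) (y i)) ` (\<Pi>\<^sub>E i\<in>I. space (N i))
        \<subseteq> (\<Pi>\<^sub>E i\<in>I. space (M i))"
      using f(1) by (auto simp: bij_betw_def PiE_def Pi_def the_inv_into_into)
  qed
  then show ?thesis
    unfolding sym_module_iso_def direct_sum_sel
    by (intro exI[of _ "\<lambda>x. \<lambda>i\<in>I. f i (x i)"] conjI) (auto simp: f(2-4) PiE_def Pi_def intro!: restrict_ext)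
qed

section \<open>Equivariant sections\<close>

definition stable :: "nat \<Rightarrow> ((nat \<Rightarrow> nat) \<Rightarrow> ('x \<Rightarrow>\<^sub>0 'k) \<Rightarrow> ('x \<Rightarrow>\<^sub>0 'k)) \<Rightarrow> ('x \<Rightarrow>\<^sub>0 'k::field) set \<Rightarrow> bool"
  where "stable n a U \<longleftrightarrow> free_vs.subspace U \<and> (\<forall>p. p permutes {1..n} \<longrightarrow> (\<forall>u\<in>U. a p u \<in> U))"

lemma closed_fmodule: "stable n a U \<Longrightarrow> closed_module n (fmodule U a)"
  by (auto simp: closed_module_def stable_def free_vs.subspace_add free_vs.subspace_scale)

locale perm_rep =
  fixes n :: nat and a :: "(nat \<Rightarrow> nat) \<Rightarrow> ('x \<Rightarrow>\<^sub>0 'k::field) \<Rightarrow> ('x \<Rightarrow>\<^sub>0 'k)"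
  assumes lin: "\<And>p. flin (a p)"
    and comp: "\<And>p q v. a (p \<circ> q) v = a p (a q v)"
    and id: "\<And>v. a id v = v"
    and inv_fact: "of_nat (fact n) \<noteq> (0 :: 'k)"
begin

text \<open>A linear right inverse g of f on W with values in U becomes equivariant when its
  conjugates are averaged over the group. It remains a section on W because W is stable and f is
  equivariant: each of the n! summands is already mapped to w.\<close>

lemma maschke_section:
  fixes f :: "('x \<Rightarrow>\<^sub>0 'k) \<Rightarrow> ('x \<Rightarrow>\<^sub>0 'k)"
  assumes f: "flin f" and equiv: "\<And>p v. p permutes {1..n} \<Longrightarrow> f (a p v) = a p (f v)"
    and U: "stable n a U" and W: "stable n a W" and sur: "W \<subseteq> f ` U"
  obtains s where "flin s" "\<And>p v. p permutes {1..n} \<Longrightarrow> s (a p v) = a p (s v)"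
    "\<And>w. s w \<in> U" "\<And>w. w \<in> W \<Longrightarrow> f (s w) = w"
proof -
  interpret vector_space_pair "fscale :: 'k \<Rightarrow> ('x \<Rightarrow>\<^sub>0 'k) \<Rightarrow> _" "fscale :: 'k \<Rightarrow> ('x \<Rightarrow>\<^sub>0 'k) \<Rightarrow> _"
    by unfold_locales
  obtain g where g: "range g \<subseteq> U" "flin g" "\<And>v. v \<in> W \<Longrightarrow> f (g v) = v"
    using linear_exists_right_inverse_on[OF f, of U] U sur unfolding stable_def by blast
  let ?P = "{p. p permutes {1..n}}"
  define c :: 'k where "c = inverse (of_nat (fact n))"
  define s where "s = (\<lambda>v. fscale c (\<Sum>p\<in>?P. a p (g (a (inv p) v))))"
  have fin: "finite ?P" and card: "card ?P = fact n"
    using card_permutations[of "{1..n}" n] by (auto simp: finite_permutations)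
  have "flin s"
    by (rule flinI) (simp_all add: s_def flin_add[OF lin] flin_scale[OF lin] flin_add[OF g(2)]
        flin_scale[OF g(2)] sum.distrib free_vs.scale_right_distrib free_vs.scale_sum_right mult.commute)
  moreover have "s (a q v) = a q (s v)" if q: "q permutes {1..n}" for q v
  proof -
    have "(\<Sum>p\<in>?P. a p (g (a (inv p) (a q v)))) = (\<Sum>p\<in>?P. a (q \<circ> p) (g (a (inv p) v)))"
    proof (rule sum.reindex_bij_witness[of _ "\<lambda>p. q \<circ> p" "\<lambda>p. inv q \<circ> p"])
      fix p assume "p \<in> ?P"
      then have p: "p permutes {1..n}" by simp
      have qq: "q \<circ> inv q = id" "inv q \<circ> q = id"
        using permutes_inv_o[OF q] by simp_all
      show "q \<circ> (inv q \<circ> p) = p" "inv q \<circ> (q \<circ> p) = p"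
        by (simp_all add: o_assoc qq)
      show "inv q \<circ> p \<in> ?P" "q \<circ> p \<in> ?P"
        using p q by (auto intro: permutes_compose permutes_inv)
      have "inv (inv q \<circ> p) = inv p \<circ> q"
        using o_inv_distrib[OF permutes_bij[OF permutes_inv[OF q]] permutes_bij[OF p]]
          inv_inv_eq[OF permutes_bij[OF q]] by simp
      then show "a (q \<circ> (inv q \<circ> p)) (g (a (inv (inv q \<circ> p)) v)) = a p (g (a (inv p) (a q v)))"
        by (simp add: o_assoc qq comp)
    qed
    then show ?thesis
      by (simp add: s_def flin_scale[OF lin] flin_sum[OF lin] comp)
  qed
  moreover have "s w \<in> U" for w
    unfolding s_def using U g(1)
    by (auto simp: stable_def intro!: free_vs.subspace_scale free_vs.subspace_sum)
  moreover have "f (s w) = w" if w: "w \<in> W" for w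
  proof -
    have "f (a p (g (a (inv p) w))) = w" if p: "p \<in> ?P" for p
    proof -
      have "a (inv p) w \<in> W"
        using W w p by (auto simp: stable_def permutes_inv)
      then have "f (a p (g (a (inv p) w))) = a (p \<circ> inv p) w"
        using p equiv g(3) by (simp add: comp)
      also have "\<dots> = w"
        using p by (simp add: permutes_inv_o id)
      finally show ?thesis .
    qed
    then have "f (s w) = fscale c (\<Sum>p\<in>?P. w)"
      by (simp add: s_def flin_scale[OF f] flin_sum[OF f])
    also have "(\<Sum>p\<in>?P. w) = fscale (of_nat (fact n)) w"
      by (rule poly_mapping_eqI) (simp only: lookup_sum' sum_constant card lookup_fscale)
    finally show ?thesis
      using inv_fact by (simp add: c_def)
  qed
  ultimately show thesis using that by blast
qed

text \<open>The subspaces of \<open>X\<close> on which all \<open>\<Phi> j\<close> of smaller weight vanish form a filtration with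
  factors \<open>S i\<close>; it splits by Maschke's theorem.\<close>

lemma filtration_direct_sum:
  fixes \<Phi> :: "'i \<Rightarrow> ('x \<Rightarrow>\<^sub>0 'k) \<Rightarrow> ('x \<Rightarrow>\<^sub>0 'k)" and \<kappa> :: "'i \<Rightarrow> nat"
  assumes fin: "finite I" and X: "stable n a X" and S: "\<And>i. i \<in> I \<Longrightarrow> stable n a (S i)"
    and \<Phi>: "\<And>i. i \<in> I \<Longrightarrow> flin (\<Phi> i)"
    and equiv: "\<And>i p v. i \<in> I \<Longrightarrow> p permutes {1..n} \<Longrightarrow> \<Phi> i (a p v) = a p (\<Phi> i v)"
    and into: "\<And>i x. i \<in> I \<Longrightarrow> x \<in> X \<Longrightarrow> (\<And>j. j \<in> I \<Longrightarrow> \<kappa> j < \<kappa> i \<Longrightarrow> \<Phi> j x = 0) \<Longrightarrow> \<Phi> i x \<in> S i"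
    and lift: "\<And>i y. i \<in> I \<Longrightarrow> y \<in> S i \<Longrightarrow>
      \<exists>x\<in>X. \<Phi> i x = y \<and> (\<forall>j\<in>I. j \<noteq> i \<longrightarrow> \<kappa> j \<le> \<kappa> i \<longrightarrow> \<Phi> j x = 0)"
    and sep: "\<And>x. x \<in> X \<Longrightarrow> (\<And>i. i \<in> I \<Longrightarrow> \<Phi> i x = 0) \<Longrightarrow> x = 0"
  shows "sym_module_iso n (direct_sum I (\<lambda>i. fmodule (S i) a)) (fmodule X a)"
proof -
  \<comment> \<open>Lifting into \<open>Y i\<close> makes the matrix of the maps \<Phi> j \<circ> s
    i unitriangular: an entry off the diagonal can be nonzero only if \<kappa> j > \<kappa>
    i.\<close>
  define Y where "Y i = {x \<in> X. \<forall>j\<in>I. j \<noteq> i \<longrightarrow> \<kappa> j \<le> \<kappa> i \<longrightarrow> \<Phi> j x = 0}" for i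
  have Y: "stable n a (Y i)" for i
    using X equiv unfolding stable_def Y_def free_vs.subspace_def
    by (auto simp: flin_0[OF \<Phi>] flin_add[OF \<Phi>] flin_scale[OF \<Phi>] flin_0[OF lin])
  have "\<exists>s. flin s \<and> (\<forall>p v. p permutes {1..n} \<longrightarrow> s (a p v) = a p (s v)) \<and>
      (\<forall>w. s w \<in> Y i) \<and> (\<forall>w\<in>S i. \<Phi> i (s w) = w)" if i: "i \<in> I" for i
  proof -
    have "S i \<subseteq> \<Phi> i ` Y i"
    proof
      fix y assume "y \<in> S i"
      with lift[OF i] obtain x where "x \<in> X" "\<Phi> i x = y" "\<forall>j\<in>I. j \<noteq> i \<longrightarrow> \<kappa> j \<le> \<kappa> i \<longrightarrow> \<Phi> j x = 0"
        by blast
      then show "y \<in> \<Phi> i ` Y i"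
        by (auto simp: Y_def)
    qed
    then obtain t where "flin t" "\<And>p v. p permutes {1..n} \<Longrightarrow> t (a p v) = a p (t v)"
      "\<And>w. t w \<in> Y i" "\<And>w. w \<in> S i \<Longrightarrow> \<Phi> i (t w) = w"
      using maschke_section[OF \<Phi>[OF i] equiv[OF i] Y S[OF i]] by metis
    then show ?thesis
      by (intro exI[of _ t]) simp
  qed
  then have "\<forall>i\<in>I. \<exists>s. flin s \<and> (\<forall>p v. p permutes {1..n} \<longrightarrow> s (a p v) = a p (s v)) \<and>
      (\<forall>w. s w \<in> Y i) \<and> (\<forall>w\<in>S i. \<Phi> i (s w) = w)" by (intro ballI)
  from bchoice[OF this] obtain s where "\<forall>i\<in>I. flin (s i) \<and>
      (\<forall>p v. p permutes {1..n} \<longrightarrow> s i (a p v) = a p (s i v)) \<and>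
      (\<forall>w. s i w \<in> Y i) \<and> (\<forall>w\<in>S i. \<Phi> i (s i w) = w)"
    by (elim exE)
  then have s: "\<And>i. i \<in> I \<Longrightarrow> flin (s i)"
    "\<And>i p v. i \<in> I \<Longrightarrow> p permutes {1..n} \<Longrightarrow> s i (a p v) = a p (s i v)"
    "\<And>i w. i \<in> I \<Longrightarrow> s i w \<in> Y i" "\<And>i w. i \<in> I \<Longrightarrow> w \<in> S i \<Longrightarrow> \<Phi> i (s i w) = w"
    by simp_all
  have sX: "s i w \<in> X" if "i \<in> I" for i w
    using s(3)[OF that] by (auto simp: Y_def)
  have s0: "\<Phi> j (s i w) = 0" if "i \<in> I" "j \<in> I" "j \<noteq> i" "\<kappa> j \<le> \<kappa> i" for i j w
    using s(3)[OF that(1)] that by (auto simp: Y_def)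
  define h where "h y = (\<Sum>i\<in>I. s i (y i))" for y
  have hX: "h y \<in> X" for y
    unfolding h_def using X sX by (auto simp: stable_def intro: free_vs.subspace_sum)
  have zero: "\<forall>i\<in>I. y i = 0" if h0: "h y = 0" and yS: "\<And>i. i \<in> I \<Longrightarrow> y i \<in> S i" for y
  proof (rule ccontr)
    assume "\<not> ?thesis"
    then have "\<exists>i. i \<in> I \<and> y i \<noteq> 0" by blast
    \<comment> \<open>At an index of least weight among the nonzero components, \<Phi> i kills all
      the other summands of \<open>h y\<close> and returns \<open>y i\<close>.\<close>
    then obtain i where i: "i \<in> I" "y i \<noteq> 0" and least: "\<And>j. j \<in> I \<Longrightarrow> y j \<noteq> 0 \<Longrightarrow> \<kappa> i \<le> \<kappa> j"
      using ex_has_least_nat[of "\<lambda>i. i \<in> I \<and> y i \<noteq> 0" _ \<kappa>] by blast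
    have "\<Phi> i (h y) = (\<Sum>j\<in>I. \<Phi> i (s j (y j)))"
      by (simp add: h_def flin_sum[OF \<Phi>[OF i(1)]])
    also have "\<dots> = (\<Sum>j\<in>I. if j = i then y i else 0)"
    proof (rule sum.cong)
      fix j assume j: "j \<in> I"
      show "\<Phi> i (s j (y j)) = (if j = i then y i else 0)"
        using s(4)[OF j yS[OF j]] s0[OF j i(1)] least[OF j] flin_0[OF s(1)[OF j]]
          flin_0[OF \<Phi>[OF i(1)]] by (cases "y j = 0") auto
    qed simp
    also have "\<dots> = y i" using i(1) fin by simp
    finally show False using h0 i flin_0[OF \<Phi>[OF i(1)]] by simp
  qed
  \<comment> \<open>Successive approximation: the correction z clears the weight N and, by
    triangularity, leaves the smaller weights undisturbed.\<close>
  have approx: "\<exists>y. (\<forall>i\<in>I. y i \<in> S i) \<and> (\<forall>j\<in>I. \<kappa> j < N \<longrightarrow> \<Phi> j (x - h y) = 0)" if x: "x \<in> X" for x N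
  proof (induction N)
    case 0
    show ?case
      using S by (intro exI[of _ "\<lambda>_. 0"]) (auto simp: stable_def free_vs.subspace_0)
  next
    case (Suc N)
    then obtain y where y: "\<And>i. i \<in> I \<Longrightarrow> y i \<in> S i"
      and y0: "\<And>j. j \<in> I \<Longrightarrow> \<kappa> j < N \<Longrightarrow> \<Phi> j (x - h y) = 0" by blast
    let ?x = "x - h y"
    have xX: "?x \<in> X"
      using x hX X by (auto simp: stable_def intro: free_vs.subspace_diff)
    define z where "z i = (if \<kappa> i = N then \<Phi> i ?x else 0)" for i
    have z: "z i \<in> S i" if "i \<in> I" for i
      using into[OF that xX] y0 S[OF that] by (auto simp: z_def stable_def free_vs.subspace_0)
    have "h (\<lambda>i. y i + z i) = h y + h z"
      by (simp add: h_def flin_add[OF s(1)] sum.distrib)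
    then have eq: "x - h (\<lambda>i. y i + z i) = ?x - h z" by simp
    have "\<Phi> j (?x - h z) = 0" if j: "j \<in> I" "\<kappa> j < Suc N" for j
    proof -
      have "\<Phi> j (h z) = (\<Sum>i\<in>I. \<Phi> j (s i (z i)))"
        by (simp add: h_def flin_sum[OF \<Phi>[OF j(1)]])
      also have "\<dots> = (\<Sum>i\<in>I. if i = j then z j else 0)"
      proof (rule sum.cong)
        fix i assume i: "i \<in> I"
        show "\<Phi> j (s i (z i)) = (if i = j then z j else 0)"
          using s(4)[OF i z[OF i]] s0[OF i j(1)] j(2) flin_0[OF s(1)[OF i]]
            flin_0[OF \<Phi>[OF j(1)]] by (cases "\<kappa> i = N") (auto simp: z_def)
      qed simp
      also have "\<dots> = z j" using j(1) fin by simp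
      finally have "\<Phi> j (h z) = z j" .
      then show ?thesis
        using y0[OF j(1)] j(2) by (auto simp: z_def flin_diff[OF \<Phi>[OF j(1)]])
    qed
    then show ?case
      unfolding eq[symmetric] using y z S
      by (intro exI[of _ "\<lambda>i. y i + z i"]) (auto simp: stable_def intro: free_vs.subspace_add)
  qed
  have h_cong: "h y = h y'" if "\<And>i. i \<in> I \<Longrightarrow> y i = y' i" for y y'
    using that by (simp add: h_def)
  have "bij_betw h (\<Pi>\<^sub>E i\<in>I. S i) X"
    unfolding bij_betw_def
  proof
    show "inj_on h (\<Pi>\<^sub>E i\<in>I. S i)"
    proof (rule inj_onI)
      fix y y' assume y: "y \<in> (\<Pi>\<^sub>E i\<in>I. S i)" "y' \<in> (\<Pi>\<^sub>E i\<in>I. S i)" and eq: "h y = h y'"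
      have "h (\<lambda>i. y i - y' i) = 0"
        using eq by (simp add: h_def flin_diff[OF s(1)] sum_subtractf)
      moreover have "y i - y' i \<in> S i" if "i \<in> I" for i
        using y that S[OF that] by (auto simp: stable_def intro: free_vs.subspace_diff)
      ultimately have "\<forall>i\<in>I. y i - y' i = 0"
        by (rule zero)
      then show "y = y'"
        using y by (intro PiE_ext) auto
    qed
    show "h ` (\<Pi>\<^sub>E i\<in>I. S i) = X"
    proof (intro equalityI subsetI)
      fix x assume x: "x \<in> X"
      obtain y where y: "\<And>i. i \<in> I \<Longrightarrow> y i \<in> S i"
        \<comment> \<open>The sum of all weights bounds each of them, so this N clears every
          index.\<close>
        and y0: "\<And>j. j \<in> I \<Longrightarrow> \<kappa> j < Suc (\<Sum>i\<in>I. \<kappa> i) \<Longrightarrow> \<Phi> j (x - h y) = 0"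
        using approx[OF x] by blast
      have "\<kappa> j < Suc (\<Sum>i\<in>I. \<kappa> i)" if "j \<in> I" for j
        using member_le_sum[of j I \<kappa>] that fin by simp
      then have "\<And>j. j \<in> I \<Longrightarrow> \<Phi> j (x - h y) = 0"
        using y0 by blast
      moreover have "x - h y \<in> X"
        using X x hX[of y] by (simp add: stable_def free_vs.subspace_diff)
      ultimately have "x - h y = 0"
        using sep by blast
      moreover have "h (\<lambda>i\<in>I. y i) = h y"
        by (rule h_cong) simp
      ultimately have "x = h (\<lambda>i\<in>I. y i)"
        by (simp only: right_minus_eq)
      moreover have "(\<lambda>i\<in>I. y i) \<in> (\<Pi>\<^sub>E i\<in>I. S i)"
        using y by (simp add: restrict_PiE_iff)
      ultimately show "x \<in> h ` (\<Pi>\<^sub>E i\<in>I. S i)"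
        by (rule image_eqI)
    qed (use hX in auto)
  qed
  moreover have "h (\<lambda>i\<in>I. x i + y i) = h x + h y" for x y
    by (simp add: h_def flin_add[OF s(1)] sum.distrib)
  moreover have "h (\<lambda>i\<in>I. fscale c (x i)) = fscale c (h x)" for c x
    by (simp add: h_def flin_scale[OF s(1)] free_vs.scale_sum_right)
  moreover have "h (\<lambda>i\<in>I. a p (x i)) = a p (h x)" if "p permutes {1..n}" for p x
    using s(2) that by (simp add: h_def flin_sum[OF lin])
  ultimately show ?thesis
    unfolding sym_module_iso_def direct_sum_sel fmodule_sel by blast
qed

end

section \<open>Ordered pointed set partitions\<close>

text \<open>A position without a successor leaves the list unchanged; this frees
  \<open>merge_at_merge_at\<close> from conditions on the length. The operation is a parameter
  because the blocks are merged by union and their sizes by addition.\<close>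

fun merge_at :: "('a \<Rightarrow> 'a \<Rightarrow> 'a) \<Rightarrow> nat \<Rightarrow> 'a list \<Rightarrow> 'a list" where
  "merge_at f 0 (a # b # xs) = f a b # xs"
| "merge_at f 0 [a] = [a]"
| "merge_at f i [] = []"
| "merge_at f (Suc i) (a # xs) = a # merge_at f i xs"

abbreviation mrg :: "nat \<Rightarrow> 'a set list \<Rightarrow> 'a set list"
  where "mrg \<equiv> merge_at (\<union>)"

lemma split_at:
  assumes "Suc i < length xs"
  obtains pre a b post where "xs = pre @ a # b # post" "length pre = i"
proof -
  have "xs = take i xs @ xs ! i # xs ! Suc i # drop (Suc (Suc i)) xs" "length (take i xs) = i"
    using assms by (simp_all add: Cons_nth_drop_Suc id_take_nth_drop[symmetric])
  then show thesis using that by blast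
qed

lemma merge_at_append [simp]: "merge_at f (length pre) (pre @ a # b # post) = pre @ f a b # post"
  by (induction pre) auto

lemma merge_at_short: "length xs \<le> Suc i \<Longrightarrow> merge_at f i xs = xs"
  by (induction f i xs rule: merge_at.induct) auto

lemma length_merge_at: "Suc i < length xs \<Longrightarrow> length (merge_at f i xs) = length xs - 1"
  by (elim split_at) (auto simp: merge_at_append)

text \<open>The simplicial identity between the faces of a bar complex; it is behind the
  cancellation in \<open>boundary_bar_chain\<close>.\<close>

lemma merge_at_merge_at:
  assumes assoc: "\<And>a b c. f (f a b) c = f a (f b c)" and "i \<le> j"
  shows "merge_at f j (merge_at f i xs) = merge_at f i (merge_at f (Suc j) xs)"
  using assms(2)
proof (induction i arbitrary: j xs)
  case 0
  show ?case
    by (cases j; cases xs; cases "tl xs"; cases "tl (tl xs)") (auto simp: assoc)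
next
  case (Suc i)
  then obtain j' where "j = Suc j'" "i \<le> j'" by (cases j) auto
  with Suc.IH show ?case by (cases xs) auto
qed

lemma merge_at_map:
  assumes "\<And>a b. g (f a b) = h (g a) (g b)"
  shows "map g (merge_at f i xs) = merge_at h i (map g xs)"
  using assms by (induction f i xs rule: merge_at.induct) auto

lemma map_image_mrg: "map ((`) g) (mrg i C) = mrg i (map ((`) g) C)"
  by (rule merge_at_map) (rule image_Un)

text \<open>The last entry plays the role of the pointed block. It can be treated like any other
  block because for m > 0 it is nonempty as well.\<close>

definition osp :: "nat \<Rightarrow> nat set list set"
  where "osp n = {C. {} \<notin> set C \<and> sorted_wrt disjnt C \<and> \<Union> (set C) = {1..n}}"

lemma sorted_wrt_disjnt_append:
  "sorted_wrt disjnt (xs @ ys) \<longleftrightarrow>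
    sorted_wrt disjnt xs \<and> sorted_wrt disjnt ys \<and> disjnt (\<Union> (set xs)) (\<Union> (set ys))"
  by (auto simp: sorted_wrt_append disjnt_def)

lemma sorted_wrt_disjnt_Cons:
  "sorted_wrt disjnt (x # xs) \<longleftrightarrow> sorted_wrt disjnt xs \<and> disjnt x (\<Union> (set xs))"
  by (auto simp: disjnt_def)

lemma osp_mrg:
  assumes "C \<in> osp n"
  shows "mrg i C \<in> osp n"
proof (cases "Suc i < length C")
  case True
  then obtain pre A B post where "C = pre @ A # B # post" "length pre = i"
    by (rule split_at)
  moreover from this have "mrg i C = pre @ (A \<union> B) # post" by auto
  ultimately show ?thesis
    using assms by (auto simp: osp_def sorted_wrt_disjnt_append sorted_wrt_disjnt_Cons disjnt_Un1 disjnt_Un2)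
next
  case False
  then show ?thesis using assms by (simp add: merge_at_short)
qed

lemma osp_distinct:
  assumes "C \<in> osp n"
  shows "distinct C"
proof -
  have "sorted_wrt disjnt C \<Longrightarrow> {} \<notin> set C \<Longrightarrow> distinct C"
    by (induction C) (auto simp: disjnt_def)
  then show ?thesis using assms by (simp add: osp_def)
qed

lemma finite_osp [simp]: "finite (osp n)"
proof (rule finite_subset)
  show "osp n \<subseteq> {xs. set xs \<subseteq> Pow {1..n} \<and> distinct xs}"
    by (auto simp: osp_distinct) (auto simp: osp_def)
  show "finite {xs. set xs \<subseteq> Pow {1..n} \<and> distinct xs}"
    by (rule finite_subset_distinct) simp
qed

lemma osp_finite_member: "C \<in> osp n \<Longrightarrow> A \<in> set C \<Longrightarrow> finite A"
  by (rule finite_subset[of A "{1..n}"]) (auto simp: osp_def)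

lemma osp_map:
  assumes "C \<in> osp n" "p permutes {1..n}"
  shows "map ((`) p) C \<in> osp n"
proof -
  have inj: "inj p" using assms(2) by (simp add: permutes_inj)
  have "sorted_wrt disjnt (map ((`) p) C)"
    using assms(1) unfolding osp_def sorted_wrt_map
    by (auto elim!: sorted_wrt_mono_rel[rotated] simp: disjnt_def) (metis IntI empty_iff inj injD)
  moreover have "\<Union> (set (map ((`) p) C)) = p ` \<Union> (set C)" by auto
  ultimately show ?thesis
    using assms by (auto simp: osp_def permutes_image)
qed

lemma card_map_image: "inj p \<Longrightarrow> map card (map ((`) p) C) = map card C"
  by (auto simp: card_image inj_on_def dest: injD)

lemma sum_list_card_disjnt:
  "sorted_wrt disjnt C \<Longrightarrow> \<forall>A\<in>set C. finite A \<Longrightarrow> sum_list (map card C) = card (\<Union> (set C))"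
  by (induction C) (auto simp: card_Un_disjnt sorted_wrt_disjnt_Cons simp del: sorted_wrt.simps)

lemma card_mrg: "C \<in> osp n \<Longrightarrow> map card (mrg i C) = merge_at (+) i (map card C)"
proof (cases "Suc i < length C")
  case True
  assume C: "C \<in> osp n"
  obtain pre A B post where *: "C = pre @ A # B # post" "length pre = i"
    using True by (rule split_at)
  then have "mrg i C = pre @ (A \<union> B) # post" by auto
  moreover have "merge_at (+) i (map card C) = map card pre @ (card A + card B) # map card post"
    using merge_at_append[of "(+)" "map card pre"] * by simp
  moreover have "card (A \<union> B) = card A + card B"
    using C * osp_finite_member[OF C]
    by (auto simp: osp_def sorted_wrt_disjnt_append sorted_wrt_disjnt_Cons disjnt_Un2 intro!: card_Un_disjnt)
  ultimately show ?thesis by simp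
qed (simp add: merge_at_short)

definition perm_act :: "(nat \<Rightarrow> nat) \<Rightarrow> (nat set list \<Rightarrow>\<^sub>0 'k::field) \<Rightarrow> (nat set list \<Rightarrow>\<^sub>0 'k)"
  where "perm_act p = basis_map (map ((`) p))"

lemma flin_perm_act [simp]: "flin (perm_act p)"
  by (simp add: perm_act_def)

lemma perm_rep_perm_act:
  "of_nat (fact n) \<noteq> (0 :: 'k::field) \<Longrightarrow> perm_rep n (perm_act :: _ \<Rightarrow> (nat set list \<Rightarrow>\<^sub>0 'k) \<Rightarrow> _)"
  by (rule perm_rep.intro)
    (simp_all add: perm_act_def basis_map_basis_map basis_map_id image_image o_def
      trans[OF basis_map_cong[of v v _ "\<lambda>x. x" for v] basis_map_id])

text \<open>The cycles of the bar complex whose terms have \<open>r\<close> blocks. For the families \<open>T\<close> that occur below, the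
  merging maps have images with disjoint supports, so that their alternating sum vanishes only if
  each of them does.\<close>

definition cyc :: "nat \<Rightarrow> nat set list set \<Rightarrow> (nat set list \<Rightarrow>\<^sub>0 'k::field) set"
  where "cyc r T = {x. Poly_Mapping.keys x \<subseteq> T \<and> (\<forall>i. Suc i < r \<longrightarrow> basis_map (mrg i) x = 0)}"

lemma stable_cyc:
  assumes "\<And>p C. p permutes {1..n} \<Longrightarrow> C \<in> T \<Longrightarrow> map ((`) p) C \<in> T"
  shows "stable n perm_act (cyc r T)"
  unfolding stable_def
proof (intro conjI allI impI ballI)
  show "free_vs.subspace (cyc r T)"
    unfolding free_vs.subspace_def cyc_def
    by (auto simp: basis_map_simps in_keys_iff lookup_add subset_iff) (metis add_0)
next
  fix p x assume p: "p permutes {1..n}" and x: "x \<in> cyc r T"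
  have "basis_map (mrg i) (perm_act p x) = perm_act p (basis_map (mrg i) x)" for i
    by (simp add: perm_act_def basis_map_basis_map map_image_mrg)
  moreover have "Poly_Mapping.keys (perm_act p x) \<subseteq> T"
    using keys_basis_map[of "map ((`) p)" x] assms[OF p] x by (auto simp: perm_act_def cyc_def)
  ultimately show "perm_act p x \<in> cyc r T"
    using x by (auto simp: cyc_def flin_0[OF flin_perm_act])
qed

definition ospc :: "nat \<Rightarrow> nat list \<Rightarrow> nat set list set"
  where "ospc n d = {C \<in> osp n. map card C = d}"

lemma finite_ospc [simp]: "finite (ospc n d)"
  by (rule finite_subset[of _ "osp n"]) (auto simp: ospc_def)

lemma ospc_map:
  assumes "C \<in> ospc n d" "p permutes {1..n}"
  shows "map ((`) p) C \<in> ospc n d"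
proof -
  have "map card (map ((`) p) C) = map card C"
    by (rule card_map_image[OF permutes_inj[OF assms(2)]])
  with osp_map[OF _ assms(2), of C] assms(1) show ?thesis
    by (simp only: ospc_def mem_Collect_eq)
qed

section \<open>Cutting a word into blocks\<close>

text \<open>One word \<open>u\<close> serves all compositions: merging blocks changes only the list
  of lengths (\<open>mrg_cut\<close>), and a permutation changes only \<open>u\<close>
  (\<open>map_image_cut\<close>). The start \<open>s\<close> keeps the positions absolute in the
  recursion.\<close>

fun cut :: "(nat \<Rightarrow> nat) \<Rightarrow> nat \<Rightarrow> nat list \<Rightarrow> nat set list" where
  "cut u s [] = []"
| "cut u s (a # w) = u ` {s..<s + a} # cut u (s + a) w"

lemma length_cut [simp]: "length (cut u s w) = length w"
  by (induction w arbitrary: s) auto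

lemma map_image_cut: "map ((`) p) (cut u s w) = cut (p \<circ> u) s w"
  by (induction w arbitrary: s) (auto simp: image_comp)

lemma mrg_cut: "mrg i (cut u s w) = cut u s (merge_at (+) i w)"
proof (induction i arbitrary: s w)
  case 0
  show ?case
    by (cases w; cases "tl w") (auto simp: image_Un[symmetric] add.assoc ivl_disj_un_two(3))
next
  case (Suc i)
  then show ?case by (cases w) auto
qed

lemma nth_cut: "i < length w \<Longrightarrow>
    cut u s w ! i = u ` {s + sum_list (take i w)..<s + sum_list (take (Suc i) w)}"
  by (induction w arbitrary: s i) (auto simp: nth_Cons add.assoc split: nat.splits)

lemma Union_cut: "\<Union> (set (cut u s w)) = u ` {s..<s + sum_list w}"
proof (induction w arbitrary: s)
  case (Cons a w)
  have "{s..<s + sum_list (a # w)} = {s..<s + a} \<union> {s + a..<s + a + sum_list w}"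
    by auto
  then show ?case using Cons by (simp add: image_Un)
qed simp

lemma cut_disjnt: "inj_on u {s..<s + sum_list w} \<Longrightarrow>
    sorted_wrt disjnt (cut u s w) \<and> map card (cut u s w) = w"
proof (induction w arbitrary: s)
  case (Cons a w)
  have sub: "{s..<s + a} \<subseteq> {s..<s + sum_list (a # w)}"
    "{s + a..<s + a + sum_list w} \<subseteq> {s..<s + sum_list (a # w)}" by auto
  have "u ` {s..<s + a} \<inter> u ` {s + a..<s + a + sum_list w} = u ` ({s..<s + a} \<inter> {s + a..<s + a + sum_list w})"
    by (rule inj_on_image_Int[OF Cons.prems sub, symmetric])
  also have "{s..<s + a} \<inter> {s + a..<s + a + sum_list w} = {}" by auto
  finally have "disjnt (u ` {s..<s + a}) (\<Union> (set (cut u (s + a) w)))"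
    unfolding Union_cut disjnt_def by simp
  moreover have "inj_on u {s + a..<s + a + sum_list w}" "inj_on u {s..<s + a}"
    using Cons.prems sub by (auto intro: inj_on_subset)
  ultimately show ?case
    using Cons.IH[of "s + a"]
    by (simp add: sorted_wrt_disjnt_Cons card_image del: sorted_wrt.simps)
qed simp

lemma cut_ospc:
  assumes "bij_betw u {..<n} {1..n}" "sum_list w = n" "0 \<notin> set w"
  shows "cut u 0 w \<in> ospc n w"
proof -
  have inj: "inj_on u {0..<0 + sum_list w}" and im: "u ` {0..<n} = {1..n}"
    using assms by (auto simp: bij_betw_def lessThan_atLeast0)
  note c = cut_disjnt[OF inj]
  have "{} \<notin> set (cut u 0 w)"
    using c assms(3) by (metis card.empty in_set_conv_nth length_map nth_map)
  with c show ?thesis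
    using Union_cut[of u 0 w] assms(2) im by (simp add: ospc_def osp_def)
qed

text \<open>Exchanging two neighbouring positions changes a block only if a cut separates them, that
  is, if some partial sum equals b.\<close>

lemma cut_transpose:
  assumes "0 < b" "\<And>i. s + sum_list (take i w) \<noteq> b"
  shows "cut (u \<circ> transpose (b - 1) b) s w = cut u s w"
  using assms(2)
proof (induction w arbitrary: s)
  case (Cons a w)
  have "s \<noteq> b" "s + a \<noteq> b"
    using Cons.prems[of 0] Cons.prems[of 1] by auto
  then have "transpose (b - 1) b ` {s..<s + a} = {s..<s + a}"
    using assms(1) by (intro transpose_image_eq) auto
  then have "(u \<circ> transpose (b - 1) b) ` {s..<s + a} = u ` {s..<s + a}"
    by (metis image_comp)
  moreover have "s + a + sum_list (take i w) \<noteq> b" for i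
    using Cons.prems[of "Suc i"] by (simp add: add.assoc)
  ultimately show ?case using Cons.IH by simp
qed simp

lemma cut_nth_concat:
  "cut ((!) (ys @ concat xss)) (length ys) (map length xss) = map set xss"
proof (induction xss arbitrary: ys)
  case (Cons xs xss)
  have "(!) (ys @ xs @ concat xss) ` {length ys..<length ys + length xs} = set xs"
  proof -
    have "{length ys..<length ys + length xs} = (+) (length ys) ` {..<length xs}"
      by (simp add: lessThan_atLeast0 image_add_atLeastLessThan add.commute)
    moreover have "(ys @ xs @ concat xss) ! (length ys + l) = xs ! l" if "l < length xs" for l
      using that by (simp add: nth_append)
    ultimately have "(!) (ys @ xs @ concat xss) ` {length ys..<length ys + length xs} = (!) xs ` {..<length xs}"
      by (simp add: image_image)
    then show ?thesis by (auto simp: set_conv_nth)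
  qed
  with Cons[of "ys @ xs"] show ?case by simp
qed simp


section \<open>Polytabloids of border strips\<close>

text \<open>The cell \<open>(i, j)\<close> of a border strip is the cell number \<open>i + j\<close> in the reading of the strip row
  by row, so that a tableau is a bijection \<open>u\<close> from \<open>{..<n}\<close> to \<open>{1..n}\<close>.\<close>

definition column_positions :: "nat list \<Rightarrow> nat \<Rightarrow> nat set"
  where "column_positions d j = {i + j |i. (i, j) \<in> border_strip d}"

definition column_perms :: "nat \<Rightarrow> nat list \<Rightarrow> (nat \<Rightarrow> nat) \<Rightarrow> (nat \<Rightarrow> nat) set"
  where "column_perms n d u = {p. p permutes {1..n} \<and>
    (\<forall>j. p ` u ` column_positions d j = u ` column_positions d j)}"

text \<open>A tabloid is determined by the list of its rows, an ordered partition of type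
  \<open>d\<close>. Written in this way, polytabloids lie in the same space as the cycles.\<close>

definition polytab :: "nat \<Rightarrow> nat list \<Rightarrow> (nat \<Rightarrow> nat) \<Rightarrow> (nat set list \<Rightarrow>\<^sub>0 'k::field)"
  where "polytab n d u = (\<Sum>p\<in>column_perms n d u.
    Poly_Mapping.single (cut (p \<circ> u) 0 d) (of_int (sign p)))"

lemma finite_column_perms [simp]: "finite (column_perms n d u)"
  by (rule finite_subset[OF _ finite_permutations[of "{1..n}"]]) (auto simp: column_perms_def)

text \<open>Consecutive rows share one column, so column numbers fall behind reading positions by
  one for each row. This is the origin of the numbering of the cells by i + j.\<close>

lemma row_start_add:
  "0 \<notin> set d \<Longrightarrow> i \<le> length d \<Longrightarrow> row_start d i + i = sum_list (take i d)"
proof (induction i)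
  case (Suc i)
  then have "0 < d ! i" by (metis Suc_le_lessD gr0I nth_mem)
  with Suc show ?case by (simp add: row_start_Suc take_Suc_conv_app_nth)
qed (simp add: row_start_def)

lemma sum_list_take_mono: "i \<le> j \<Longrightarrow> sum_list (take i (d :: nat list)) \<le> sum_list (take j d)"
proof -
  assume "i \<le> j"
  then have "take j d = take i d @ take (j - i) (drop i d)"
    by (metis le_add_diff_inverse take_add)
  then show ?thesis by simp
qed

lemma cell_position:
  assumes "0 \<notin> set d" "(i, j) \<in> border_strip d"
  shows "i < length d" "sum_list (take i d) \<le> i + j" "i + j < sum_list (take (Suc i) d)"
    "i + j < sum_list d"
proof -
  show i: "i < length d" using assms by (simp add: border_strip_def)
  have *: "sum_list (take (Suc i) d) = sum_list (take i d) + d ! i"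
    using i by (simp add: take_Suc_conv_app_nth)
  show "sum_list (take i d) \<le> i + j" and **: "i + j < sum_list (take (Suc i) d)"
    using row_start_add[OF assms(1), of i] assms(2) i * by (auto simp: border_strip_def)
  show "i + j < sum_list d"
    using ** sum_list_take_mono[of "Suc i" "length d" d] i by simp
qed

lemma cell_exists:
  assumes "0 \<notin> set d" "sum_list (take i d) \<le> q" "q < sum_list (take (Suc i) d)" "i < length d"
  shows "i \<le> q" "(i, q - i) \<in> border_strip d"
  using row_start_add[OF assms(1), of i] assms
  by (auto simp: border_strip_def take_Suc_conv_app_nth)

lemma position_exists:
  assumes "q < sum_list (d :: nat list)"
  obtains i where "i < length d" "sum_list (take i d) \<le> q" "q < sum_list (take (Suc i) d)"
proof -
  have "\<exists>i. i < length d \<and> sum_list (take i d) \<le> q \<and> q < sum_list (take (Suc i) d)"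
    using assms
  proof (induction d arbitrary: q)
    case (Cons a d)
    show ?case
    proof (cases "q < a")
      case False
      then obtain i where "i < length d" "sum_list (take i d) \<le> q - a" "q - a < sum_list (take (Suc i) d)"
        using Cons.IH[of "q - a"] Cons.prems by fastforce
      then show ?thesis
        using False by (intro exI[of _ "Suc i"]) auto
    qed (auto intro: exI[of _ 0])
  qed simp
  then show thesis using that by blast
qed

lemma cell_unique:
  assumes "0 \<notin> set d" "(i, j) \<in> border_strip d" "(i', j') \<in> border_strip d" "i + j = i' + j'"
  shows "i = i'" "j = j'"
proof -
  have "\<not> i < i'" "\<not> i' < i"
    using cell_position[OF assms(1,2)] cell_position[OF assms(1,3)] assms(4)
      sum_list_take_mono[of "Suc i" i' d] sum_list_take_mono[of "Suc i'" i d] by auto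
  with assms(4) show "i = i'" "j = j'" by auto
qed

lemma column_positions_disjoint:
  "0 \<notin> set d \<Longrightarrow> q \<in> column_positions d j \<Longrightarrow> q \<in> column_positions d j' \<Longrightarrow> j = j'"
  by (auto simp: column_positions_def dest: cell_unique(2))

lemma column_positions_less:
  "0 \<notin> set d \<Longrightarrow> q \<in> column_positions d j \<Longrightarrow> q < sum_list d"
  by (auto simp: column_positions_def dest: cell_position(4))

text \<open>Rows i and i + 1 overlap in a single column; the last cell of the lower row and the
  first cell of the upper row stand there, at the reading positions b - 1 and b.\<close>

lemma boundary_column:
  assumes "0 \<notin> set d" "Suc i < length d" and b: "b = sum_list (take (Suc i) d)"
  shows "b - 1 \<in> column_positions d (row_start d (Suc i))" "b \<in> column_positions d (row_start d (Suc i))"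
    "0 < b"
proof -
  have pos: "0 < d ! i" "0 < d ! Suc i"
    using assms(1,2) by (metis Suc_lessD gr0I nth_mem)+
  have *: "row_start d (Suc i) + Suc i = b"
    using row_start_add[of d "Suc i"] assms by simp
  then show "0 < b" by simp
  have "(i, row_start d (Suc i)) \<in> border_strip d" "(Suc i, row_start d (Suc i)) \<in> border_strip d"
    using assms(2) pos by (auto simp: border_strip_def row_start_Suc)
  with * show "b - 1 \<in> column_positions d (row_start d (Suc i))"
    "b \<in> column_positions d (row_start d (Suc i))"
    by (force simp: column_positions_def)+
qed

text \<open>The two entries belong to one column and the columns are disjoint, so the transposition
  maps every column to itself.\<close>

lemma column_perms_transpose:
  assumes d: "0 \<notin> set d" "sum_list d = n" and u: "bij_betw u {..<n} {1..n}"
    and q: "q \<in> column_positions d j" "q' \<in> column_positions d j"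
    and p: "p \<in> column_perms n d u"
  shows "p \<circ> transpose (u q) (u q') \<in> column_perms n d u"
proof -
  have less: "q < n" "q' < n"
    using column_positions_less[OF d(1)] q d(2) by blast+
  have "u q \<in> {1..n}" "u q' \<in> {1..n}"
    using less u bij_betwE by blast+
  then have perm: "p \<circ> transpose (u q) (u q') permutes {1..n}"
    using p unfolding column_perms_def by (blast intro: permutes_compose permutes_swap_id)
  have mem: "u q0 \<in> u ` column_positions d j' \<longleftrightarrow> q0 \<in> column_positions d j'" if "q0 < n" for q0 j'
    using that u column_positions_less[OF d(1)] d(2)
    by (auto simp: bij_betw_def inj_on_def)
  have "u q \<in> u ` column_positions d j' \<longleftrightarrow> u q' \<in> u ` column_positions d j'" for j'
    unfolding mem[OF less(1)] mem[OF less(2)]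
    using q column_positions_disjoint[OF d(1)] by blast
  then have "transpose (u q) (u q') ` u ` column_positions d j' = u ` column_positions d j'" for j'
    by (rule transpose_image_eq)
  then show ?thesis
    using p perm by (simp only: column_perms_def mem_Collect_eq image_comp[symmetric]) simp
qed

section \<open>Sign-reversing cancellation along columns\<close>

lemma two_neq_0:
  assumes "of_nat (fact n) \<noteq> (0 :: 'k::field)" "2 \<le> n"
  shows "(2 :: 'k) \<noteq> 0"
proof
  assume 2: "(2 :: 'k) = 0"
  have "2 dvd (fact n :: nat)"
    using assms(2) by (simp add: dvd_fact)
  then obtain l :: nat where "fact n = 2 * l" by (rule dvdE)
  then have "of_nat (fact n) = (2 :: 'k) * of_nat l"
    by (metis of_nat_mult of_nat_numeral)
  with 2 assms(1) show False by simp
qed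

lemma sum_pm_self_neg:
  assumes "(2 :: 'k::field) \<noteq> 0" "v = - (v :: 'x \<Rightarrow>\<^sub>0 'k)"
  shows "v = 0"
proof (rule poly_mapping_eqI)
  fix x
  have "Poly_Mapping.lookup v x = - Poly_Mapping.lookup v x"
    using assms(2) by (metis lookup_uminus)
  then have "Poly_Mapping.lookup v x + Poly_Mapping.lookup v x = 0"
    by (metis add.right_inverse)
  then have "2 * Poly_Mapping.lookup v x = 0" by (simp only: mult_2)
  with assms(1) show "Poly_Mapping.lookup v x = Poly_Mapping.lookup 0 x" by simp
qed

text \<open>Right multiplication by the transposition is a sign-reversing involution, so the sum
  equals its own negative. Dividing by 2 avoids a choice of coset representatives.\<close>

lemma sign_cancel:
  fixes h :: "(nat \<Rightarrow> nat) \<Rightarrow> ('x \<Rightarrow>\<^sub>0 'k::field)"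
  assumes "(2 :: 'k) \<noteq> 0" "a \<noteq> b"
    and P: "\<And>p. p \<in> P \<Longrightarrow> p permutes {1..n}" "\<And>p. p \<in> P \<Longrightarrow> p \<circ> transpose a b \<in> P"
    and h: "\<And>p. p \<in> P \<Longrightarrow> h (p \<circ> transpose a b) = h p"
  shows "(\<Sum>p\<in>P. fscale (of_int (sign p)) (h p)) = 0"
proof -
  have "(\<Sum>p\<in>P. fscale (of_int (sign p)) (h p)) = (\<Sum>p\<in>P. - fscale (of_int (sign p)) (h p))"
  proof (rule sum.reindex_bij_witness[of _ "\<lambda>p. p \<circ> transpose a b" "\<lambda>p. p \<circ> transpose a b"])
    fix p assume p: "p \<in> P"
    show "p \<circ> transpose a b \<circ> transpose a b = p" by (simp add: o_assoc[symmetric])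
    then show "p \<circ> transpose a b \<circ> transpose a b = p" .
    show "p \<circ> transpose a b \<in> P" using P(2) p .
    then show "p \<circ> transpose a b \<in> P" .
    have "sign (p \<circ> transpose a b) = - sign p"
      using assms(2) P(1)[OF p] permutation_permutes[of p] permutation_swap_id[of a b]
      by (subst sign_compose) (auto simp: sign_swap_id)
    then show "- fscale (of_int (sign (p \<circ> transpose a b))) (h (p \<circ> transpose a b))
        = fscale (of_int (sign p)) (h p)"
      using h[OF p] by simp
  qed
  then show ?thesis
    using assms(1) by (intro sum_pm_self_neg) (simp_all add: sum_negf)
qed

lemma transpose_comp: "inj_on u A \<Longrightarrow> q \<in> A \<Longrightarrow> a \<in> A \<Longrightarrow> b \<in> A \<Longrightarrow>
    transpose (u a) (u b) (u q) = u (transpose a b q)"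
  by (auto simp: transpose_def inj_on_def)

lemma cut_cong: "(\<And>q. s \<le> q \<Longrightarrow> q < s + sum_list w \<Longrightarrow> u q = v q) \<Longrightarrow> cut u s w = cut v s w"
proof (induction w arbitrary: s)
  case (Cons a w)
  have "u ` {s..<s + a} = v ` {s..<s + a}"
    using Cons.prems by (intro image_cong) auto
  moreover have "cut u (s + a) w = cut v (s + a) w"
    by (rule Cons.IH) (use Cons.prems in auto)
  ultimately show ?case by simp
qed simp

text \<open>Transposing the entries at b - 1 and b amounts to transposing these positions, and
  \<open>cut_transpose\<close> applies.\<close>

lemma cut_column_transpose:
  assumes u: "bij_betw u {..<n} {1..n}" and b: "0 < b" "b < n" and w: "sum_list w = n"
    and nb: "\<And>i. sum_list (take i w) \<noteq> b"
  shows "cut (p \<circ> transpose (u (b - 1)) (u b) \<circ> u) 0 w = cut (p \<circ> u) 0 w"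
proof -
  have "cut (p \<circ> transpose (u (b - 1)) (u b) \<circ> u) 0 w = cut ((p \<circ> u) \<circ> transpose (b - 1) b) 0 w"
  proof (rule cut_cong)
    fix q assume "q < 0 + sum_list w"
    then show "(p \<circ> transpose (u (b - 1)) (u b) \<circ> u) q = (p \<circ> u \<circ> transpose (b - 1) b) q"
      using transpose_comp[of u "{..<n}" q "b - 1" b] u b w by (simp add: bij_betw_def)
  qed
  also have "\<dots> = cut (p \<circ> u) 0 w"
    using b(1) nb by (intro cut_transpose) auto
  finally show ?thesis .
qed

text \<open>Exchanging the two cells at the boundary between two rows cancels a sum over the column
  stabilizer whose terms do not see that boundary.\<close>

lemma column_cancel:
  fixes c :: "'k::field"
  assumes 2: "(2 :: 'k) \<noteq> 0" and d: "0 \<notin> set d" "sum_list d = n" and u: "bij_betw u {..<n} {1..n}"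
    and i: "Suc i < length d" and w: "sum_list w = n"
    and nb: "\<And>l. sum_list (take l w) \<noteq> sum_list (take (Suc i) d)"
  shows "(\<Sum>p\<in>column_perms n d u. Poly_Mapping.single (cut (p \<circ> u) 0 w) (of_int (sign p) * c)) = 0"
proof -
  define b where "b = sum_list (take (Suc i) d)"
  note bc = boundary_column[OF d(1) i b_def]
  have b: "b < n" using column_positions_less[OF d(1) bc(2)] d(2) by simp
  have neq: "u (b - 1) \<noteq> u b"
    using bij_betw_imp_inj_on[OF u] b bc(3) by (auto dest: inj_onD[where x = "b - 1" and y = b])
  have "(\<Sum>p\<in>column_perms n d u. fscale (of_int (sign p)) (Poly_Mapping.single (cut (p \<circ> u) 0 w) c)) = 0"
  proof (rule sign_cancel[OF 2 neq])
    fix p assume p: "p \<in> column_perms n d u"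
    show "p permutes {1..n}" using p by (simp add: column_perms_def)
    show "p \<circ> transpose (u (b - 1)) (u b) \<in> column_perms n d u"
      by (rule column_perms_transpose[OF d u bc(1,2) p])
    show "Poly_Mapping.single (cut (p \<circ> transpose (u (b - 1)) (u b) \<circ> u) 0 w) c
        = Poly_Mapping.single (cut (p \<circ> u) 0 w) c"
      using cut_column_transpose[OF u bc(3) b w] nb b_def by simp
  qed
  then show ?thesis by simp
qed

lemma sum_list_merge_at: "sum_list (merge_at (+) i w) = sum_list (w :: nat list)"
  by (induction "(+) :: nat \<Rightarrow> _" i w rule: merge_at.induct) auto

text \<open>The partial sums of a word of positive numbers increase strictly, so merging two letters
  really removes the cut between them.\<close>

lemma take_merge_at_boundary:
  assumes "0 \<notin> set w" "Suc i < length (w :: nat list)"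
  shows "sum_list (take l (merge_at (+) i w)) \<noteq> sum_list (take (Suc i) w)"
proof -
  obtain pre a b post where *: "w = pre @ a # b # post" "length pre = i"
    using assms(2) by (rule split_at)
  then have "merge_at (+) i w = pre @ (a + b) # post" by auto
  moreover have "sum_list (take l (pre @ (a + b) # post)) \<noteq> sum_list pre + a"
  proof (cases "l \<le> length pre")
    case True
    then have "sum_list (take l pre) \<le> sum_list pre"
      using sum_list_take_mono[of l "length pre" pre] by simp
    with True * assms(1) show ?thesis by auto
  next
    case False
    then have "sum_list (take l (pre @ (a + b) # post)) \<ge> sum_list pre + (a + b)"
      by (auto simp: take_Cons split: nat.splits)
    with * assms(1) show ?thesis by auto
  qed
  ultimately show ?thesis using * by simp
qed

lemma perm_comp_bij: "bij_betw u A B \<Longrightarrow> p permutes B \<Longrightarrow> bij_betw (p \<circ> u) A B"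
  by (rule bij_betw_trans) (auto intro: permutes_imp_bij)

lemma polytab_cyc:
  assumes 2: "of_nat (fact n) \<noteq> (0 :: 'k::field)" and d: "0 \<notin> set d" "sum_list d = n"
    and u: "bij_betw u {..<n} {1..n}"
  shows "polytab n d u \<in> (cyc (length d) (ospc n d) :: (_ \<Rightarrow>\<^sub>0 'k) set)"
proof -
  have "Poly_Mapping.keys (polytab n d u :: _ \<Rightarrow>\<^sub>0 'k) \<subseteq> (\<lambda>p. cut (p \<circ> u) 0 d) ` column_perms n d u"
    unfolding polytab_def by (rule order_trans[OF Poly_Mapping.keys_sum]) auto
  also have "\<dots> \<subseteq> ospc n d"
    using cut_ospc[OF perm_comp_bij[OF u] d(2,1)] by (auto simp: column_perms_def)
  finally have "Poly_Mapping.keys (polytab n d u :: _ \<Rightarrow>\<^sub>0 'k) \<subseteq> ospc n d" .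
  moreover have "basis_map (mrg i) (polytab n d u :: _ \<Rightarrow>\<^sub>0 'k) = 0" if i: "Suc i < length d" for i
  proof -
    have "2 \<le> length d" using i by simp
    moreover have "length d \<le> sum_list d"
      using d(1) by (induction d) auto
    ultimately have "(2 :: 'k) \<noteq> 0" using two_neq_0[OF 2] d(2) by simp
    then show ?thesis
      using column_cancel[OF _ d u i, of "merge_at (+) i d" 1] take_merge_at_boundary[OF d(1) i]
      by (simp add: polytab_def basis_map_simps mrg_cut sum_list_merge_at d(2))
  qed
  ultimately show ?thesis by (simp add: cyc_def)
qed

section \<open>Leading terms with respect to the rows of the entries\<close>

lemma digits_less: "(\<And>v. v < k \<Longrightarrow> g v < (N :: nat)) \<Longrightarrow> (\<Sum>v<k. g v * N ^ v) < N ^ k"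
proof (induction k)
  case (Suc k)
  have "(\<Sum>v<Suc k. g v * N ^ v) < N ^ k + g k * N ^ k"
    using Suc by simp
  also have "\<dots> = Suc (g k) * N ^ k" by simp
  also have "\<dots> \<le> N * N ^ k"
    using Suc.prems[of k] by (intro mult_right_mono) auto
  finally show ?case by simp
qed simp

lemma digits_lex_less:
  assumes "\<And>v. v \<le> n \<Longrightarrow> g v < (N :: nat)" "v0 \<le> n" "g v0 < g' v0"
    and eq: "\<And>v. v0 < v \<Longrightarrow> v \<le> n \<Longrightarrow> g v = g' v"
  shows "(\<Sum>v\<le>n. g v * N ^ v) < (\<Sum>v\<le>n. g' v * N ^ v)"
proof -
  have set: "{..n} = {..<v0} \<union> insert v0 {v0<..n}"
    using assms(2) by auto
  have split: "(\<Sum>v\<le>n. f v) = (\<Sum>v<v0. f v) + f v0 + (\<Sum>v\<in>{v0<..n}. f v)" for f :: "nat \<Rightarrow> nat"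
    unfolding set by (subst sum.union_disjoint) auto
  have "(\<Sum>v<v0. g v * N ^ v) + g v0 * N ^ v0 < N ^ v0 + g v0 * N ^ v0"
    using digits_less[of v0 g N] assms(1,2) by simp
  also have "\<dots> = Suc (g v0) * N ^ v0" by simp
  also have "\<dots> \<le> g' v0 * N ^ v0"
    using assms(3) by (intro mult_right_mono) auto
  moreover have "(\<Sum>v\<in>{v0<..n}. g v * N ^ v) = (\<Sum>v\<in>{v0<..n}. g' v * N ^ v)"
    using eq by (intro sum.cong) auto
  ultimately show ?thesis
    unfolding split by linarith
qed

text \<open>For disjoint blocks at most one summand is nonzero. Entries outside all blocks get the
  default row 0.\<close>

definition row_of :: "nat set list \<Rightarrow> nat \<Rightarrow> nat"
  where "row_of D v = (\<Sum>i<length D. if v \<in> D ! i then i else 0)"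

text \<open>Comparing weights means comparing, from the largest entry on, the rows of the entries.\<close>

definition row_weight :: "nat \<Rightarrow> nat set list \<Rightarrow> nat"
  where "row_weight n D = (\<Sum>v\<le>n. row_of D v * Suc (length D) ^ v)"

lemma merge_at_append': "length pre = i \<Longrightarrow> merge_at f i (pre @ a # b # post) = pre @ f a b # post"
  by auto

lemma length_ospc: "C \<in> ospc n d \<Longrightarrow> length C = length d"
  by (auto simp: ospc_def)

lemma card_nth_ospc: "C \<in> ospc n d \<Longrightarrow> i < length d \<Longrightarrow> card (C ! i) = d ! i"
  by (auto simp: ospc_def)

lemma disjnt_nth:
  "sorted_wrt disjnt D \<Longrightarrow> i < length D \<Longrightarrow> j < length D \<Longrightarrow> i \<noteq> j \<Longrightarrow> disjnt (D ! i) (D ! j)"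
  using sorted_wrt_nth_less[of disjnt D i j] sorted_wrt_nth_less[of disjnt D j i]
  by (cases i j rule: linorder_cases) (auto simp: disjnt_sym)

lemma row_of_eq:
  assumes "sorted_wrt disjnt D" "i < length D" "v \<in> D ! i"
  shows "row_of D v = i"
proof -
  have "row_of D v = (\<Sum>j<length D. if j = i then i else 0)"
    unfolding row_of_def
  proof (rule sum.cong)
    fix j assume "j \<in> {..<length D}"
    then show "(if v \<in> D ! j then j else 0) = (if j = i then i else 0)"
      using disjnt_nth[OF assms(1), of i j] assms by (auto simp: disjnt_def)
  qed simp
  then show ?thesis using assms(2) by simp
qed

lemma row_of_notin: "v \<notin> \<Union> (set D) \<Longrightarrow> row_of D v = 0"
  unfolding row_of_def by (intro sum.neutral) auto

lemma row_of_less: "sorted_wrt disjnt D \<Longrightarrow> row_of D v < Suc (length D)"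
proof (cases "v \<in> \<Union> (set D)")
  case True
  assume "sorted_wrt disjnt D"
  with True show ?thesis
    by (auto simp: in_set_conv_nth row_of_eq)
qed (simp add: row_of_notin)

lemma row_weight_less:
  assumes "sorted_wrt disjnt D" "length D' = length D" "v0 \<le> n" "row_of D v0 < row_of D' v0"
    and "\<And>v. v0 < v \<Longrightarrow> v \<le> n \<Longrightarrow> row_of D v = row_of D' v"
  shows "row_weight n D < row_weight n D'"
  unfolding row_weight_def assms(2)
  using digits_lex_less[of n "row_of D" "Suc (length D)" v0 "row_of D'"] row_of_less[OF assms(1)] assms(3-)
  by simp

text \<open>D puts the smallest entries of the united block into row i. Any other distribution with
  the same sizes has to pull entries of row i + 1 down, which lowers the weight; hence D is the
  heaviest partition over its merge.\<close>

lemma row_weight_merge_less: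
  assumes D: "D \<in> ospc n d" and D': "D' \<in> ospc n d" and i: "Suc i < length d"
    and eq: "mrg i D = mrg i D'" "D \<noteq> D'"
    and small: "\<And>a b. a \<in> D ! i \<Longrightarrow> b \<in> D ! Suc i \<Longrightarrow> a < b"
  shows "row_weight n D' < row_weight n D"
proof -
  have len: "length D = length d" "length D' = length d"
    using D D' by (simp_all add: length_ospc)
  have dj: "sorted_wrt disjnt D" "sorted_wrt disjnt D'"
    using D D' by (simp_all add: ospc_def osp_def)
  obtain pre A B post where 1: "D = pre @ A # B # post" "length pre = i"
    using i len(1) by (metis split_at)
  obtain pre' A' B' post' where 2: "D' = pre' @ A' # B' # post'" "length pre' = i"
    using i len(2) by (metis split_at)
  have "pre @ (A \<union> B) # post = pre' @ (A' \<union> B') # post'"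
    using eq(1) merge_at_append'[OF 1(2), of "(\<union>)" A B post]
      merge_at_append'[OF 2(2), of "(\<union>)" A' B' post'] 1(1) 2(1) by simp
  then have "pre = pre' \<and> (A \<union> B) # post = (A' \<union> B') # post'"
    using 1(2) 2(2) by (subst (asm) append_eq_append_conv) auto
  then have same: "pre' = pre" "A' \<union> B' = A \<union> B" "post' = post"
    by auto
  have nth: "D ! i = A" "D ! Suc i = B" "D' ! i = A'" "D' ! Suc i = B'"
    using 1 2 by (auto simp: nth_append)
  have card: "card A' = card A"
    using card_nth_ospc[OF D, of i] card_nth_ospc[OF D', of i] i nth by simp
  have fin: "finite A" "finite A'"
    using osp_finite_member[of D n] osp_finite_member[of D' n] D D' 1 2 by (auto simp: ospc_def)
  have disj: "A \<inter> B = {}" "A' \<inter> B' = {}"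
    using dj 1 2 by (auto simp: sorted_wrt_disjnt_append sorted_wrt_disjnt_Cons disjnt_def)
  have "A' \<noteq> A"
    using eq(2) 1 2 same disj by blast
  then have ne: "A' - A \<noteq> {}"
    using card_subset_eq[OF fin(1), of A'] card by auto
  \<comment> \<open>The largest entry that moves down decides the comparison: all larger entries
    stand in the same row of both partitions.\<close>
  define x where "x = Max (A' - A)"
  have x: "x \<in> A'" "x \<notin> A" and xmax: "\<And>y. y \<in> A' \<Longrightarrow> y \<notin> A \<Longrightarrow> y \<le> x"
    using Max_in[OF _ ne] Max_ge[of "A' - A"] fin by (auto simp: x_def)
  have xB: "x \<in> B" using x same by auto
  have xn: "x \<le> n"
    using D 1 xB by (auto simp: ospc_def osp_def)
  show ?thesis
  proof (rule row_weight_less[OF dj(2) _ xn])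
    show "length D = length D'" using len by simp
    have "row_of D' x = i" "row_of D x = Suc i"
      using row_of_eq[OF dj(2), of i x] row_of_eq[OF dj(1), of "Suc i" x] nth x xB len i by auto
    then show "row_of D' x < row_of D x" by simp
    fix v assume v: "x < v" "v \<le> n"
    show "row_of D' v = row_of D v"
    proof (cases "v \<in> A \<union> B")
      case True
      have "v \<notin> A" using small[of v x] v(1) nth xB by auto
      moreover from this have "v \<notin> A'" using xmax[of v] v(1) by auto
      ultimately have "v \<in> B" "v \<in> B'" using True same by auto
      then show ?thesis
        using row_of_eq[OF dj(2), of "Suc i" v] row_of_eq[OF dj(1), of "Suc i" v] nth len i by auto
    next
      case False
      have "v \<in> D' ! j \<longleftrightarrow> v \<in> D ! j" if "j < length D" for j
        using False same 1 2 by (auto simp: nth_append nth_Cons split: nat.splits)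
      then show ?thesis
        unfolding row_of_def using len by (intro sum.cong) auto
    qed
  qed
qed

lemma nth_concat_take:
  "i < length xss \<Longrightarrow> l < length (xss ! i) \<Longrightarrow>
    concat xss ! (sum_list (take i (map length xss)) + l) = xss ! i ! l"
  by (induction xss arbitrary: i) (auto simp: nth_append nth_Cons add.assoc split: nat.splits)

lemma bij_betw_position:
  assumes u: "bij_betw u {..<n} {1..n}" and d: "0 \<notin> set d" "sum_list d = n"
    and v: "v \<in> {1..n}"
  obtains i j where "(i, j) \<in> border_strip d" "u (i + j) = v"
proof -
  have "v \<in> u ` {..<n}"
    using u v by (simp add: bij_betw_def)
  then obtain q where q: "q < n" "u q = v" by auto
  obtain i where i: "i < length d" "sum_list (take i d) \<le> q" "q < sum_list (take (Suc i) d)"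
    using position_exists[of q d] q(1) d(2) by auto
  have "(i, q - i) \<in> border_strip d" "i + (q - i) = q"
    using cell_exists[OF d(1) i(2,3,1)] by auto
  with q(2) that show thesis by metis
qed

lemma row_of_cut:
  assumes u: "bij_betw u {..<n} {1..n}" and d: "0 \<notin> set d" "sum_list d = n"
    and c: "(i, j) \<in> border_strip d"
  shows "row_of (cut u 0 d) (u (i + j)) = i"
proof (rule row_of_eq)
  show "sorted_wrt disjnt (cut u 0 d)"
    using cut_ospc[OF u d(2,1)] by (simp add: ospc_def osp_def)
  show "i < length (cut u 0 d)" "u (i + j) \<in> cut u 0 d ! i"
    using cell_position[OF d(1) c] by (simp_all add: nth_cut)
qed

text \<open>A column is an uninterrupted pile of cells, each step of which crosses the boundary
  between two adjacent rows, where the decrease is assumed.\<close>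

lemma column_decreasing:
  assumes d: "0 \<notin> set d"
    and dec: "\<And>i. Suc i < length d \<Longrightarrow> u (sum_list (take (Suc i) d)) < u (sum_list (take (Suc i) d) - 1)"
    and c: "(i, j) \<in> border_strip d" "(i', j) \<in> border_strip d" "i < i'"
  shows "u (i' + j) < (u (i + j) :: nat)"
proof -
  have len: "i' < length d" using c by (simp add: border_strip_def)
  have mono: "row_start d k \<le> row_start d l" if "k \<le> l" for k l
    unfolding row_start_def using that by (intro sum_mono2) auto
  have pos: "0 < d ! k" if "k < length d" for k
    using d that by (metis gr0I nth_mem)
  \<comment> \<open>Row starts increase weakly. Row i + 1 starts where row i ends, hence not before
    column j, and row i' starts not after it; so all rows from i + 1 to i' start exactly in column
    j.\<close>
  have j_eq: "row_start d (Suc k) = j" if k: "i \<le> k" "k < i'" for k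
  proof -
    have "j \<le> row_start d (Suc i)"
      using c(1) pos[of i] by (auto simp: border_strip_def row_start_Suc)
    moreover have "row_start d i' \<le> j" using c(2) by (simp add: border_strip_def)
    ultimately show ?thesis
      using mono[of "Suc i" "Suc k"] mono[of "Suc k" i'] k by linarith
  qed
  have step: "u (Suc k + j) < u (k + j)" if k: "i \<le> k" "k < i'" for k
  proof -
    have "sum_list (take (Suc k) d) = Suc k + j"
      using row_start_add[OF d, of "Suc k"] k len j_eq[OF k] by simp
    then show ?thesis
      using dec[of k] k len by simp
  qed
  have "l \<le> i' \<Longrightarrow> u (l + j) < u (i + j)" if "Suc i \<le> l" for l
    using that
  proof (induction l rule: dec_induct)
    case base
    then show ?case using step[of i] c(3) by simp
  next
    case (step l)
    then show ?case using \<open>\<And>k. i \<le> k \<Longrightarrow> k < i' \<Longrightarrow> u (Suc k + j) < u (k + j)\<close>[of l] by simp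
  qed
  then show ?thesis using c(3) by simp
qed

text \<open>If the columns are decreasing, the largest entry that is moved by a column permutation moves to a
  higher row.\<close>

lemma row_weight_column_perm:
  assumes u: "bij_betw u {..<n} {1..n}" and d: "0 \<notin> set d" "sum_list d = n"
    and dec: "\<And>i. Suc i < length d \<Longrightarrow> u (sum_list (take (Suc i) d)) < u (sum_list (take (Suc i) d) - 1)"
    and p: "p \<in> column_perms n d u" "p \<noteq> id"
  shows "row_weight n (cut u 0 d) < row_weight n (cut (p \<circ> u) 0 d)"
proof -
  have perm: "p permutes {1..n}" using p(1) by (simp add: column_perms_def)
  note pu = perm_comp_bij[OF u perm]
  define M where "M = {v. p v \<noteq> v}"
  have M: "M \<subseteq> {1..n}" using perm by (auto simp: M_def permutes_def)
  have "M \<noteq> {}" using p(2) by (auto simp: M_def)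
  moreover have fin: "finite M" using M finite_subset by blast
  ultimately have v0M: "Max M \<in> M" by (intro Max_in)
  define v0 where "v0 = Max M"
  \<comment> \<open>After \<open>p\<close> is applied, v0 stands in the cell that held w. By
    maximality w is smaller than v0, and in a decreasing column the smaller entry stands in the
    higher row.\<close>
  define w where "w = inv p v0"
  have pw: "p w = v0" using permutes_inverses[OF perm] by (simp add: w_def)
  have wv0: "w \<noteq> v0" using v0M pw by (auto simp: M_def v0_def)
  have wM: "w \<in> M" using pw wv0 by (simp add: M_def)
  then have wless: "w < v0" using Max_ge[OF fin wM] wv0 by (simp add: v0_def)
  have "v0 \<in> {1..n}" using v0M M v0_def by blast
  then obtain i0 j0 where c0: "(i0, j0) \<in> border_strip d" "u (i0 + j0) = v0"
    by (rule bij_betw_position[OF u d])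
  have "w \<in> {1..n}" using wM M by blast
  then obtain i1 j1 where c1: "(i1, j1) \<in> border_strip d" "u (i1 + j1) = w"
    by (rule bij_betw_position[OF u d])
  have "w \<in> u ` column_positions d j1"
    using c1 by (auto simp: column_positions_def)
  then have "p w \<in> p ` u ` column_positions d j1"
    by (rule imageI)
  then have "v0 \<in> u ` column_positions d j1"
    using p(1) pw by (simp only: column_perms_def mem_Collect_eq)
  then obtain q where q: "q \<in> column_positions d j1" "u q = u (i0 + j0)"
    using c0(2) by auto
  have "q = i0 + j0"
    using q(2) column_positions_less[OF d(1) q(1)] cell_position(4)[OF d(1) c0(1)] d(2)
      bij_betw_imp_inj_on[OF u] by (auto dest: inj_onD)
  then have "q \<in> column_positions d j0"
    using c0(1) unfolding column_positions_def by blast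
  then have j: "j0 = j1"
    using column_positions_disjoint[OF d(1)] q(1) by blast
  have "\<not> i1 < i0"
  proof
    assume "i1 < i0"
    then have "u (i0 + j1) < u (i1 + j1)"
      using column_decreasing[OF d(1) dec c1(1)] c0(1) j by blast
    then show False using c0(2) c1(2) j wless by simp
  qed
  moreover have "i1 \<noteq> i0" using c0 c1 j wless by auto
  ultimately have i: "i0 < i1" by simp
  show ?thesis
  proof (rule row_weight_less)
    show "sorted_wrt disjnt (cut u 0 d)"
      using cut_ospc[OF u d(2,1)] by (simp add: ospc_def osp_def)
    show "length (cut (p \<circ> u) 0 d) = length (cut u 0 d)" by simp
    show "v0 \<le> n" using v0M M by (auto simp: v0_def)
    have "row_of (cut u 0 d) v0 = i0"
      using row_of_cut[OF u d c0(1)] c0(2) by simp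
    moreover have "row_of (cut (p \<circ> u) 0 d) v0 = i1"
      using row_of_cut[OF pu d c1(1)] c1(2) pw by simp
    ultimately show "row_of (cut u 0 d) v0 < row_of (cut (p \<circ> u) 0 d) v0"
      using i by simp
    fix v assume v: "v0 < v" "v \<le> n"
    then have "v \<in> {1..n}" by simp
    then obtain i' j' where c: "(i', j') \<in> border_strip d" "u (i' + j') = v"
      by (rule bij_betw_position[OF u d])
    have "p v = v"
      using Max_ge[OF fin, of v] v(1) by (auto simp: M_def v0_def)
    then show "row_of (cut u 0 d) v = row_of (cut (p \<circ> u) 0 d) v"
      using row_of_cut[OF u d c(1)] row_of_cut[OF pu d c(1)] c(2) by simp
  qed
qed

lemma reading_word:
  assumes D: "D \<in> ospc n d" and d: "sum_list d = n"
  obtains u where "bij_betw u {..<n} {1..n}" "cut u 0 d = D"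
    "\<And>k l. k < length d \<Longrightarrow> l < d ! k \<Longrightarrow>
      u (sum_list (take k d) + l) = sorted_list_of_set (D ! k) ! l"
proof -
  have Dosp: "D \<in> osp n" and cardD: "map card D = d" using D by (auto simp: ospc_def)
  have dj: "sorted_wrt disjnt D" and UnD: "\<Union> (set D) = {1..n}"
    using Dosp by (auto simp: osp_def)
  have fin: "\<And>A. A \<in> set D \<Longrightarrow> finite A" using osp_finite_member[OF Dosp] .
  define xss where "xss = map sorted_list_of_set D"
  define u where "u = (!) (concat xss)"
  have len: "map length xss = d" "length xss = length d" "length D = length d"
    using cardD by (auto simp: xss_def)
  have "map set xss = D"
    using fin by (simp add: xss_def map_idI)
  then have cut: "cut u 0 d = D"
    using cut_nth_concat[of "[]" xss] len by (simp add: u_def)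
  have "set (concat xss) = {1..n}"
    using UnD fin by (auto simp: xss_def)
  moreover have lenc: "length (concat xss) = n"
    using len(1) d by (simp add: length_concat)
  moreover from calculation have "distinct (concat xss)"
    by (intro card_distinct) simp
  ultimately have bij: "bij_betw u {..<n} {1..n}"
    unfolding u_def by (intro bij_betw_nth) auto
  have entry: "u (sum_list (take k d) + l) = sorted_list_of_set (D ! k) ! l"
    if "k < length d" "l < d ! k" for k l
  proof -
    have "xss ! k = sorted_list_of_set (D ! k)" using that len by (simp add: xss_def)
    moreover have "length (xss ! k) = d ! k" using that len by (metis nth_map)
    ultimately show ?thesis
      using nth_concat_take[of k xss l] that len by (simp add: u_def)
  qed
  with bij cut that show thesis by blast
qed

text \<open>Each row is written in increasing order. At the boundary of two rows the column
  condition then compares the maximum of the lower row with the minimum of the upper one, and any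
  descent between the rows forces it.\<close>

lemma standard_tableau:
  assumes D: "D \<in> ospc n d" and d: "0 \<notin> set d" "sum_list d = n"
    and descent: "\<And>i. Suc i < length d \<Longrightarrow> \<exists>a\<in>D ! i. \<exists>b\<in>D ! Suc i. b \<le> a"
  obtains u where "bij_betw u {..<n} {1..n}" "cut u 0 d = D"
    "\<And>i. Suc i < length d \<Longrightarrow> u (sum_list (take (Suc i) d)) < u (sum_list (take (Suc i) d) - 1)"
proof -
  have Dosp: "D \<in> osp n" using D by (auto simp: ospc_def)
  have dj: "sorted_wrt disjnt D"
    using Dosp by (auto simp: osp_def)
  have fin: "\<And>A. A \<in> set D \<Longrightarrow> finite A" using osp_finite_member[OF Dosp] .
  have len: "length D = length d" using length_ospc[OF D] .
  obtain u where bij: "bij_betw u {..<n} {1..n}" and cut: "cut u 0 d = D"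
    and entry: "\<And>k l. k < length d \<Longrightarrow> l < d ! k \<Longrightarrow>
      u (sum_list (take k d) + l) = sorted_list_of_set (D ! k) ! l"
    using reading_word[OF D d(2)] by metis
  have pos: "0 < d ! k" if "k < length d" for k
    using d that by (metis gr0I nth_mem)
  have "u (sum_list (take (Suc i) d)) < u (sum_list (take (Suc i) d) - 1)" if i: "Suc i < length d" for i
  proof -
    obtain a b where ab: "a \<in> D ! i" "b \<in> D ! Suc i" "b \<le> a" using descent[OF i] by blast
    have disj: "disjnt (D ! i) (D ! Suc i)"
      using disjnt_nth[OF dj, of i "Suc i"] i len by simp
    have cards: "card (D ! i) = d ! i" "card (D ! Suc i) = d ! Suc i"
      using card_nth_ospc[OF D] i by simp_all
    have fins: "finite (D ! i)" "finite (D ! Suc i)"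
      using fin i len by auto
    define xs ys where "xs = sorted_list_of_set (D ! i)" and "ys = sorted_list_of_set (D ! Suc i)"
    have lens: "length xs = d ! i" "length ys = d ! Suc i" by (simp_all add: xs_def ys_def cards)
    have sets: "set xs = D ! i" "set ys = D ! Suc i" using fins by (simp_all add: xs_def ys_def)
    have sort: "sorted xs" "sorted ys" by (simp_all add: xs_def ys_def)
    obtain ka where ka: "ka < length xs" "xs ! ka = a" using ab(1) sets(1) by (metis in_set_conv_nth)
    obtain kb where kb: "kb < length ys" "ys ! kb = b" using ab(2) sets(2) by (metis in_set_conv_nth)
    have "a \<le> xs ! (d ! i - 1)" using ka sort(1) lens by (metis Suc_pred' le_less_Suc_eq less_Suc_eq_le not_le_imp_less
          diff_less less_numeral_extra(1) pos i Suc_lessD sorted_nth_mono)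
    moreover have "ys ! 0 \<le> b" using kb sort(2) by (metis le0 sorted_nth_mono)
    ultimately have le: "ys ! 0 \<le> xs ! (d ! i - 1)" using ab(3) by linarith
    have "ys ! 0 \<in> D ! Suc i" "xs ! (d ! i - 1) \<in> D ! i"
      using sets lens pos[of i] pos[OF i] i by (auto simp flip: sets)
    then have "ys ! 0 \<noteq> xs ! (d ! i - 1)" using disj by (auto simp: disjnt_def)
    with le have "ys ! 0 < xs ! (d ! i - 1)" by simp
    moreover have "u (sum_list (take (Suc i) d)) = ys ! 0"
      using entry[OF i pos[OF i]] by (simp add: ys_def)
    moreover have "sum_list (take (Suc i) d) - 1 = sum_list (take i d) + (d ! i - 1)"
      using i pos[of i] by (simp add: take_Suc_conv_app_nth)
    then have "u (sum_list (take (Suc i) d) - 1) = xs ! (d ! i - 1)"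
      using entry[of i "d ! i - 1"] i pos[of i] by (simp add: xs_def)
    ultimately show ?thesis by simp
  qed
  with bij cut that show thesis by blast
qed

text \<open>Every column permutation other than the identity raises the weight, so the lightest term
  comes from the identity alone and has its sign as coefficient.\<close>

lemma lookup_polytab:
  assumes u: "bij_betw u {..<n} {1..n}" and d: "0 \<notin> set d" "sum_list d = n"
    and dec: "\<And>i. Suc i < length d \<Longrightarrow> u (sum_list (take (Suc i) d)) < u (sum_list (take (Suc i) d) - 1)"
  shows "Poly_Mapping.lookup (polytab n d u :: _ \<Rightarrow>\<^sub>0 'k::field) (cut u 0 d) = 1"
    and "Poly_Mapping.lookup (polytab n d u :: _ \<Rightarrow>\<^sub>0 'k::field) C \<noteq> 0 \<Longrightarrow>
      C = cut u 0 d \<or> row_weight n (cut u 0 d) < row_weight n C"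
proof -
  have less: "row_weight n (cut u 0 d) < row_weight n (cut (p \<circ> u) 0 d)"
    if "p \<in> column_perms n d u" "p \<noteq> id" for p
    using row_weight_column_perm[OF u d dec that] by simp
  have id: "id \<in> column_perms n d u" by (simp add: column_perms_def permutes_id)
  have "Poly_Mapping.lookup (polytab n d u :: _ \<Rightarrow>\<^sub>0 'k) (cut u 0 d)
    = (\<Sum>p\<in>column_perms n d u. if p = id then 1 else 0)"
    unfolding polytab_def lookup_sum'
  proof (rule sum.cong)
    fix p assume "p \<in> column_perms n d u"
    then show "Poly_Mapping.lookup (Poly_Mapping.single (cut (p \<circ> u) 0 d) (of_int (sign p)))
        (cut u 0 d) = (if p = id then 1 else (0 :: 'k))"
      using less[of p] by (auto simp: lookup_single when_def)
  qed simp
  with id show "Poly_Mapping.lookup (polytab n d u :: _ \<Rightarrow>\<^sub>0 'k::field) (cut u 0 d) = 1" by simp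
  assume "Poly_Mapping.lookup (polytab n d u :: _ \<Rightarrow>\<^sub>0 'k::field) C \<noteq> 0"
  then obtain p where "p \<in> column_perms n d u"
    "Poly_Mapping.lookup (Poly_Mapping.single (cut (p \<circ> u) 0 d) (of_int (sign p) :: 'k)) C \<noteq> 0"
    unfolding polytab_def lookup_sum' by (rule sum.not_neutral_contains_not_neutral)
  then show "C = cut u 0 d \<or> row_weight n (cut u 0 d) < row_weight n C"
    using less[of p] by (cases "p = id") (auto simp: lookup_single when_def split: if_splits)
qed

text \<open>If row i of the lightest term D lay entirely below row i + 1 in value, then D would be
  the heaviest partition over its merge. As the lightest term it would be the only one there, and
  its coefficient would survive in the merged cycle.\<close>

lemma cyc_descent:
  assumes y: "y \<in> (cyc (length d) (ospc n d) :: (_ \<Rightarrow>\<^sub>0 'k::field) set)"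
    and D: "D \<in> Poly_Mapping.keys y"
    and least: "\<And>D'. D' \<in> Poly_Mapping.keys y \<Longrightarrow> row_weight n D \<le> row_weight n D'"
    and i: "Suc i < length d"
  shows "\<exists>a\<in>D ! i. \<exists>b\<in>D ! Suc i. b \<le> a"
proof (rule ccontr)
  assume neg: "\<not> ?thesis"
  let ?K = "{C \<in> Poly_Mapping.keys y. mrg i C = mrg i D}"
  have keys: "Poly_Mapping.keys y \<subseteq> ospc n d" and 0: "basis_map (mrg i) y = 0"
    using y i by (auto simp: cyc_def)
  have "?K = {D}"
  proof (intro equalityI subsetI)
    fix D' assume "D' \<in> ?K"
    then have D': "D' \<in> Poly_Mapping.keys y" "mrg i D = mrg i D'" by auto
    show "D' \<in> {D}"
    proof (rule ccontr)
      assume "D' \<notin> {D}"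
      then have "row_weight n D' < row_weight n D"
        using row_weight_merge_less[of D n d D' i] keys D D' i neg by force
      with least[OF D'(1)] show False by simp
    qed
  qed (use D in auto)
  then have "Poly_Mapping.lookup (basis_map (mrg i) y) (mrg i D) = Poly_Mapping.lookup y D"
    by (subst lookup_basis_map[of "Poly_Mapping.keys y"]) auto
  with 0 D show False by (simp add: in_keys_iff)
qed

text \<open>Gaussian elimination by weight: the lightest terms of a cycle satisfy all descent
  conditions, so they are leading terms of polytabloids. Subtracting these leaves a cycle of larger
  weight.\<close>

lemma cyc_subset_span:
  assumes 2: "of_nat (fact n) \<noteq> (0 :: 'k::field)" and d: "0 \<notin> set d" "sum_list d = n"
  shows "(cyc (length d) (ospc n d) :: (_ \<Rightarrow>\<^sub>0 'k) set)
    \<subseteq> free_vs.span (polytab n d ` {u. bij_betw u {..<n} {1..n}})" (is "?Z \<subseteq> ?S")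
proof -
  have sub: "free_vs.subspace ?Z"
    using stable_cyc[of n "ospc n d" "length d"] ospc_map by (auto simp: stable_def)
  \<comment> \<open>Larger than every weight, so a cycle whose terms all have weight at least m is
    zero. The induction descends from here.\<close>
  define m where "m = Suc (\<Sum>D\<in>ospc n d. row_weight n D)"
  have bound: "row_weight n D < m" if "D \<in> ospc n d" for D
    using member_le_sum[OF that, of "row_weight n"] by (simp add: m_def)
  have "y \<in> ?S" if "y \<in> ?Z" "\<And>D. D \<in> Poly_Mapping.keys y \<Longrightarrow> l \<le> row_weight n D" "l \<le> m" for y :: "_ \<Rightarrow>\<^sub>0 'k" and l
    using that(3,1,2)
  proof (induction l arbitrary: y rule: inc_induct)
    case base
    have "D \<notin> Poly_Mapping.keys y" for D
      using base(2)[of D] bound[of D] base(1) unfolding cyc_def by fastforce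
    then have "y = 0" by (metis ex_in_conv keys_eq_empty)
    then show ?case by (simp add: free_vs.span_zero)
  next
    case (step l)
    let ?K = "{D \<in> Poly_Mapping.keys y. row_weight n D = l}"
    have keys: "Poly_Mapping.keys y \<subseteq> ospc n d" using step.prems(1) by (simp add: cyc_def)
    have "\<exists>u. bij_betw u {..<n} {1..n} \<and> cut u 0 d = D \<and>
        (\<forall>i. Suc i < length d \<longrightarrow> u (sum_list (take (Suc i) d)) < u (sum_list (take (Suc i) d) - 1))"
      if D: "D \<in> ?K" for D
    proof -
      have "\<exists>a\<in>D ! i. \<exists>b\<in>D ! Suc i. b \<le> a" if "Suc i < length d" for i
        by (rule cyc_descent[OF step.prems(1) _ _ that]) (use D step.prems(2) in auto)
      moreover have "D \<in> ospc n d" using D keys by auto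
      ultimately show ?thesis using standard_tableau[OF _ d, of D] by metis
    qed
    then have "\<forall>D\<in>?K. \<exists>u. bij_betw u {..<n} {1..n} \<and> cut u 0 d = D \<and>
        (\<forall>i. Suc i < length d \<longrightarrow> u (sum_list (take (Suc i) d)) < u (sum_list (take (Suc i) d) - 1))"
      by (intro ballI)
    from bchoice[OF this] obtain U where "\<forall>D\<in>?K. bij_betw (U D) {..<n} {1..n} \<and> cut (U D) 0 d = D \<and>
        (\<forall>i. Suc i < length d \<longrightarrow> U D (sum_list (take (Suc i) d)) < U D (sum_list (take (Suc i) d) - 1))"
      by (elim exE)
    then have U: "\<And>D. D \<in> ?K \<Longrightarrow> bij_betw (U D) {..<n} {1..n}"
      "\<And>D. D \<in> ?K \<Longrightarrow> cut (U D) 0 d = D"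
      "\<And>D i. D \<in> ?K \<Longrightarrow> Suc i < length d \<Longrightarrow>
        U D (sum_list (take (Suc i) d)) < U D (sum_list (take (Suc i) d) - 1)"
      by blast+
    define e where "e = (\<Sum>D\<in>?K. fscale (Poly_Mapping.lookup y D) (polytab n d (U D)))"
    have eS: "e \<in> ?S"
      unfolding e_def using U(1)
      by (intro free_vs.span_sum free_vs.span_scale free_vs.span_base) auto
    have eZ: "e \<in> ?Z"
      unfolding e_def using U(1) polytab_cyc[OF 2 d]
      by (intro free_vs.subspace_sum[OF sub] free_vs.subspace_scale[OF sub]) auto
    have poly1: "Poly_Mapping.lookup (polytab n d (U D) :: _ \<Rightarrow>\<^sub>0 'k) D = 1" if "D \<in> ?K" for D
      using lookup_polytab(1)[OF U(1)[OF that] d U(3)[OF that]] U(2)[OF that] by simp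
    have poly2: "C = D \<or> l < row_weight n C"
      if "D \<in> ?K" "Poly_Mapping.lookup (polytab n d (U D) :: _ \<Rightarrow>\<^sub>0 'k) C \<noteq> 0" for C D
      using lookup_polytab(2)[OF U(1)[OF that(1)] d U(3)[OF that(1)] that(2)] U(2)[OF that(1)] that(1) by simp
    have "Suc l \<le> row_weight n C" if C: "C \<in> Poly_Mapping.keys (y - e)" for C
    proof (rule ccontr)
      assume "\<not> Suc l \<le> row_weight n C"
      then have le: "row_weight n C \<le> l" by simp
      \<comment> \<open>Up to weight l each polytabloid contributes its leading term only.\<close>
      have "Poly_Mapping.lookup e C = (\<Sum>D\<in>?K. if D = C then Poly_Mapping.lookup y C else 0)"
        unfolding e_def lookup_sum' using poly1 poly2 le by (intro sum.cong) force+
      also have "\<dots> = (if C \<in> ?K then Poly_Mapping.lookup y C else 0)"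
        by simp
      also have "\<dots> = Poly_Mapping.lookup y C"
        using step.prems(2)[of C] le by (auto simp: in_keys_iff)
      finally show False using C by (simp add: in_keys_iff lookup_minus)
    qed
    then have "y - e \<in> ?S"
      using free_vs.subspace_diff[OF sub step.prems(1) eZ] by (intro step.IH)
    from free_vs.span_add[OF this eS] show ?case by simp
  qed
  then show ?thesis using bound by (metis le0 subsetI)
qed

section \<open>Specht modules as kernels\<close>

definition row_tabloid :: "nat \<Rightarrow> nat list \<Rightarrow> nat set list \<Rightarrow> tabloid"
  where "row_tabloid n d D = {s \<in> tableaux n (border_strip d).
    \<forall>i. s ` row_cells (border_strip d) i = (if i < length d then D ! i else {})}"

text \<open>A relation and not a function: a tableau is extensional on the cells, whereas a word is
  constrained only on the positions below n, and both directions of the passage are needed.\<close>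

definition reads :: "nat \<Rightarrow> nat list \<Rightarrow> (nat \<times> nat \<Rightarrow> nat) \<Rightarrow> (nat \<Rightarrow> nat) \<Rightarrow> bool"
  where "reads n d t u \<longleftrightarrow> t \<in> tableaux n (border_strip d) \<and> bij_betw u {..<n} {1..n} \<and>
    (\<forall>(i, j)\<in>border_strip d. t (i, j) = u (i + j))"

lemma bij_betw_positions:
  assumes d: "0 \<notin> set d" "sum_list d = n"
  shows "bij_betw (\<lambda>(i, j). i + j) (border_strip d) {..<n}"
  unfolding bij_betw_def
proof
  show "inj_on (\<lambda>(i, j). i + j) (border_strip d)"
    using cell_unique[OF d(1)] by (auto intro!: inj_onI)
  show "(\<lambda>(i, j). i + j) ` border_strip d = {..<n}"
  proof (intro equalityI subsetI)
    fix q assume "q \<in> {..<n}"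
    then obtain i where i: "i < length d" "sum_list (take i d) \<le> q" "q < sum_list (take (Suc i) d)"
      using position_exists[of q d] d(2) by auto
    show "q \<in> (\<lambda>(i, j). i + j) ` border_strip d"
      using cell_exists[OF d(1) i(2,3,1)] by force
  qed (use cell_position(4)[OF d(1)] d(2) in auto)
qed

lemma reads_word_exists:
  assumes d: "0 \<notin> set d" "sum_list d = n" and t: "t \<in> tableaux n (border_strip d)"
  shows "\<exists>u. reads n d t u"
proof -
  let ?pos = "\<lambda>(i, j). i + j :: nat"
  let ?inv = "the_inv_into (border_strip d) ?pos"
  have "bij_betw (t \<circ> ?inv) {..<n} {1..n}"
    using t bij_betw_the_inv_into[OF bij_betw_positions[OF d]]
    by (auto simp: tableaux_def intro: bij_betw_trans)
  moreover have "?inv (i + j) = (i, j)" if "(i, j) \<in> border_strip d" for i j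
    using the_inv_into_f_f[OF bij_betw_imp_inj_on[OF bij_betw_positions[OF d]] that] by simp
  ultimately show ?thesis
    using t by (intro exI[of _ "t \<circ> ?inv"]) (auto simp: reads_def)
qed

lemma reads_tableau_exists:
  assumes d: "0 \<notin> set d" "sum_list d = n" and u: "bij_betw u {..<n} {1..n}"
  shows "\<exists>t. reads n d t u"
proof -
  let ?t = "\<lambda>c\<in>border_strip d. u (fst c + snd c)"
  have "bij_betw (u \<circ> (\<lambda>(i, j). i + j)) (border_strip d) {1..n}"
    by (rule bij_betw_trans[OF bij_betw_positions[OF d] u])
  then have "bij_betw ?t (border_strip d) {1..n}"
    by (rule iffD1[OF bij_betw_cong, rotated]) auto
  then show ?thesis
    using u by (intro exI[of _ ?t]) (auto simp: reads_def tableaux_def)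
qed

lemma reads_rows:
  assumes d: "0 \<notin> set d" "sum_list d = n" and r: "reads n d t u"
  shows "t ` row_cells (border_strip d) i = (if i < length d then cut u 0 d ! i else {})"
proof (cases "i < length d")
  case True
  have "t ` row_cells (border_strip d) i = u ` {i + j |j. (i, j) \<in> border_strip d}"
    using r by (auto simp: reads_def row_cells_def image_iff) (metis (mono_tags, lifting) case_prodD)+
  also have "{i + j |j. (i, j) \<in> border_strip d} = {sum_list (take i d)..<sum_list (take (Suc i) d)}"
  proof (intro equalityI subsetI)
    fix q assume "q \<in> {sum_list (take i d)..<sum_list (take (Suc i) d)}"
    then have "i \<le> q" "(i, q - i) \<in> border_strip d"
      using cell_exists[OF d(1), of i q] True by auto
    then show "q \<in> {i + j |j. (i, j) \<in> border_strip d}"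
      by (intro CollectI exI[of _ "q - i"]) simp
  qed (use cell_position[OF d(1)] in auto)
  finally show ?thesis using True by (simp add: nth_cut)
qed (auto simp: row_cells_def border_strip_def)

lemma reads_columns:
  assumes r: "reads n d t u"
  shows "t ` column_cells (border_strip d) j = u ` column_positions d j"
proof -
  have "t ` column_cells (border_strip d) j = (\<lambda>i. t (i, j)) ` {i. (i, j) \<in> border_strip d}"
    by (force simp: column_cells_def)
  also have "\<dots> = (\<lambda>i. u (i + j)) ` {i. (i, j) \<in> border_strip d}"
    using r by (intro image_cong) (auto simp: reads_def)
  finally show ?thesis by (auto simp: column_positions_def)
qed

lemma tabloid_eq_row_tabloid:
  assumes d: "0 \<notin> set d" "sum_list d = n" and r: "reads n d t u"
  shows "tabloid n (border_strip d) t = row_tabloid n d (cut u 0 d)"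
  by (simp add: tabloid_def row_tabloid_def reads_rows[OF d r])

lemma tableaux_compose:
  assumes "s \<in> tableaux n B" "p permutes {1..n}"
  shows "compose B p s \<in> tableaux n B"
proof -
  have "bij_betw (p \<circ> s) B {1..n}"
    using assms by (auto simp: tableaux_def intro: bij_betw_trans permutes_imp_bij)
  then have "bij_betw (compose B p s) B {1..n}"
    by (rule iffD1[OF bij_betw_cong, rotated]) (auto simp: compose_def)
  then show ?thesis by (simp add: tableaux_def)
qed

lemma image_compose_row: "compose B p s ` row_cells B i = p ` s ` row_cells B i"
  unfolding image_image by (intro image_cong) (auto simp: compose_def row_cells_def)

lemma tabloid_act_row_tabloid:
  assumes p: "p permutes {1..n}" and len: "length D = length d"
  shows "tabloid_act (border_strip d) p (row_tabloid n d D) = row_tabloid n d (map ((`) p) D)"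
proof -
  let ?B = "border_strip d"
  have sub: "compose ?B q s \<in> row_tabloid n d (map ((`) q) E)"
    if "s \<in> row_tabloid n d E" "q permutes {1..n}" "length E = length d" for q s E
    using that tableaux_compose[of s n ?B q] by (auto simp: row_tabloid_def image_compose_row)
  have "row_tabloid n d (map ((`) p) D) \<subseteq> compose ?B p ` row_tabloid n d D"
  proof
    fix s assume s: "s \<in> row_tabloid n d (map ((`) p) D)"
    have "map ((`) (inv p)) (map ((`) p) D) = D"
      using permutes_inv_o(2)[OF p] by (simp add: image_comp[symmetric] map_idI image_image permutes_inverses[OF p])
    then have "compose ?B (inv p) s \<in> row_tabloid n d D"
      using sub[OF s permutes_inv[OF p]] len by simp
    moreover have "compose ?B p (compose ?B (inv p) s) = s"
      using s permutes_inverses[OF p]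
      by (auto simp: compose_def row_tabloid_def tableaux_def extensional_def fun_eq_iff)
    ultimately show "s \<in> compose ?B p ` row_tabloid n d D" by force
  qed
  then show ?thesis
    using sub[OF _ p len] by (auto simp: tabloid_act_def)
qed

lemma polytabloid_eq:
  assumes d: "0 \<notin> set d" "sum_list d = n" and r: "reads n d t u"
  shows "polytabloid n (border_strip d) t = basis_map (row_tabloid n d) (polytab n d u)"
proof -
  have "column_stabilizer n (border_strip d) t = column_perms n d u"
    by (simp add: column_stabilizer_def column_perms_def reads_columns[OF r])
  moreover have "tabloid_act (border_strip d) p (tabloid n (border_strip d) t)
      = row_tabloid n d (cut (p \<circ> u) 0 d)" if "p \<in> column_perms n d u" for p
    using that tabloid_act_row_tabloid[of p n "cut u 0 d" d]
    by (simp add: tabloid_eq_row_tabloid[OF d r] map_image_cut column_perms_def)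
  ultimately show ?thesis
    by (simp add: polytabloid_def polytab_def basis_map_simps)
qed

text \<open>A reading of D gives a tableau inside its tabloid, and from any member of a tabloid the
  rows can be recovered.\<close>

lemma inj_on_row_tabloid:
  assumes d: "0 \<notin> set d" "sum_list d = n"
  shows "inj_on (row_tabloid n d) (ospc n d)"
proof (rule inj_onI)
  fix D D' assume D: "D \<in> ospc n d" "D' \<in> ospc n d" and eq: "row_tabloid n d D = row_tabloid n d D'"
  obtain u where u: "bij_betw u {..<n} {1..n}" "cut u 0 d = D"
    using reading_word[OF D(1) d(2)] by metis
  obtain t where t: "reads n d t u"
    using reads_tableau_exists[OF d u(1)] by blast
  have "t \<in> row_tabloid n d D"
    using t reads_rows[OF d t] u(2) by (auto simp: row_tabloid_def reads_def)
  with eq have "t \<in> row_tabloid n d D'" by simp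
  then have "D ! i = D' ! i" if "i < length d" for i
    using that reads_rows[OF d t, of i] u(2) by (auto simp: row_tabloid_def)
  then show "D = D'"
    using length_ospc[OF D(1)] length_ospc[OF D(2)] by (intro nth_equalityI) auto
qed

lemma inj_on_basis_map:
  assumes f: "inj_on f T"
  shows "inj_on (basis_map f) {x :: _ \<Rightarrow>\<^sub>0 'k::field. Poly_Mapping.keys x \<subseteq> T}"
proof (rule inj_onI)
  fix x y :: "_ \<Rightarrow>\<^sub>0 'k"
  assume xy: "x \<in> {x. Poly_Mapping.keys x \<subseteq> T}" "y \<in> {x. Poly_Mapping.keys x \<subseteq> T}"
    and eq: "basis_map f x = basis_map f y"
  let ?A = "Poly_Mapping.keys x \<union> Poly_Mapping.keys y"
  have "Poly_Mapping.lookup x D = Poly_Mapping.lookup y D" if "D \<in> ?A" for D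
  proof -
    have "{C \<in> ?A. f C = f D} = {D}"
      using that xy f by (auto dest: inj_onD)
    then have "Poly_Mapping.lookup (basis_map f x) (f D) = Poly_Mapping.lookup x D"
      "Poly_Mapping.lookup (basis_map f y) (f D) = Poly_Mapping.lookup y D"
      by (simp_all add: lookup_basis_map[of ?A])
    with eq show ?thesis by simp
  qed
  then show "x = y"
    by (intro poly_mapping_eqI) (metis UnCI in_keys_iff)
qed

lemma image_span:
  fixes f :: "('x \<Rightarrow>\<^sub>0 'k::field) \<Rightarrow> ('y \<Rightarrow>\<^sub>0 'k)"
  assumes f: "flin f"
  shows "f ` free_vs.span S = free_vs.span (f ` S)"
proof -
  interpret vector_space_pair "fscale :: 'k \<Rightarrow> ('x \<Rightarrow>\<^sub>0 'k) \<Rightarrow> _" "fscale :: 'k \<Rightarrow> ('y \<Rightarrow>\<^sub>0 'k) \<Rightarrow> _"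
    by unfold_locales
  show ?thesis
    using linear_span_image[OF f, of S] by simp
qed

text \<open>Both sides are spanned by polytabloids, and replacing a list of rows by its tabloid is
  injective on basis vectors.\<close>

theorem specht_iso:
  assumes inv: "of_nat (fact n) \<noteq> (0 :: 'k::field)" and d: "0 \<notin> set d" "sum_list d = n"
  shows "sym_module_iso n
    (fmodule (cyc (length d) (ospc n d)) perm_act :: ('k, nat set list \<Rightarrow>\<^sub>0 'k) sym_module)
    (specht_module n (border_strip d))"
proof -
  let ?Z = "cyc (length d) (ospc n d) :: (nat set list \<Rightarrow>\<^sub>0 'k) set"
  let ?f = "basis_map (row_tabloid n d) :: (nat set list \<Rightarrow>\<^sub>0 'k) \<Rightarrow> _"
  let ?U = "{u. bij_betw u {..<n} {1..n}}"
  have keys: "Poly_Mapping.keys x \<subseteq> ospc n d" if "x \<in> ?Z" for x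
    using that by (simp add: cyc_def)
  have sub: "free_vs.subspace ?Z"
    using stable_cyc[of n "ospc n d" "length d"] ospc_map by (auto simp: stable_def)
  have "?Z = free_vs.span (polytab n d ` ?U)"
  proof
    show "free_vs.span (polytab n d ` ?U) \<subseteq> ?Z"
      using polytab_cyc[OF inv d] sub by (intro free_vs.span_minimal) auto
  qed (rule cyc_subset_span[OF inv d])
  then have "?f ` ?Z = free_vs.span (?f ` polytab n d ` ?U)"
    using image_span[of ?f "polytab n d ` ?U"] by simp
  also have "?f ` polytab n d ` ?U = polytabloid n (border_strip d) ` tableaux n (border_strip d)"
  proof (intro equalityI subsetI)
    fix v assume "v \<in> ?f ` polytab n d ` ?U"
    then obtain u where "bij_betw u {..<n} {1..n}" "v = ?f (polytab n d u)" by auto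
    then obtain t where "reads n d t u" "v = polytabloid n (border_strip d) t"
      using reads_tableau_exists[OF d] polytabloid_eq[OF d] by metis
    then show "v \<in> polytabloid n (border_strip d) ` tableaux n (border_strip d)"
      by (auto simp: reads_def)
  next
    fix v assume "v \<in> (polytabloid n (border_strip d) :: _ \<Rightarrow> _ \<Rightarrow>\<^sub>0 'k) ` tableaux n (border_strip d)"
    then obtain t where t: "t \<in> tableaux n (border_strip d)" "v = polytabloid n (border_strip d) t" by auto
    then obtain u where "reads n d t u" using reads_word_exists[OF d] by blast
    then show "v \<in> ?f ` polytab n d ` ?U"
      using polytabloid_eq[OF d, of t u] t(2) by (auto simp: reads_def)
  qed
  finally have "bij_betw ?f ?Z (free_vs.span (polytabloid n (border_strip d) ` tableaux n (border_strip d)))"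
    using inj_on_subset[OF inj_on_basis_map[OF inj_on_row_tabloid[OF d]], of ?Z] keys
    by (auto simp: bij_betw_def)
  moreover have "?f (perm_act p x) = basis_map (tabloid_act (border_strip d) p) (?f x)"
    if p: "p permutes {1..n}" and x: "x \<in> ?Z" for p x
  proof -
    have "row_tabloid n d (map ((`) p) D) = tabloid_act (border_strip d) p (row_tabloid n d D)"
      if "D \<in> Poly_Mapping.keys x" for D
      using tabloid_act_row_tabloid[OF p, of D d] that keys[OF x] length_ospc[of D n d] by auto
    then show ?thesis
      unfolding perm_act_def basis_map_basis_map by (intro basis_map_cong) auto
  qed
  ultimately show ?thesis
    unfolding sym_module_iso_def specht_module_def
    by (intro exI[of _ ?f] conjI) (simp_all add: basis_map_simps)
qed

section \<open>Rearranging words within groups\<close>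

fun swp :: "nat \<Rightarrow> 'a list \<Rightarrow> 'a list" where
  "swp 0 (a # b # xs) = b # a # xs"
| "swp 0 [a] = [a]"
| "swp i [] = []"
| "swp (Suc i) (a # xs) = a # swp i xs"

lemma swp_append [simp]: "length pre = i \<Longrightarrow> swp i (pre @ a # b # post) = pre @ b # a # post"
  by (induction pre arbitrary: i) auto

lemma swp_append1: "Suc i < length v \<Longrightarrow> swp i (v @ w) = swp i v @ w"
  by (elim split_at) auto

lemma swp_append2: "swp (length v + i) (v @ w) = v @ swp i w"
  by (induction v) auto

lemma swp_swp [simp]: "swp i (swp i xs) = xs"
  by (induction i xs rule: swp.induct) auto

lemma mset_swp [simp]: "mset (swp i xs) = mset xs"
  by (induction i xs rule: swp.induct) auto

lemma merge_at_swp: "(\<And>a b. f a b = f b a) \<Longrightarrow> merge_at f i (swp i xs) = merge_at f i xs"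
  by (induction i xs rule: swp.induct) auto

section \<open>Inversions, and rearrangements inside the groups\<close>

fun inversions :: "nat list \<Rightarrow> nat" where
  "inversions [] = 0"
| "inversions (a # w) = length (filter (\<lambda>b. b < a) w) + inversions w"

text \<open>The inversions between two factors of a word depend only on the multisets of their
  letters, so they are blind to rearrangements inside a factor.\<close>

definition cross_inversions :: "nat multiset \<Rightarrow> nat multiset \<Rightarrow> nat"
  where "cross_inversions M N = (\<Sum>a\<in>#M. size (filter_mset (\<lambda>b. b < a) N))"

lemma inversions_append:
  "inversions (v @ w) = inversions v + inversions w + cross_inversions (mset v) (mset w)"
  by (induction v) (auto simp: cross_inversions_def simp flip: mset_filter)

lemma inversions_swap:
  "a < b \<Longrightarrow> inversions (pre @ b # a # post) = Suc (inversions (pre @ a # b # post))"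
proof -
  assume "a < b"
  then have "inversions (b # a # post) = Suc (inversions (a # b # post))" by auto
  moreover have "mset (b # a # post) = mset (a # b # post)" by simp
  ultimately show ?thesis by (simp only: inversions_append add_Suc add_Suc_right)
qed

lemma inversions_swp:
  assumes "Suc i < length w" "w ! i \<noteq> w ! Suc i"
  shows "inversions (swp i w) = Suc (inversions w) \<or> inversions w = Suc (inversions (swp i w))"
proof -
  obtain pre a b post where w: "w = pre @ a # b # post" "length pre = i"
    using assms(1) by (rule split_at)
  then have "a \<noteq> b" using assms(2) by (auto simp: nth_append)
  then show ?thesis
    using w inversions_swap[of a b pre post] inversions_swap[of b a pre post]
    by (cases a b rule: linorder_cases) auto
qed

lemma inversions_eq_0: "inversions w = 0 \<longleftrightarrow> sorted w"
  by (induction w) (auto simp: filter_empty_conv not_less)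

text \<open>The orbit of the concatenated word under the Young subgroup that permutes inside each
  group. The signed sum over it antisymmetrises every run.\<close>

fun arrangements :: "nat list list \<Rightarrow> nat list set" where
  "arrangements [] = {[]}"
| "arrangements (h # hs) = {k @ w |k w. mset k = mset h \<and> w \<in> arrangements hs}"

lemma finite_arrangements [simp]: "finite (arrangements hs)"
proof (induction hs)
  case (Cons h hs)
  have "arrangements (h # hs) = (\<lambda>(k, w). k @ w) ` ({k. mset k = mset h} \<times> arrangements hs)"
    by auto
  then show ?case using Cons by (simp add: mset_eq_finite)
qed simp

lemma mset_arrangements: "w \<in> arrangements hs \<Longrightarrow> mset w = mset (concat hs)"
  by (induction hs arbitrary: w) auto

lemma concat_arrangements: "concat hs \<in> arrangements hs"
  by (induction hs) auto

lemma arrangements_snoc: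
  "w \<in> arrangements (hs @ [[m]]) \<Longrightarrow> \<exists>v. w = v @ [m] \<and> mset v = mset (concat hs)"
proof (induction hs arbitrary: w)
  case (Cons h hs)
  from Cons.prems(1) obtain k w' where "w = k @ w'" "mset k = mset h" "w' \<in> arrangements (hs @ [[m]])"
    unfolding append_Cons arrangements.simps by blast
  with Cons.IH[of w'] show ?case by force
qed (auto simp: mset_single_iff)

text \<open>The inversions between different groups are constant on the orbit, and those inside a
  group vanish only for the sorted order.\<close>

lemma inversions_arrangements:
  assumes "w \<in> arrangements hs" "\<forall>h\<in>set hs. sorted h"
  shows "inversions (concat hs) \<le> inversions w \<and>
    (inversions w \<le> inversions (concat hs) \<longrightarrow> w = concat hs)"
  using assms
proof (induction hs arbitrary: w)
  case (Cons h hs)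
  from Cons.prems(1) obtain k v where w: "w = k @ v" "mset k = mset h" "v \<in> arrangements hs"
    unfolding arrangements.simps by blast
  have IH: "inversions (concat hs) \<le> inversions v"
    "inversions v \<le> inversions (concat hs) \<Longrightarrow> v = concat hs"
    using Cons.IH[OF w(3)] Cons.prems(2) by (meson list.set_intros(2))+
  have h: "sorted h" "inversions h = 0" using Cons.prems(2) by (simp_all add: inversions_eq_0)
  have 1: "inversions (concat (h # hs)) = inversions (concat hs) + cross_inversions (mset h) (mset (concat hs))"
    by (simp add: inversions_append h(2))
  have 2: "inversions w = inversions k + inversions v + cross_inversions (mset h) (mset (concat hs))"
    using w mset_arrangements[OF w(3)] by (simp add: inversions_append)
  have "w = concat (h # hs)" if "inversions w \<le> inversions (concat (h # hs))"
  proof -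
    have "inversions k = 0" "v = concat hs" using that 1 2 IH(1) IH(2) by linarith+
    moreover from this have "k = h"
      using properties_for_sort[OF w(2)] sorted_sort_id[OF h(1)] by (simp add: inversions_eq_0)
    ultimately show ?thesis using w(1) by simp
  qed
  then show ?case using 1 2 IH by auto
qed simp

text \<open>Two neighbouring positions either straddle the boundary of two groups or lie in one
  group, whose letters are distinct. The alternative decides by which of two mechanisms a merge
  cancels in \<open>lift_tableau_cyc\<close>.\<close>

lemma arrangements_swp:
  assumes "w \<in> arrangements hs" "\<forall>h\<in>set hs. distinct h" "Suc l < length w"
  shows "(\<exists>i. Suc i < length hs \<and> Suc l = length (concat (take (Suc i) hs))) \<or>
    swp l w \<in> arrangements hs \<and> w ! l \<noteq> w ! Suc l"
  using assms
proof (induction hs arbitrary: w l)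
  case (Cons h hs)
  from Cons.prems(1) obtain k v where w: "w = k @ v" "mset k = mset h" "v \<in> arrangements hs"
    unfolding arrangements.simps by blast
  have len: "length k = length h" using w(2) by (metis size_mset)
  consider "Suc l < length k" | "Suc l = length k" | l' where "l = length k + l'"
    by (metis le_Suc_ex less_Suc_eq_le linorder_cases)
  then show ?case
  proof cases
    case 1
    have "distinct k" using w(2) Cons.prems(2) by (metis list.set_intros(1) mset_eq_imp_distinct_iff)
    then have "w ! l \<noteq> w ! Suc l"
      using 1 by (simp add: w(1) nth_append nth_eq_iff_index_eq)
    moreover have "swp l w = swp l k @ v" using 1 by (simp add: w(1) swp_append1)
    then have "swp l w \<in> arrangements (h # hs)"
      unfolding arrangements.simps using w(2,3) by (intro CollectI exI[of _ "swp l k"] exI[of _ v]) simp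
    ultimately show ?thesis by blast
  next
    case 2
    have "hs \<noteq> []" using 2 Cons.prems(3) w by auto
    then show ?thesis using 2 len by (intro disjI1 exI[of _ 0]) auto
  next
    case 3
    have l': "Suc l' < length v" using Cons.prems(3) w(1) 3 by simp
    have "(\<exists>i. Suc i < length hs \<and> Suc l' = length (concat (take (Suc i) hs))) \<or>
        swp l' v \<in> arrangements hs \<and> v ! l' \<noteq> v ! Suc l'"
      using Cons.IH[OF w(3) _ l'] Cons.prems(2) by simp
    then show ?thesis
    proof (elim disjE)
      assume "\<exists>i. Suc i < length hs \<and> Suc l' = length (concat (take (Suc i) hs))"
      then obtain i where "Suc i < length hs" "Suc l' = length (concat (take (Suc i) hs))" by blast
      then show ?thesis using 3 len by (intro disjI1 exI[of _ "Suc i"]) simp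
    next
      assume "swp l' v \<in> arrangements hs \<and> v ! l' \<noteq> v ! Suc l'"
      then show ?thesis using 3 w by (auto simp: swp_append2 nth_append)
    qed
  qed
qed simp

lemma sum_take_arrangements:
  "w \<in> arrangements hs \<Longrightarrow> sum_list (take (length (concat (take j hs))) w) = sum_list (concat (take j hs))"
proof (induction hs arbitrary: w j)
  case (Cons h hs)
  from Cons.prems(1) obtain k v where w: "w = k @ v" "mset k = mset h" "v \<in> arrangements hs"
    unfolding arrangements.simps by blast
  have "length k = length h" "sum_list k = sum_list h"
    using w(2) by (metis size_mset, metis sum_mset_sum_list)
  then show ?case using Cons.IH[OF w(3)] w(1) by (cases j) auto
qed simp

section \<open>Uniting the blocks of each group\<close>

fun group :: "nat list \<Rightarrow> 'a set list \<Rightarrow> 'a set list" where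
  "group [] C = []"
| "group (l # ls) C = \<Union> (set (take l C)) # group ls (drop l C)"

lemma length_group [simp]: "length (group ls C) = length ls"
  by (induction ls C rule: group.induct) auto

lemma map_image_group: "map ((`) p) (group ls C) = group ls (map ((`) p) C)"
  by (induction ls C rule: group.induct) (auto simp: take_map drop_map image_Union)

lemma mrg_group: "mrg i (group ls C) = group (merge_at (+) i ls) C"
proof (induction i arbitrary: ls C)
  case 0
  show ?case by (cases ls; cases "tl ls") (auto simp: take_add add.commute)
next
  case (Suc i)
  then show ?case by (cases ls) auto
qed

lemma take_merge_at: "take a (merge_at f (a + k) xs) = take a xs"
proof (induction a arbitrary: xs)
  case (Suc a)
  then show ?case by (cases xs) auto
qed simp

lemma drop_merge_at: "drop a (merge_at f (a + k) xs) = merge_at f k (drop a xs)"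
proof (induction a arbitrary: xs)
  case (Suc a)
  then show ?case by (cases xs) auto
qed simp

text \<open>Blocks of the same group may be merged beforehand; the group then counts one block
  less.\<close>

lemma group_mrg:
  "Suc e < c \<Longrightarrow> sum_list as + c \<le> length C \<Longrightarrow>
    group (as @ c # bs) C = group (as @ (c - 1) # bs) (mrg (sum_list as + e) C)"
proof (induction as arbitrary: C)
  case Nil
  then have "Suc e < length C" by simp
  then obtain pre A B post where C: "C = pre @ A # B # post" "length pre = e"
    by (rule split_at)
  obtain c' where c': "c = Suc (Suc (e + c'))"
    using Nil(1) by (metis add_Suc_right add_Suc_shift less_imp_Suc_add)
  show ?case
    using C(2) by (simp add: c' C(1) merge_at_append'[OF C(2)] Un_ac)
next
  case (Cons a as)
  then show ?case
    using Cons.IH[of "drop a C"] by (simp add: add.assoc take_merge_at drop_merge_at)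
qed

lemma cut_append: "cut u s (v @ w) = cut u s v @ cut u (s + sum_list v) w"
  by (induction v arbitrary: s) (auto simp: add.assoc)

lemma group_cut: "group (map length hs) (cut u s (concat hs)) = cut u s (map sum_list hs)"
  by (induction hs arbitrary: s) (auto simp: cut_append Union_cut)

lemma Union_group: "\<Union> (set (group ls C)) = \<Union> (set (take (sum_list ls) C))"
  by (induction ls C rule: group.induct) (auto simp: take_add)

lemma group_osp:
  assumes "C \<in> osp n" "sum_list ls = length C" "0 \<notin> set ls"
  shows "group ls C \<in> osp n"
proof -
  have "sorted_wrt disjnt (group ls C) \<and> {} \<notin> set (group ls C)"
    if "sorted_wrt disjnt C" "{} \<notin> set C" "sum_list ls = length C" for C :: "nat set list"
    using that assms(3)
  proof (induction ls C rule: group.induct)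
    case (2 l ls C)
    have C: "C = take l C @ drop l C" by simp
    have dj: "sorted_wrt disjnt (drop l C)" "disjnt (\<Union> (set (take l C))) (\<Union> (set (drop l C)))"
      using 2(2) by (metis C sorted_wrt_disjnt_append)+
    have "sorted_wrt disjnt (group ls (drop l C)) \<and> {} \<notin> set (group ls (drop l C))"
      using 2 dj by (intro "2.IH") (auto dest: in_set_dropD)
    moreover have "\<Union> (set (take l C)) \<noteq> {}"
    proof -
      have "take l C \<noteq> []" using 2 by auto
      then have "hd (take l C) \<in> set (take l C)" by (rule hd_in_set)
      then show ?thesis using 2(3) by (metis Sup_upper in_set_takeD subset_empty)
    qed
    moreover have "take (sum_list ls) (drop l C) = drop l C" using 2 by simp
    ultimately show ?case
      using dj(2) by (simp add: sorted_wrt_disjnt_Cons Union_group del: sorted_wrt.simps)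
  qed simp
  with assms show ?thesis by (simp add: osp_def Union_group)
qed

lemma card_group:
  assumes "sorted_wrt disjnt C" "\<forall>A\<in>set C. finite A" "map card C = concat hs"
  shows "map card (group (map length hs) C) = map sum_list hs"
  using assms
proof (induction hs arbitrary: C)
  case (Cons h hs)
  have C: "C = take (length h) C @ drop (length h) C" by simp
  have "map card (take (length h) C) = h" "map card (drop (length h) C) = concat hs"
    using Cons.prems(3) by (simp_all add: take_map[symmetric] drop_map[symmetric])
  moreover have fin: "\<forall>A\<in>set (take (length h) C). finite A" "\<forall>A\<in>set (drop (length h) C). finite A"
    using Cons.prems(2) by (auto dest: in_set_dropD in_set_takeD)
  moreover have "sorted_wrt disjnt (take (length h) C)" "sorted_wrt disjnt (drop (length h) C)"
    using Cons.prems(1) by (metis C sorted_wrt_append)+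
  ultimately show ?case
    using Cons.IH[of "drop (length h) C"] sum_list_card_disjnt[of "take (length h) C"] fin by simp
qed simp

definition merge_groups :: "nat list list \<Rightarrow> (nat set list \<Rightarrow>\<^sub>0 'k::field) \<Rightarrow> (nat set list \<Rightarrow>\<^sub>0 'k)"
  where "merge_groups hs = lin_ext (\<lambda>C. if map card C = concat hs
    then Poly_Mapping.single (group (map length hs) C) 1 else 0)"

lemma flin_merge_groups [simp]: "flin (merge_groups hs)"
  by (simp add: merge_groups_def)

lemma merge_groups_perm_act:
  assumes "p permutes {1..n}"
  shows "merge_groups hs (perm_act p x) = perm_act p (merge_groups hs x)"
proof -
  have "map card (map ((`) p) C) = map card C" for C
    by (rule card_map_image[OF permutes_inj[OF assms]])
  then show ?thesis
    unfolding merge_groups_def perm_act_def lin_ext_basis_map basis_map_lin_ext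
    by (intro lin_ext_cong refl) (simp add: map_image_group basis_map_simps del: map_map)
qed

lemma sum_list_concat: "sum_list (concat xss) = (sum_list (map sum_list xss) :: nat)"
  by (induction xss) auto

text \<open>The letters are positive, so equal prefix sums of one word mean equal prefixes, and the
  last assumption says that \<open>hs'\<close> refines \<open>hs\<close>. The use is contrapositive:
  a different grouping with no more groups misses a cut of \<open>hs\<close>, and there
  \<open>column_cancel\<close> applies.\<close>

lemma prefix_sums_refine:
  assumes "concat hs' = concat hs" "\<forall>h\<in>set hs. h \<noteq> [] \<and> 0 \<notin> set h" "\<forall>h\<in>set hs'. h \<noteq> []"
    and "\<And>i. Suc i < length hs \<Longrightarrow>
      \<exists>l. sum_list (take l (map sum_list hs')) = (sum_list (take (Suc i) (map sum_list hs)) :: nat)"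
  shows "length hs \<le> length hs' \<and> (length hs' \<le> length hs \<longrightarrow> hs = hs')"
  using assms
proof (induction hs arbitrary: hs')
  case (Cons h t)
  show ?case
  proof (cases "t = []")
    case True
    have "hs' \<noteq> []" using Cons.prems by auto
    then obtain h' t' where hs': "hs' = h' # t'" by (cases hs') auto
    with Cons.prems True show ?thesis by (cases t') auto
  next
    case False
    obtain l where l: "sum_list (take l (map sum_list hs')) = sum_list h"
      using Cons.prems(4)[of 0] False by auto
    have sum: "sum_list (concat (take l hs')) = sum_list h"
      using l by (simp add: take_map sum_list_concat)
    have pre: "concat (take l hs') @ concat (drop l hs') = h @ concat t"
      using Cons.prems(1) by (simp flip: concat_append)
    have pos: "0 \<notin> set (h @ concat t)" using Cons.prems(2) by auto
    have h0: "0 < sum_list h" using Cons.prems(2) by (cases h) auto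
    from pre have "concat (take l hs') = h \<and> concat (drop l hs') = concat t"
    proof (rule append_eq_append_conv2[THEN iffD1, THEN exE])
      \<comment> \<open>One of the two prefixes extends the other by \<open>us\<close>; as their
        sums agree, \<open>us\<close> has sum 0 and is empty.\<close>
      fix us assume us: "concat (take l hs') = h @ us \<and> us @ concat (drop l hs') = concat t \<or>
        concat (take l hs') @ us = h \<and> concat (drop l hs') = us @ concat t"
      have "set us \<subseteq> set (concat t) \<or> set us \<subseteq> set h"
        using us by (metis Un_upper1 Un_upper2 set_append)
      then have "set us \<subseteq> set (h @ concat t)" by auto
      then have "0 \<notin> set us" using pos by blast
      moreover have "sum_list us = 0" using us sum by (metis add_cancel_right_right sum_list_append)
      ultimately have "us = []" by (cases us) auto
      with us show ?thesis by auto
    qed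
    then have eq: "concat (take l hs') = h" "concat (drop l hs') = concat t" by auto
    have l0: "0 < l" using eq(1) h0 by (cases l) auto
    have len': "l \<le> length hs'"
      using eq(2) Cons.prems(2) False by (cases t) (auto simp: not_le intro: ccontr)
    have "\<exists>l'. sum_list (take l' (map sum_list (drop l hs'))) = sum_list (take (Suc i) (map sum_list t))"
      if i: "Suc i < length t" for i
    proof -
      obtain l2 where l2: "sum_list (take l2 (map sum_list hs')) = sum_list h + sum_list (take (Suc i) (map sum_list t))"
        using Cons.prems(4)[of "Suc i"] i by auto
      have "l \<le> l2"
      proof (rule ccontr)
        assume "\<not> l \<le> l2"
        then have "sum_list (take l2 (map sum_list hs')) \<le> sum_list h"
          using sum_list_take_mono[of l2 l "map sum_list hs'"] l by simp
        then have "sum_list (take (Suc i) (map sum_list t)) = 0" using l2 by simp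
        then show False using Cons.prems(2) i by (cases t; cases "hd t") auto
      qed
      then obtain l' where l': "l2 = l + l'" by (metis le_Suc_ex)
      then have "sum_list (take l2 (map sum_list hs')) = sum_list h + sum_list (take l' (map sum_list (drop l hs')))"
        using l by (simp add: take_add drop_map)
      with l2 show ?thesis by auto
    qed
    then have IH: "length t \<le> length (drop l hs')" "length (drop l hs') \<le> length t \<Longrightarrow> t = drop l hs'"
      using Cons.IH[of "drop l hs'"] Cons.prems(2,3) eq(2) by (auto dest: in_set_dropD)
    have "h # t = hs'" if "length hs' \<le> length (h # t)"
    proof -
      have "l = 1" using that IH(1) l0 len' by simp
      moreover have "t = drop l hs'" using that IH(2) l0 by simp
      moreover have "hs' \<noteq> []" using len' l0 by auto
      ultimately show ?thesis using eq(1) by (cases hs') auto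
    qed
    then show ?thesis using IH(1) l0 len' by auto
  qed
qed simp

lemma length_le_sum_list: "0 \<notin> set w \<Longrightarrow> length w \<le> sum_list (w :: nat list)"
  by (induction w) auto

section \<open>The filtration of the top cycles by words with runs\<close>

locale pointed_type =
  fixes lam :: "nat multiset" and m n :: nat
  assumes parts_pos: "0 \<notin># lam" and m_pos: "0 < m" and total: "sum_mset lam + m = n"
begin

definition osp_type :: "nat set list set"
  where "osp_type = {C \<in> osp n. \<exists>v. map card C = v @ [m] \<and> mset v = lam}"

text \<open>A sum of parts of distinct values is recorded by listing these parts in strictly
  increasing order. The runs need not be maximal; the pointed number always forms a group of its own
  because the last entry of a composition in V is m.\<close>

definition grouped_words :: "nat list list set"
  where "grouped_words = {gs @ [[m]] |gs.
    (\<forall>g\<in>set gs. g \<noteq> [] \<and> sorted_wrt (<) g) \<and> mset (concat gs) = lam}"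

text \<open>There are at most \<open>size lam + 1\<close> groups, so the factor
  \<open>size lam + 2\<close> makes the comparison lexicographic, inversions before groups.\<close>

definition group_weight :: "nat list list \<Rightarrow> nat"
  where "group_weight hs = inversions (concat hs) * (size lam + 2) + length hs"

lemma finite_osp_type [simp]: "finite osp_type"
  by (rule finite_subset[of _ "osp n"]) (auto simp: osp_type_def)

lemma osp_type_map:
  assumes "C \<in> osp_type" "p permutes {1..n}"
  shows "map ((`) p) C \<in> osp_type"
proof -
  have "map card (map ((`) p) C) = map card C"
    by (rule card_map_image[OF permutes_inj[OF assms(2)]])
  with osp_map[OF _ assms(2), of C] assms(1) show ?thesis
    by (simp only: osp_type_def mem_Collect_eq)
qed

lemma length_osp_type: "C \<in> osp_type \<Longrightarrow> length C = Suc (size lam)"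
  by (auto simp: osp_type_def dest!: arg_cong[where f = length])

lemma word_facts:
  assumes "mset v = lam"
  shows "0 \<notin> set (v @ [m])" "sum_list (v @ [m]) = n" "length (v @ [m]) = Suc (size lam)"
  using assms parts_pos m_pos total by (auto simp: sum_mset_sum_list)

lemma grouped_words_facts:
  assumes "hs \<in> grouped_words"
  shows "\<exists>v. concat hs = v @ [m] \<and> mset v = lam" "hs \<noteq> []" "\<forall>h\<in>set hs. h \<noteq> []"
    "\<forall>h\<in>set hs. sorted h \<and> distinct h" "\<forall>h\<in>set hs. 0 \<notin> set h" "length hs \<le> Suc (size lam)"
    "0 \<notin> set (map sum_list hs)" "sum_list (map sum_list hs) = n"
proof -
  obtain gs where hs: "hs = gs @ [[m]]" and gs: "\<forall>g\<in>set gs. g \<noteq> [] \<and> sorted_wrt (<) g"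
    and lam: "mset (concat gs) = lam"
    using assms by (auto simp: grouped_words_def)
  show "\<exists>v. concat hs = v @ [m] \<and> mset v = lam" "hs \<noteq> []" "\<forall>h\<in>set hs. h \<noteq> []"
    using hs gs lam by auto
  show "\<forall>h\<in>set hs. sorted h \<and> distinct h"
    using hs gs by (auto simp: strict_sorted_iff)
  have "0 \<notin> set (concat gs)" using lam parts_pos by (metis set_mset_mset)
  then show pos: "\<forall>h\<in>set hs. 0 \<notin> set h" using hs m_pos by auto
  have "length gs \<le> length (concat gs)"
    using gs by (induction gs) (auto simp: neq_Nil_conv)
  also have "\<dots> = size lam" using lam by (metis size_mset)
  finally show "length hs \<le> Suc (size lam)" using hs by simp
  show "0 \<notin> set (map sum_list hs)"
  proof
    assume "0 \<in> set (map sum_list hs)"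
    then obtain h where "h \<in> set hs" "sum_list h = 0" by auto
    with pos \<open>\<forall>h\<in>set hs. h \<noteq> []\<close> show False by (cases h) auto
  qed
  show "sum_list (map sum_list hs) = n"
    using word_facts(2)[OF lam] hs by (simp add: sum_list_concat)
qed

lemma singletons_grouped: "mset v = lam \<Longrightarrow> map (\<lambda>a. [a]) (v @ [m]) \<in> grouped_words"
  by (auto simp: grouped_words_def intro!: exI[of _ "map (\<lambda>a. [a]) v"])

lemma group_singletons: "length C = length w \<Longrightarrow> group (map length (map (\<lambda>a. [a]) w)) C = C"
proof (induction w arbitrary: C)
  case (Cons a w)
  then show ?case by (cases C) auto
qed simp

text \<open>With singleton groups nothing is united, and the map is the bare projection onto the
  component of the word. Hence these groupings read off every coefficient.\<close>

lemma lookup_merge_singletons: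
  assumes x: "Poly_Mapping.keys x \<subseteq> osp_type" and C: "map card C = v"
    and 0: "merge_groups (map (\<lambda>a. [a]) v) x = (0 :: _ \<Rightarrow>\<^sub>0 'k::field)"
  shows "Poly_Mapping.lookup x C = 0"
proof -
  have "merge_groups (map (\<lambda>a. [a]) v) x
      = lin_ext (\<lambda>C. if map card C = v then Poly_Mapping.single C 1 else 0) x"
    unfolding merge_groups_def
  proof (rule lin_ext_cong)
    fix C
    have "concat (map (\<lambda>a. [a]) v) = v" by (induction v) auto
    moreover have "group (map length (map (\<lambda>a. [a]) v)) C = C" if "map card C = v"
      using that by (intro group_singletons) auto
    ultimately show "(if map card C = concat (map (\<lambda>a. [a]) v)
        then Poly_Mapping.single (group (map length (map (\<lambda>a. [a]) v)) C) 1 else 0)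
      = (if map card C = v then Poly_Mapping.single C 1 else (0 :: _ \<Rightarrow>\<^sub>0 'k))" by simp
  qed simp
  then have "0 = Poly_Mapping.lookup (lin_ext (\<lambda>C. if map card C = v then Poly_Mapping.single C 1 else 0) x) C"
    using 0 by simp
  also have "\<dots> = (\<Sum>D\<in>osp_type. if D = C then Poly_Mapping.lookup x C else 0)"
    unfolding lookup_lin_ext[OF finite_osp_type x] using C
    by (intro sum.cong) (auto simp: lookup_single when_def)
  also have "\<dots> = Poly_Mapping.lookup x C"
    using x by (auto simp: in_keys_iff)
  finally show ?thesis by simp
qed

lemma merge_groups_keys:
  assumes x: "Poly_Mapping.keys x \<subseteq> osp_type" and hs: "hs \<in> grouped_words"
  shows "Poly_Mapping.keys (merge_groups hs x :: _ \<Rightarrow>\<^sub>0 'k::field) \<subseteq> ospc n (map sum_list hs)"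
proof
  fix D assume "D \<in> Poly_Mapping.keys (merge_groups hs x :: _ \<Rightarrow>\<^sub>0 'k)"
  then obtain C where C: "C \<in> Poly_Mapping.keys x" "map card C = concat hs" "D = group (map length hs) C"
    unfolding merge_groups_def using keys_lin_ext[of _ x] by (fastforce split: if_splits)
  have osp: "C \<in> osp n" using C(1) x by (auto simp: osp_type_def)
  have "length C = sum_list (map length hs)"
    using C(2) by (metis length_concat length_map)
  moreover have "0 \<notin> set (map length hs)" using grouped_words_facts(3)[OF hs] by auto
  ultimately have "D \<in> osp n" using group_osp[OF osp] C(3) by simp
  moreover have "map card D = map sum_list hs"
    using card_group[OF _ _ C(2)] osp osp_finite_member[OF osp] C(3) by (auto simp: osp_def)
  ultimately show "D \<in> ospc n (map sum_list hs)" by (simp add: ospc_def)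
qed

text \<open>At an ascent inside a word the two groups can be joined to a group of smaller weight. At a weak
  descent a term in the boundary of the component \<open>concat hs\<close> can only be cancelled by the word
  with the two letters exchanged, which has fewer inversions.\<close>

lemma merge_groups_into:
  fixes x :: "nat set list \<Rightarrow>\<^sub>0 'k::field"
  assumes x: "x \<in> cyc (Suc (size lam)) osp_type" and hs: "hs \<in> grouped_words"
    and 0: "\<And>hs'. hs' \<in> grouped_words \<Longrightarrow> group_weight hs' < group_weight hs \<Longrightarrow> merge_groups hs' x = 0"
  shows "merge_groups hs x \<in> cyc (length hs) (ospc n (map sum_list hs))"
proof -
  have keys: "Poly_Mapping.keys x \<subseteq> osp_type" using x by (simp add: cyc_def)
  have "basis_map (mrg i) (merge_groups hs x) = 0" if i: "Suc i < length hs" for i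
  proof -
    obtain h1 g1 g2 h2 where hs_eq: "hs = h1 @ g1 # g2 # h2" and h1: "length h1 = i"
      using i by (rule split_at)
    note facts = grouped_words_facts[OF hs]
    obtain g1' a where g1: "g1 = g1' @ [a]" using facts(3) hs_eq by (metis in_set_conv_decomp rev_exhaust)
    obtain b g2' where g2: "g2 = b # g2'" using facts(3) hs_eq by (metis in_set_conv_decomp list.exhaust append_Cons append_assoc append_Nil)
    define hs' where "hs' = h1 @ (g1 @ g2) # h2"
    have len': "merge_at (+) i (map length hs) = map length hs'"
      using merge_at_append'[of "map length h1" i "(+)" "length g1" "length g2" "map length h2"] h1
      by (simp add: hs_eq hs'_def)
    have conc: "concat hs' = concat hs" by (simp add: hs_eq hs'_def)
    have step: "basis_map (mrg i) (merge_groups hs x) = lin_ext (\<lambda>C. if map card C = concat hs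
        then Poly_Mapping.single (group (map length hs') C) 1 else 0) x"
      unfolding merge_groups_def basis_map_lin_ext
      by (intro lin_ext_cong refl) (simp add: mrg_group len' basis_map_simps)
    show ?thesis
    \<comment> \<open>If \<open>h2\<close> is empty, the second group is the pointed one and cannot
      be joined. This boundary is treated together with the weak descents: every word ends in m,
      which excludes the exchanged word.\<close>
    proof (cases "h2 \<noteq> [] \<and> a < b")
      case True
      obtain gs where gs: "hs = gs @ [[m]]" "\<forall>g\<in>set gs. g \<noteq> [] \<and> sorted_wrt (<) g" "mset (concat gs) = lam"
        using hs by (auto simp: grouped_words_def)
      obtain h2' where h2: "h2 = h2' @ [[m]]" using gs(1) hs_eq True by (cases h2 rule: rev_exhaust) auto
      have gs': "gs = h1 @ g1 # g2 # h2'" using gs(1) hs_eq h2 by simp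
      have "sorted_wrt (<) (g1 @ g2)"
        using gs(2) True unfolding gs' g1 g2 by (fastforce simp: sorted_wrt_append)
      then have "hs' \<in> grouped_words"
        unfolding grouped_words_def using gs(2,3)
        by (intro CollectI exI[of _ "h1 @ (g1 @ g2) # h2'"]) (auto simp: gs' hs'_def h2)
      moreover have "group_weight hs' < group_weight hs"
        unfolding group_weight_def conc by (simp add: hs_eq hs'_def)
      ultimately have "merge_groups hs' x = 0" by (rule 0)
      then have "lin_ext (\<lambda>C. if map card C = concat hs
          then Poly_Mapping.single (group (map length hs') C) 1 else 0) x = 0"
        unfolding merge_groups_def conc .
      then show ?thesis unfolding step .
    next
      case False
      define P Q where "P = concat h1 @ g1'" and "Q = g2' @ concat h2"
      have w: "concat hs = P @ a # b # Q" by (simp add: hs_eq g1 g2 P_def Q_def)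
      define l where "l = length P"
      obtain v0 where v0: "concat hs = v0 @ [m]" "mset v0 = lam" using facts(1) by blast
      \<comment> \<open>By comparison of multisets, a word with this merge at l is
        \<open>concat hs\<close> or has a and b exchanged. The second word has smaller weight as a
        singleton grouping, so it does not occur in the support of x.\<close>
      have claim: "map card C = concat hs \<longleftrightarrow> map card (mrg l C) = P @ (a + b) # Q"
        if C: "C \<in> Poly_Mapping.keys x" for C
      proof
        have osp: "C \<in> osp n" using C keys by (auto simp: osp_type_def)
        obtain v where v: "map card C = v @ [m]" "mset v = lam" using C keys by (auto simp: osp_type_def)
        have cm: "map card (mrg l C) = merge_at (+) l (map card C)" by (rule card_mrg[OF osp])
        show "map card (mrg l C) = P @ (a + b) # Q" if "map card C = concat hs"
          unfolding cm that w by (simp add: l_def)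
        assume eq: "map card (mrg l C) = P @ (a + b) # Q"
        have lenC: "length (v @ [m]) = length (concat hs)"
          using v0 v(2) by (metis length_append size_mset)
        then have "Suc l < length (v @ [m])" by (simp add: w l_def)
        then obtain P' a' b' Q' where v': "v @ [m] = P' @ a' # b' # Q'" "length P' = l"
          by (rule split_at)
        have "P' @ (a' + b') # Q' = P @ (a + b) # Q"
          using eq cm v(1) v' merge_at_append'[OF v'(2)] by metis
        then have same: "P' = P" "a' + b' = a + b" "Q' = Q"
          using v'(2) by (auto simp: l_def)
        have "mset (v @ [m]) = mset (v0 @ [m])" using v v0 by simp
        then have ms: "{#a', b'#} = {#a, b#}"
        proof -
          have "v @ [m] = P @ a' # b' # Q" using v'(1) same by simp
          moreover have "v0 @ [m] = P @ a # b # Q" using v0(1) w by simp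
          ultimately have "mset (P @ a' # b' # Q) = mset (P @ a # b # Q)"
            using \<open>mset (v @ [m]) = mset (v0 @ [m])\<close> by (simp only:)
          then show ?thesis by simp
        qed
        show "map card C = concat hs"
        proof (cases "a' = a")
          case True
          then show ?thesis using v(1) v' same w by simp
        next
          case ne: False
          then have swap: "a' = b" "b' = a" using ms by (auto simp: add_eq_conv_ex)
          have "Q \<noteq> []"
          proof
            assume "Q = []"
            then have "b' = m" "b = m" using v' v0(1) w same by (metis last.simps last_appendR list.distinct(1) last_snoc)+
            with ne swap same(2) show False by simp
          qed
          have "h2 \<noteq> []"
          proof
            assume "h2 = []"
            then have "g2 = [m]" using hs hs_eq by (auto simp: grouped_words_def)
            with \<open>h2 = []\<close> g2 \<open>Q \<noteq> []\<close> show False by (simp add: Q_def)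
          qed
          with False ne swap have "b < a" by simp
          then have inv: "inversions (concat hs) = Suc (inversions (v @ [m]))"
            using inversions_swap[of b a P Q] v' same swap w by simp
          have "group_weight (map (\<lambda>a. [a]) (v @ [m])) < group_weight hs"
          proof -
            have "concat (map (\<lambda>a. [a]) (v @ [m])) = v @ [m]" by (induction v) auto
            moreover have "length v = size lam" using v(2) by (metis size_mset)
            ultimately show ?thesis unfolding group_weight_def inv by simp
          qed
          then have "merge_groups (map (\<lambda>a. [a]) (v @ [m])) x = 0"
            using singletons_grouped[OF v(2)] by (intro 0)
          then have "Poly_Mapping.lookup x C = 0"
            using lookup_merge_singletons[OF keys v(1)] by blast
          with C show ?thesis by (simp add: in_keys_iff)
        qed
      qed
      have l: "Suc l < Suc (size lam)"
      proof -
        have "length (P @ a # b # Q) = Suc (size lam)"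
          using word_facts(3)[OF v0(2)] w v0(1) by metis
        then show ?thesis by (simp add: l_def)
      qed
      have bm: "basis_map (mrg l) x = 0" using x l by (simp add: cyc_def)
      \<comment> \<open>Since the merge at l has already been carried out, the joined group has one
        block less.\<close>
      define ls where "ls = map length h1 @ (length g1 + length g2 - 1) # map length h2"
      have "lin_ext (\<lambda>C. if map card C = concat hs
            then Poly_Mapping.single (group (map length hs') C) 1 else 0) x
          = lin_ext (\<lambda>C. if map card (mrg l C) = P @ (a + b) # Q
            then Poly_Mapping.single (group ls (mrg l C)) 1 else (0 :: _ \<Rightarrow>\<^sub>0 'k)) x"
      proof (rule lin_ext_cong)
        fix C assume C: "C \<in> Poly_Mapping.keys x"
        have "group (map length hs') C = group ls (mrg l C)" if "map card C = concat hs"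
        proof -
          have "length C = length (concat hs)" using that by (metis length_map)
          then have "sum_list (map length h1) + (length g1 + length g2) \<le> length C"
            by (simp add: hs_eq length_concat)
          moreover have "l = sum_list (map length h1) + length g1'"
            by (simp add: l_def P_def length_concat)
          ultimately show ?thesis
            using group_mrg[of "length g1'" "length g1 + length g2" "map length h1" C "map length h2"]
            by (simp add: hs'_def ls_def g1 g2)
        qed
        with claim[OF C] show "(if map card C = concat hs
            then Poly_Mapping.single (group (map length hs') C) 1 else 0)
          = (if map card (mrg l C) = P @ (a + b) # Q
            then Poly_Mapping.single (group ls (mrg l C)) 1 else (0 :: _ \<Rightarrow>\<^sub>0 'k))" by auto
      qed simp
      also have "\<dots> = lin_ext (\<lambda>R. if map card R = P @ (a + b) # Q
            then Poly_Mapping.single (group ls R) 1 else (0 :: _ \<Rightarrow>\<^sub>0 'k)) (basis_map (mrg l) x)"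
        by (simp add: lin_ext_basis_map)
      also have "\<dots> = 0" by (simp add: bm lin_ext_simps)
      finally show ?thesis unfolding step .
    qed
  qed
  then show ?thesis
    using merge_groups_keys[OF keys hs] by (simp add: cyc_def)
qed

text \<open>The tabloids of a polytabloid are cut along whole words, antisymmetrised inside each
  run. The constant summand in the exponent normalises the coefficient of the word
  \<open>concat hs\<close> to that of the polytabloid.\<close>

definition lift_tableau :: "nat list list \<Rightarrow> (nat \<Rightarrow> nat) \<Rightarrow> (nat set list \<Rightarrow>\<^sub>0 'k::field)"
  where "lift_tableau hs u = (\<Sum>p\<in>column_perms n (map sum_list hs) u. \<Sum>w\<in>arrangements hs.
    Poly_Mapping.single (cut (p \<circ> u) 0 w) (of_int (sign p) * (- 1) ^ (inversions w + inversions (concat hs))))"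

lemma arrangements_facts:
  assumes hs: "hs \<in> grouped_words" and w: "w \<in> arrangements hs"
  shows "\<exists>v. w = v @ [m] \<and> mset v = lam"
  using assms arrangements_snoc unfolding grouped_words_def by fastforce

lemma lift_tableau_keys:
  assumes hs: "hs \<in> grouped_words" and u: "bij_betw u {..<n} {1..n}"
  shows "Poly_Mapping.keys (lift_tableau hs u :: _ \<Rightarrow>\<^sub>0 'k::field) \<subseteq> osp_type"
proof -
  have "cut (p \<circ> u) 0 w \<in> osp_type" if p: "p \<in> column_perms n (map sum_list hs) u" and w: "w \<in> arrangements hs" for p w
  proof -
    obtain v where v: "w = v @ [m]" "mset v = lam"
      using arrangements_facts[OF hs w] by blast
    have "bij_betw (p \<circ> u) {..<n} {1..n}"
      using p by (intro perm_comp_bij[OF u]) (simp add: column_perms_def)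
    then show ?thesis
      using cut_ospc[of "p \<circ> u" n w] word_facts(1,2)[OF v(2)] v by (simp add: ospc_def osp_type_def)
  qed
  then show ?thesis
    unfolding lift_tableau_def
    by (intro order_trans[OF Poly_Mapping.keys_sum] UN_least) auto
qed

text \<open>A merge across a group boundary cancels in the sum over the column group. A merge inside
  a group cancels in the sum over words: exchanging two distinct neighbours changes the parity of
  the inversions and is invisible after merging.\<close>

lemma lift_tableau_cyc:
  assumes inv: "of_nat (fact n) \<noteq> (0 :: 'k::field)" and hs: "hs \<in> grouped_words"
    and u: "bij_betw u {..<n} {1..n}"
  shows "(lift_tableau hs u :: _ \<Rightarrow>\<^sub>0 'k) \<in> cyc (Suc (size lam)) osp_type"
proof -
  note facts = grouped_words_facts[OF hs]
  let ?d = "map sum_list hs"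
  let ?c = "\<lambda>w. (- 1) ^ (inversions w + inversions (concat hs)) :: 'k"
  have "basis_map (mrg l) (lift_tableau hs u :: _ \<Rightarrow>\<^sub>0 'k) = 0" if l: "l < size lam" for l
  proof -
    have wf: "0 \<notin> set w" "sum_list w = n" "length w = Suc (size lam)" if w: "w \<in> arrangements hs" for w
    proof -
      obtain v where "w = v @ [m]" "mset v = lam"
        using arrangements_facts[OF hs w] by blast
      then show "0 \<notin> set w" "sum_list w = n" "length w = Suc (size lam)"
        using word_facts[of v] by simp_all
    qed
    have len: "Suc l < length w" if "w \<in> arrangements hs" for w
      using wf(3)[OF that] l by simp
    have "Suc (size lam) \<le> n"
      using wf[OF concat_arrangements] length_le_sum_list[of "concat hs"] by simp
    then have 2: "(2 :: 'k) \<noteq> 0" using two_neq_0[OF inv] l by simp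
    have eq: "basis_map (mrg l) (lift_tableau hs u :: _ \<Rightarrow>\<^sub>0 'k) = (\<Sum>p\<in>column_perms n ?d u. \<Sum>w\<in>arrangements hs.
        Poly_Mapping.single (cut (p \<circ> u) 0 (merge_at (+) l w)) (of_int (sign p) * ?c w))"
      by (simp add: lift_tableau_def basis_map_simps mrg_cut)
    show ?thesis
    proof (cases "\<exists>i. Suc i < length hs \<and> Suc l = length (concat (take (Suc i) hs))")
      case True
      then obtain i where i: "Suc i < length hs" "Suc l = length (concat (take (Suc i) hs))" by blast
      have "(\<Sum>p\<in>column_perms n ?d u.
        Poly_Mapping.single (cut (p \<circ> u) 0 (merge_at (+) l w)) (of_int (sign p) * ?c w)) = 0"
        if w: "w \<in> arrangements hs" for w
      proof (rule column_cancel[OF 2 facts(7,8) u])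
        show "Suc i < length ?d" using i by simp
        show "sum_list (merge_at (+) l w) = n" using wf(2)[OF w] by (simp add: sum_list_merge_at)
        have "sum_list (take (Suc i) ?d) = sum_list (take (Suc l) w)"
          using sum_take_arrangements[OF w, of "Suc i"] i(2) by (simp add: take_map sum_list_concat)
        then show "sum_list (take j (merge_at (+) l w)) \<noteq> sum_list (take (Suc i) ?d)" for j
          using take_merge_at_boundary[OF wf(1)[OF w] len[OF w]] by simp
      qed
      then show ?thesis
        unfolding eq by (subst sum.swap) (simp add: sum.neutral)
    next
      case False
      have sw: "swp l w \<in> arrangements hs" "w ! l \<noteq> w ! Suc l" if w: "w \<in> arrangements hs" for w
        using arrangements_swp[OF w _ len[OF w]] facts(4) False by blast+
      have "(\<Sum>w\<in>arrangements hs. Poly_Mapping.single (cut (p \<circ> u) 0 (merge_at (+) l w)) (of_int (sign p) * ?c w))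
          = (\<Sum>w\<in>arrangements hs. - Poly_Mapping.single (cut (p \<circ> u) 0 (merge_at (+) l w)) (of_int (sign p) * ?c w))" for p
      proof (rule sum.reindex_bij_witness[of _ "swp l" "swp l"])
        fix w assume w: "w \<in> arrangements hs"
        have "?c (swp l w) = - ?c w"
          using inversions_swp[OF len[OF w] sw(2)[OF w]] by (elim disjE) simp_all
        moreover have "merge_at (+) l (swp l w) = merge_at (+) l w"
          by (rule merge_at_swp) simp
        ultimately show "- Poly_Mapping.single (cut (p \<circ> u) 0 (merge_at (+) l (swp l w))) (of_int (sign p) * ?c (swp l w))
            = Poly_Mapping.single (cut (p \<circ> u) 0 (merge_at (+) l w)) (of_int (sign p) * ?c w)"
          by (simp add: single_uminus)
      qed (use sw in auto)
      then have "(\<Sum>w\<in>arrangements hs. Poly_Mapping.single (cut (p \<circ> u) 0 (merge_at (+) l w)) (of_int (sign p) * ?c w)) = 0" for p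
        unfolding sum_negf by (rule sum_pm_self_neg[OF 2])
      then show ?thesis unfolding eq by simp
    qed
  qed
  then show ?thesis
    using lift_tableau_keys[OF hs u] by (simp add: cyc_def)
qed

lemma merge_groups_lift_tableau:
  assumes hs: "hs \<in> grouped_words" and u: "bij_betw u {..<n} {1..n}"
  shows "merge_groups hs' (lift_tableau hs u) = (if concat hs' \<in> arrangements hs
    then (\<Sum>p\<in>column_perms n (map sum_list hs) u. Poly_Mapping.single (cut (p \<circ> u) 0 (map sum_list hs'))
      (of_int (sign p) * (- 1) ^ (inversions (concat hs') + inversions (concat hs)))) else (0 :: _ \<Rightarrow>\<^sub>0 'k::field))"
proof -
  let ?P = "column_perms n (map sum_list hs) u"
  let ?c = "\<lambda>p w. of_int (sign p) * (- 1) ^ (inversions w + inversions (concat hs)) :: 'k"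
  let ?X = "\<lambda>p. Poly_Mapping.single (cut (p \<circ> u) 0 (map sum_list hs')) (?c p (concat hs'))"
  have "merge_groups hs' (Poly_Mapping.single (cut (p \<circ> u) 0 w) (?c p w))
      = (if w = concat hs' then ?X p else 0)" if p: "p \<in> ?P" and w: "w \<in> arrangements hs" for p w
  proof -
    obtain v where v: "w = v @ [m]" "mset v = lam"
      using arrangements_facts[OF hs w] by blast
    have "bij_betw (p \<circ> u) {..<n} {1..n}"
      using p by (intro perm_comp_bij[OF u]) (simp add: column_perms_def)
    then have "map card (cut (p \<circ> u) 0 w) = w"
      using cut_ospc[of "p \<circ> u" n w] word_facts(1,2)[OF v(2)] v by (simp add: ospc_def)
    then show ?thesis
      by (simp add: merge_groups_def group_cut)
  qed
  then have "merge_groups hs' (lift_tableau hs u)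
      = (\<Sum>p\<in>?P. \<Sum>w\<in>arrangements hs. if w = concat hs' then ?X p else 0)"
    unfolding lift_tableau_def by (simp add: flin_sum[OF flin_merge_groups])
  then show ?thesis by simp
qed

lemma merge_groups_lift_tableau_self:
  assumes hs: "hs \<in> grouped_words" and u: "bij_betw u {..<n} {1..n}"
  shows "merge_groups hs (lift_tableau hs u) = polytab n (map sum_list hs) u"
  using concat_arrangements[of hs] by (simp add: merge_groups_lift_tableau[OF hs u] polytab_def)

text \<open>Among the arrangements \<open>concat hs\<close> has the fewest inversions, so the weight
  bound leaves only a different grouping of the same word with no more runs. It overlooks a cut of
  \<open>hs\<close>, and the column sum vanishes.\<close>

lemma merge_groups_lift_tableau_other:
  assumes inv: "of_nat (fact n) \<noteq> (0 :: 'k::field)"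
    and hs: "hs \<in> grouped_words" and u: "bij_betw u {..<n} {1..n}"
    and hs': "hs' \<in> grouped_words" "hs' \<noteq> hs" "group_weight hs' \<le> group_weight hs"
  shows "merge_groups hs' (lift_tableau hs u) = (0 :: _ \<Rightarrow>\<^sub>0 'k)"
proof (cases "concat hs' \<in> arrangements hs")
  case True
  note facts = grouped_words_facts[OF hs] and facts' = grouped_words_facts[OF hs'(1)]
  have "inversions (concat hs') \<le> inversions (concat hs)"
  proof (rule ccontr)
    assume "\<not> ?thesis"
    then have "Suc (inversions (concat hs)) * (size lam + 2) \<le> inversions (concat hs') * (size lam + 2)"
      by (intro mult_right_mono) auto
    then show False using hs'(3) facts(6) by (simp add: group_weight_def)
  qed
  then have conc: "concat hs' = concat hs"
    using inversions_arrangements[OF True] facts(4) by blast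
  then have "length hs' \<le> length hs"
    using hs'(3) by (simp add: group_weight_def)
  then have "\<not> (\<forall>i. Suc i < length hs \<longrightarrow>
      (\<exists>l. sum_list (take l (map sum_list hs')) = sum_list (take (Suc i) (map sum_list hs))))"
    using prefix_sums_refine[OF conc] facts(3,5) facts'(3) hs'(2) by blast
  then obtain i where i: "Suc i < length hs"
    "\<And>l. sum_list (take l (map sum_list hs')) \<noteq> sum_list (take (Suc i) (map sum_list hs))" by blast
  have "Suc (Suc i) \<le> length (map sum_list hs)" using i(1) by simp
  also have "\<dots> \<le> n" using length_le_sum_list[OF facts(7)] facts(8) by simp
  finally have 2: "(2 :: 'k) \<noteq> 0" using two_neq_0[OF inv] by simp
  show ?thesis
    using column_cancel[OF 2 facts(7,8) u _ facts'(8) i(2)] i(1) True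
    by (simp add: merge_groups_lift_tableau[OF hs u])
qed (simp add: merge_groups_lift_tableau[OF hs u])

lemma mset_subseteq_concat: "g \<in> set gs \<Longrightarrow> mset g \<subseteq># mset (concat gs)"
  by (induction gs) (auto intro: subset_mset.trans)

text \<open>By the knapsack property the sum of a group determines its multiset of parts, and the
  strict order determines the group. Conversely the parts united into an entry of a composition in V
  must be the distinct values that sum to it, and sorting them gives the run.\<close>

lemma V_comps_eq:
  assumes knapsack: "inj_on sum_mset {A. A \<subseteq># lam}"
  shows "bij_betw (map sum_list) grouped_words (V_comps lam m n)"
  unfolding bij_betw_def
proof
  show "inj_on (map sum_list) grouped_words"
  proof (rule inj_onI)
    fix hs hs' assume hs: "hs \<in> grouped_words" "hs' \<in> grouped_words" and eq: "map sum_list hs = map sum_list hs'"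
    obtain gs where gs: "hs = gs @ [[m]]" "\<forall>g\<in>set gs. sorted_wrt (<) g" "mset (concat gs) = lam"
      using hs(1) by (auto simp: grouped_words_def)
    obtain gs' where gs': "hs' = gs' @ [[m]]" "\<forall>g\<in>set gs'. sorted_wrt (<) g" "mset (concat gs') = lam"
      using hs(2) by (auto simp: grouped_words_def)
    have eq': "map sum_list gs = map sum_list gs'" using eq gs(1) gs'(1) by simp
    have "gs = gs'"
    proof (rule nth_equalityI)
      show len: "length gs = length gs'" using eq' by (rule map_eq_imp_length_eq)
      fix i assume i: "i < length gs"
      then have sub: "mset (gs ! i) \<subseteq># lam" "mset (gs' ! i) \<subseteq># lam"
        using mset_subseteq_concat[of "gs ! i" gs] mset_subseteq_concat[of "gs' ! i" gs'] len gs(3) gs'(3) by auto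
      have "sum_list (gs ! i) = sum_list (gs' ! i)" using eq' i len by (metis nth_map)
      then have "mset (gs ! i) = mset (gs' ! i)"
        using inj_onD[OF knapsack, of "mset (gs ! i)" "mset (gs' ! i)"] sub by (simp add: sum_mset_sum_list)
      moreover have "sorted (gs ! i)" "sorted (gs' ! i)"
        using gs(2) gs'(2) i len by (auto simp: strict_sorted_iff)
      ultimately show "gs ! i = gs' ! i" by (metis properties_for_sort)
    qed
    then show "hs = hs'" using gs(1) gs'(1) by simp
  qed
  show "map sum_list ` grouped_words = V_comps lam m n"
  proof (intro equalityI subsetI)
    fix d assume "d \<in> map sum_list ` grouped_words"
    then obtain hs where hs: "hs \<in> grouped_words" and d: "d = map sum_list hs" by blast
    obtain gs where gs: "hs = gs @ [[m]]" "\<forall>g\<in>set gs. g \<noteq> [] \<and> sorted_wrt (<) g" "mset (concat gs) = lam"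
      using hs by (auto simp: grouped_words_def)
    note facts = grouped_words_facts[OF hs]
    have d': "butlast d = map sum_list gs" "last d = m" "d \<noteq> []" using d gs(1) by auto
    have "0 \<notin> set (butlast d)" using facts(7) d by (auto dest: in_set_butlastD)
    then have "d \<in> pcompositions n" using facts(8) d d'(3) by (simp add: pcompositions_def)
    moreover have "concat hs \<in> pcompositions n" "pcomp_type (concat hs) = (lam, m)"
      using word_facts[OF gs(3)] gs(1,3) by (auto simp: pcompositions_def pcomp_type_def)
    moreover have "pcomp_le (concat hs) d"
      using facts(3) d unfolding pcomp_le_def by blast
    ultimately have "d \<in> pcomp_filter lam m n" by (auto simp: pcomp_filter_def)
    moreover have "\<exists>S\<subseteq>set_mset lam. x = \<Sum>S" if x: "x \<in> set (butlast d)" for x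
    proof -
      obtain g where g: "g \<in> set gs" "x = sum_list g" using x d'(1) by auto
      have "distinct g" using gs(2) g(1) by (simp add: strict_sorted_iff)
      then have "x = \<Sum>(set g)" using g(2) sum_list_distinct_conv_sum_set[of g "\<lambda>x. x"] by simp
      moreover have "set g \<subseteq> set_mset lam" using g(1) gs(3) by auto
      ultimately show ?thesis by blast
    qed
    ultimately show "d \<in> V_comps lam m n" using d'(2) by (simp add: V_comps_def)
  next
    fix d assume d: "d \<in> V_comps lam m n"
    then have last_d: "last d = m" and dS: "\<And>x. x \<in> set (butlast d) \<Longrightarrow> \<exists>S\<subseteq>set_mset lam. x = \<Sum>S"
      and "d \<in> pcomp_filter lam m n" by (auto simp: V_comps_def)
    then obtain c where c: "c \<in> pcompositions n" "pcomp_type c = (lam, m)" "pcomp_le c d" and "d \<noteq> []"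
      by (auto simp: pcomp_filter_def pcompositions_def)
    then obtain runs where runs: "[] \<notin> set runs" "concat runs = c" "map sum_list runs = d"
      by (auto simp: pcomp_le_def)
    have c': "c = butlast c @ [m]" "mset (butlast c) = lam"
      using c(1,2) by (auto simp: pcompositions_def pcomp_type_def)
    obtain R r where Rr: "runs = R @ [r]"
      using runs(3) \<open>d \<noteq> []\<close> by (cases runs rule: rev_exhaust) auto
    have r_ne: "r \<noteq> []" using runs(1) Rr by auto
    then obtain r' where r': "r = r' @ [m]"
      using c'(1) runs(2) Rr by (metis append_butlast_last_id concat.simps concat_append last_appendR append_Nil2 last_snoc)
    have sum_r: "sum_list r = m" using last_d runs(3) Rr by auto
    have cR: "concat R @ r' = butlast c"
      using runs(2) Rr r' by (metis append.right_neutral append_assoc butlast_snoc concat.simps concat_append)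
    \<comment> \<open>The last run ends with m and has sum m, and all parts are positive.\<close>
    have "r' = []"
    proof (cases r')
      case (Cons a as)
      then have "a \<in># lam" using cR c'(2) by (metis in_set_conv_decomp set_mset_mset)
      moreover have "a = 0" using sum_r r' Cons by simp
      ultimately show ?thesis using parts_pos by simp
    qed simp
    then have r: "r = [m]" and lamR: "mset (concat R) = lam" using r' cR c'(2) by auto
    have dR: "butlast d = map sum_list R" using runs(3) Rr by auto
    have dist: "distinct g" if g: "g \<in> set R" for g
    proof -
      obtain S where S: "S \<subseteq> set_mset lam" "sum_list g = \<Sum>S"
        using dS[of "sum_list g"] dR g by auto
      have "finite S" using S(1) finite_subset by blast
      then have "mset_set S \<subseteq># lam"
        using S(1) by (intro mset_subset_eqI) (auto simp: count_mset_set' Suc_le_eq)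
      moreover have "sum_mset (mset g) = sum_mset (mset_set S)"
        using S(2) by (simp add: sum_mset_sum_list sum_unfold_sum_mset)
      \<comment> \<open>Both are submultisets of \<open>lam\<close> with the same sum, and a set has
        no repetitions.\<close>
      ultimately have "mset g = mset_set S"
        using inj_onD[OF knapsack] mset_subseteq_concat[OF g] lamR by blast
      then show ?thesis
        by (metis \<open>finite S\<close> mset_eq_imp_distinct_iff mset_sorted_list_of_multiset sorted_list_of_mset_set distinct_sorted_list_of_set)
    qed
    have "map sort R @ [[m]] \<in> grouped_words"
    proof -
      have "mset (concat (map sort R)) = mset (concat R)" by (induction R) auto
      moreover have "sort g \<noteq> []" if "g \<in> set R" for g
        using that runs(1) Rr by (metis UnI1 mset_sort mset_zero_iff set_append)
      ultimately show ?thesis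
        unfolding grouped_words_def using dist lamR runs(1) Rr
        by (intro CollectI exI[of _ "map sort R"]) (auto simp: strict_sorted_iff)
    qed
    moreover have "map sum_list (map sort R @ [[m]]) = d"
    proof -
      have "sum_list (sort g) = sum_list g" for g :: "nat list" by (metis mset_sort sum_mset_sum_list)
      then show ?thesis using runs(3) Rr r by auto
    qed
    ultimately show "d \<in> map sum_list ` grouped_words" by (metis image_eqI)
  qed
qed

lemma finite_V_comps: "finite (V_comps lam m n)"
proof (rule finite_subset)
  show "V_comps lam m n \<subseteq> {d. set d \<subseteq> {..n} \<and> length d \<le> Suc n}"
  proof
    fix d assume "d \<in> V_comps lam m n"
    then have d: "0 \<notin> set (butlast d)" "sum_list d = n"
      by (auto simp: V_comps_def pcomp_filter_def pcompositions_def)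
    have "set d \<subseteq> {..n}" using d(2) member_le_sum_list by fastforce
    moreover have "sum_list (butlast d) \<le> sum_list d"
      using sum_list_take_mono[of "length d - 1" "length d" d] by (simp add: butlast_conv_take)
    then have "length d \<le> Suc n" using length_le_sum_list[OF d(1)] d(2) by simp
    ultimately show "d \<in> {d. set d \<subseteq> {..n} \<and> length d \<le> Suc n}" by simp
  qed
  show "finite {d. set d \<subseteq> {..n} \<and> length d \<le> Suc n}"
    by (rule finite_lists_length_le) simp
qed

lemma V_comps_facts:
  assumes "inj_on sum_mset {A. A \<subseteq># lam}" "d \<in> V_comps lam m n"
  shows "0 \<notin> set d" "sum_list d = n"
proof -
  obtain hs where "hs \<in> grouped_words" "d = map sum_list hs"
    using V_comps_eq[OF assms(1)] assms(2) unfolding bij_betw_def by blast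
  then show "0 \<notin> set d" "sum_list d = n"
    using grouped_words_facts(7,8)[of hs] by simp_all
qed

theorem cycles_direct_sum:
  assumes knapsack: "inj_on sum_mset {A. A \<subseteq># lam}" and inv: "of_nat (fact n) \<noteq> (0 :: 'k::field)"
  shows "sym_module_iso n
    (direct_sum (V_comps lam m n) (\<lambda>d. fmodule (cyc (length d) (ospc n d)) perm_act))
    (fmodule (cyc (Suc (size lam)) osp_type) perm_act :: ('k, nat set list \<Rightarrow>\<^sub>0 'k) sym_module)"
proof -
  interpret perm_rep n "perm_act :: _ \<Rightarrow> (nat set list \<Rightarrow>\<^sub>0 'k) \<Rightarrow> _"
    by (rule perm_rep_perm_act[OF inv])
  note bij = V_comps_eq[OF knapsack]
  define H where "H = the_inv_into grouped_words (map sum_list :: nat list list \<Rightarrow> nat list)"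
  have H: "H d \<in> grouped_words" "map sum_list (H d) = d" if "d \<in> V_comps lam m n" for d
    using bij that unfolding H_def by (auto simp: bij_betw_def the_inv_into_into f_the_inv_into_f)
  have H_inv: "\<exists>d\<in>V_comps lam m n. H d = hs" if "hs \<in> grouped_words" for hs
    using bij that unfolding H_def bij_betw_def
    by (intro bexI[of _ "map sum_list hs"]) (auto simp: the_inv_into_f_f)
  let ?X = "cyc (Suc (size lam)) osp_type :: (nat set list \<Rightarrow>\<^sub>0 'k) set"
  show ?thesis
  proof (rule filtration_direct_sum[where \<Phi> = "\<lambda>d. merge_groups (H d)" and \<kappa> = "\<lambda>d. group_weight (H d)"])
    show "finite (V_comps lam m n)" by (rule finite_V_comps)
    show X: "stable n perm_act ?X" by (rule stable_cyc[OF osp_type_map])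
    fix d assume d: "d \<in> V_comps lam m n"
    let ?S = "cyc (length d) (ospc n d) :: (nat set list \<Rightarrow>\<^sub>0 'k) set"
    show "stable n perm_act ?S" by (rule stable_cyc[OF ospc_map])
    show "flin (merge_groups (H d) :: (nat set list \<Rightarrow>\<^sub>0 'k) \<Rightarrow> _)" by simp
    show "merge_groups (H d) (perm_act p v) = perm_act p (merge_groups (H d) v)"
      if "p permutes {1..n}" for p and v :: "nat set list \<Rightarrow>\<^sub>0 'k"
      by (rule merge_groups_perm_act[OF that])
    show "merge_groups (H d) x \<in> ?S"
      if x: "x \<in> ?X" and 0: "\<And>j. j \<in> V_comps lam m n \<Longrightarrow> group_weight (H j) < group_weight (H d) \<Longrightarrow>
        merge_groups (H j) x = 0" for x
    proof -
      have "merge_groups (H d) x \<in> cyc (length (H d)) (ospc n (map sum_list (H d)))"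
        by (rule merge_groups_into[OF x H(1)[OF d]]) (use 0 H_inv in blast)
      moreover have "length (H d) = length d" using H(2)[OF d] by (metis length_map)
      ultimately show ?thesis using H(2)[OF d] by simp
    qed
    show "\<exists>x\<in>?X. merge_groups (H d) x = y \<and> (\<forall>j\<in>V_comps lam m n. j \<noteq> d \<longrightarrow>
        group_weight (H j) \<le> group_weight (H d) \<longrightarrow> merge_groups (H j) x = 0)" if y: "y \<in> ?S" for y
    proof -
      \<comment> \<open>The admissible lifts form a subspace, so it is enough to lift the
        polytabloids, which span the target.\<close>
      define L where "L = {x \<in> ?X. \<forall>j\<in>V_comps lam m n. j \<noteq> d \<longrightarrow>
        group_weight (H j) \<le> group_weight (H d) \<longrightarrow> merge_groups (H j) x = 0}"
      have L: "free_vs.subspace L"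
        using X unfolding L_def stable_def free_vs.subspace_def
        by (auto simp: flin_0 flin_add flin_scale)
      have "polytab n d u \<in> merge_groups (H d) ` L" if u: "bij_betw u {..<n} {1..n}" for u
      proof -
        have "lift_tableau (H d) u \<in> L"
          unfolding L_def
        proof (intro CollectI conjI ballI impI)
          fix j assume j: "j \<in> V_comps lam m n" "j \<noteq> d" "group_weight (H j) \<le> group_weight (H d)"
          have "H j \<noteq> H d" using H(2)[OF d] H(2)[OF j(1)] j(2) by metis
          then show "merge_groups (H j) (lift_tableau (H d) u) = (0 :: _ \<Rightarrow>\<^sub>0 'k)"
            by (rule merge_groups_lift_tableau_other[OF inv H(1)[OF d] u H(1)[OF j(1)] _ j(3)])
        qed (rule lift_tableau_cyc[OF inv H(1)[OF d] u])
        moreover have "merge_groups (H d) (lift_tableau (H d) u) = (polytab n d u :: _ \<Rightarrow>\<^sub>0 'k)"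
          using merge_groups_lift_tableau_self[OF H(1)[OF d] u] H(2)[OF d] by simp
        ultimately show ?thesis by (metis imageI)
      qed
      moreover have "free_vs.subspace (merge_groups (H d) ` L)"
        using L unfolding free_vs.subspace_def
        by (auto simp: image_iff) (metis flin_0 flin_merge_groups, metis flin_add flin_merge_groups,
            metis flin_scale flin_merge_groups)
      ultimately have "free_vs.span (polytab n d ` {u. bij_betw u {..<n} {1..n}}) \<subseteq> merge_groups (H d) ` L"
        by (intro free_vs.span_minimal) auto
      then have "y \<in> merge_groups (H d) ` L"
        using cyc_subset_span[OF inv V_comps_facts[OF knapsack d]] y by blast
      then show ?thesis by (auto simp: L_def)
    qed
  next
    fix x assume x: "x \<in> ?X" and 0: "\<And>d. d \<in> V_comps lam m n \<Longrightarrow> merge_groups (H d) x = 0"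
    have keys: "Poly_Mapping.keys x \<subseteq> osp_type" using x by (simp add: cyc_def)
    have "Poly_Mapping.lookup x C = 0" if C: "C \<in> osp_type" for C
    proof -
      obtain v where v: "map card C = v @ [m]" "mset v = lam" using C by (auto simp: osp_type_def)
      obtain d where "d \<in> V_comps lam m n" "H d = map (\<lambda>a. [a]) (v @ [m])"
        using H_inv[OF singletons_grouped[OF v(2)]] by blast
      with 0 show ?thesis using lookup_merge_singletons[OF keys v(1)] by metis
    qed
    then show "x = 0"
      using keys by (intro poly_mapping_eqI) (auto simp: in_keys_iff)
  qed
qed

end

section \<open>Covers of pointed set partitions\<close>

definition absorb_block :: "nat set \<Rightarrow> pset_partition \<Rightarrow> pset_partition"
  where "absorb_block A = (\<lambda>(Bs, Z). (Bs - {A}, A \<union> Z))"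

definition join_blocks :: "nat set \<Rightarrow> nat set \<Rightarrow> pset_partition \<Rightarrow> pset_partition"
  where "join_blocks A B = (\<lambda>(Bs, Z). (insert (A \<union> B) (Bs - {A, B}), Z))"

lemma pset_partitions_iff:
  "(Bs, Z) \<in> pset_partitions n \<longleftrightarrow> Z \<subseteq> {1..n} \<and> \<Union> Bs = {1..n} - Z \<and> {} \<notin> Bs \<and>
    (\<forall>A\<in>Bs. \<forall>B\<in>Bs. A \<noteq> B \<longrightarrow> A \<inter> B = {})"
  by (auto simp: pset_partitions_def partition_on_def disjoint_def)

lemma block_unique:
  "(Bs, Z) \<in> pset_partitions n \<Longrightarrow> A \<in> Bs \<Longrightarrow> B \<in> Bs \<Longrightarrow> v \<in> A \<Longrightarrow> v \<in> B \<Longrightarrow> A = B"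
  unfolding pset_partitions_iff by blast

lemma block_not_pointed:
  "(Bs, Z) \<in> pset_partitions n \<Longrightarrow> A \<in> Bs \<Longrightarrow> v \<in> A \<Longrightarrow> v \<in> {1..n} \<and> v \<notin> Z"
  unfolding pset_partitions_iff by blast

lemma pset_partitions_subset: "pset_partitions n \<subseteq> Pow (Pow {1..n}) \<times> Pow {1..n}"
proof
  fix x assume x: "x \<in> pset_partitions n"
  obtain Bs Z where "x = (Bs, Z)" by force
  with x show "x \<in> Pow (Pow {1..n}) \<times> Pow {1..n}"
    using block_not_pointed[of Bs Z n] by (auto simp: pset_partitions_iff[of Bs Z])
qed

lemma pset_partitions_finite: "(Bs, Z) \<in> pset_partitions n \<Longrightarrow> finite Bs"
  by (rule finite_subset[of _ "Pow {1..n}"]) (use pset_partitions_subset in blast, simp)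

lemma finite_pset_partitions [simp]: "finite (pset_partitions n)"
  by (rule finite_subset[OF pset_partitions_subset]) simp

lemma pset_le_refl [simp]: "pset_le x x"
  by (auto simp: pset_le_def)

lemma pset_le_trans: "pset_le x y \<Longrightarrow> pset_le y z \<Longrightarrow> pset_le x z"
proof -
  assume xy: "pset_le x y" and yz: "pset_le y z"
  obtain Bs1 Z1 Bs2 Z2 Bs3 Z3 where eq: "x = (Bs1, Z1)" "y = (Bs2, Z2)" "z = (Bs3, Z3)"
    by (metis surj_pair)
  have 2: "\<exists>B'\<in>insert Z3 Bs3. B \<subseteq> B'" if "B \<in> insert Z2 Bs2" for B
    using yz that by (auto simp: pset_le_def eq)
  have "\<exists>B'\<in>insert Z3 Bs3. B \<subseteq> B'" if B: "B \<in> Bs1" for B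
  proof -
    obtain B' where B': "B' \<in> insert Z2 Bs2" "B \<subseteq> B'"
      using xy B unfolding pset_le_def eq prod.case by blast
    with 2[OF B'(1)] show ?thesis by (meson subset_trans)
  qed
  moreover have "Z1 \<subseteq> Z3" using xy yz by (auto simp: pset_le_def eq)
  ultimately show ?thesis by (simp add: pset_le_def eq)
qed

lemma absorb_block_partition:
  assumes "(Bs, Z) \<in> pset_partitions n" "A \<in> Bs"
  shows "absorb_block A (Bs, Z) \<in> pset_partitions n"
proof -
  have "\<Union> (Bs - {A}) = \<Union> Bs - A"
    using block_unique[OF assms(1) _ assms(2)] by blast
  then show ?thesis
    using assms block_not_pointed[OF assms] by (auto simp: pset_partitions_iff absorb_block_def)
qed

lemma join_blocks_partition:
  assumes "(Bs, Z) \<in> pset_partitions n" "A \<in> Bs" "B \<in> Bs"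
  shows "join_blocks A B (Bs, Z) \<in> pset_partitions n"
proof -
  have un: "\<Union> (insert (A \<union> B) (Bs - {A, B})) = \<Union> Bs" using assms(2,3) by auto
  have disj: "C \<inter> (A \<union> B) = {}" if "C \<in> Bs - {A, B}" for C
    using block_unique[OF assms(1), of C A] block_unique[OF assms(1), of C B] assms(2,3) that by blast
  have ne: "A \<union> B \<noteq> {}" using assms by (auto simp: pset_partitions_iff)
  show ?thesis
    unfolding pset_partitions_iff join_blocks_def prod.case
  proof (intro conjI ballI impI)
    show "Z \<subseteq> {1..n}" using assms(1) by (simp add: pset_partitions_iff)
    show "\<Union> (insert (A \<union> B) (Bs - {A, B})) = {1..n} - Z"
      using un assms(1) by (simp add: pset_partitions_iff)
    show "{} \<notin> insert (A \<union> B) (Bs - {A, B})"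
      using ne assms(1) by (simp add: pset_partitions_iff)
    fix X Y assume "X \<in> insert (A \<union> B) (Bs - {A, B})" "Y \<in> insert (A \<union> B) (Bs - {A, B})" "X \<noteq> Y"
    then show "X \<inter> Y = {}"
      using disj[of X] disj[of Y] block_unique[OF assms(1), of X Y] by blast
  qed
qed

lemma card_absorb_block:
  assumes "(Bs, Z) \<in> pset_partitions n" "A \<in> Bs"
  shows "Suc (card (fst (absorb_block A (Bs, Z)))) = card Bs"
  using assms(2) pset_partitions_finite[OF assms(1)]
  by (simp only: absorb_block_def prod.case fst_conv card_Suc_Diff1)

lemma union_not_block:
  assumes P: "(Bs, Z) \<in> pset_partitions n" and mem: "A \<in> Bs" "B \<in> Bs" "A \<noteq> B"
  shows "A \<union> B \<notin> Bs" "A \<noteq> {}" "B \<noteq> {}"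
proof -
  show "A \<noteq> {}" "B \<noteq> {}" using P mem unfolding pset_partitions_iff by blast+
  then obtain a b where ab: "a \<in> A" "b \<in> B" by blast
  show "A \<union> B \<notin> Bs"
  proof
    assume AB: "A \<union> B \<in> Bs"
    have "A \<union> B = A" "A \<union> B = B"
      using block_unique[OF P AB mem(1), of a] block_unique[OF P AB mem(2), of b] ab by blast+
    then show False using mem(3) by simp
  qed
qed

lemma card_join_blocks:
  assumes "(Bs, Z) \<in> pset_partitions n" "A \<in> Bs" "B \<in> Bs" "A \<noteq> B"
  shows "Suc (card (fst (join_blocks A B (Bs, Z)))) = card Bs"
proof -
  have fin: "finite Bs" by (rule pset_partitions_finite[OF assms(1)])
  have "A \<union> B \<notin> Bs" by (rule union_not_block(1)[OF assms])
  moreover have "card Bs = Suc (Suc (card (Bs - {A, B})))"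
    using card_Suc_Diff1[OF fin assms(2)] card_Suc_Diff1[of "Bs - {A}" B] fin assms(3,4)
    by (simp add: Diff_insert2[symmetric] insert_commute del: card_Diff_insert card_Diff_singleton)
  ultimately show ?thesis
    using fin by (simp add: join_blocks_def)
qed

text \<open>Suppose that no move stays below the upper partition. Then no block of the lower one
  lies in the upper pointed block, and no two lie in a common block; counting elements blockwise,
  the two partitions coincide.\<close>

lemma pset_le_step:
  assumes x: "(Bs, Z) \<in> pset_partitions n" and y: "(Bs', Z') \<in> pset_partitions n"
    and le: "pset_le (Bs, Z) (Bs', Z')" and ne: "(Bs, Z) \<noteq> (Bs', Z')"
  shows "(\<exists>A\<in>Bs. pset_le (absorb_block A (Bs, Z)) (Bs', Z')) \<or>
    (\<exists>A\<in>Bs. \<exists>B\<in>Bs. A \<noteq> B \<and> pset_le (join_blocks A B (Bs, Z)) (Bs', Z'))"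
proof (rule ccontr)
  assume "\<not> ?thesis"
  then have na: "\<And>A. A \<in> Bs \<Longrightarrow> \<not> pset_le (absorb_block A (Bs, Z)) (Bs', Z')"
    and nj: "\<And>A B. A \<in> Bs \<Longrightarrow> B \<in> Bs \<Longrightarrow> A \<noteq> B \<Longrightarrow> \<not> pset_le (join_blocks A B (Bs, Z)) (Bs', Z')"
    by blast+
  have ZZ: "Z \<subseteq> Z'" using le by (simp add: pset_le_def)
  have up: "\<exists>B'\<in>Bs'. A \<subseteq> B'" if A: "A \<in> Bs" for A
  proof (rule ccontr)
    assume "\<not> ?thesis"
    then have "A \<subseteq> Z'" using le A by (auto simp: pset_le_def)
    then have "pset_le (absorb_block A (Bs, Z)) (Bs', Z')"
      using le ZZ by (auto simp: pset_le_def absorb_block_def)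
    with na[OF A] show False by simp
  qed
  have one: "A = B" if "A \<in> Bs" "B \<in> Bs" "A \<subseteq> B'" "B \<subseteq> B'" "B' \<in> Bs'" for A B B'
  proof (rule ccontr)
    assume "A \<noteq> B"
    moreover have "pset_le (join_blocks A B (Bs, Z)) (Bs', Z')"
      using le that by (auto simp: pset_le_def join_blocks_def)
    ultimately show False using nj that(1,2) by blast
  qed
  have Z: "Z = Z'"
  proof (rule antisym[OF ZZ], rule subsetI, rule ccontr)
    fix v assume v: "v \<in> Z'" "v \<notin> Z"
    then have "v \<in> \<Union> Bs" using x y by (auto simp: pset_partitions_iff)
    then obtain A B' where "v \<in> A" "B' \<in> Bs'" "A \<subseteq> B'" using up by blast
    then show False using y v(1) by (auto simp: pset_partitions_iff)
  qed
  have sub: "Bs \<subseteq> Bs'"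
  proof
    fix A assume A: "A \<in> Bs"
    obtain B' where B': "B' \<in> Bs'" "A \<subseteq> B'" using up[OF A] by blast
    have "B' \<subseteq> A"
    proof
      fix v assume v: "v \<in> B'"
      then have "v \<in> \<Union> Bs" using B'(1) x y Z by (auto simp: pset_partitions_iff)
      then obtain A2 where A2: "A2 \<in> Bs" "v \<in> A2" by blast
      obtain B2 where B2: "B2 \<in> Bs'" "A2 \<subseteq> B2" using up[OF A2(1)] by blast
      then have "B2 = B'" using block_unique[OF y _ B'(1) _ v] A2(2) by blast
      then have "A2 = A" using one A A2(1) B' B2 by blast
      with A2(2) show "v \<in> A" by simp
    qed
    then have "A = B'" using B'(2) by auto
    with B'(1) show "A \<in> Bs'" by simp
  qed
  have "Bs' \<subseteq> Bs"
  proof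
    fix B' assume B': "B' \<in> Bs'"
    then have "B' \<noteq> {}" using y unfolding pset_partitions_iff by blast
    then obtain v where v: "v \<in> B'" by blast
    then have "v \<in> \<Union> Bs" using B' x y Z by (auto simp: pset_partitions_iff)
    then obtain A where A: "A \<in> Bs" "v \<in> A" by blast
    then have "A = B'" using block_unique[OF y _ B' _ v] sub by blast
    with A(1) show "B' \<in> Bs" by simp
  qed
  with sub Z ne show False by simp
qed

text \<open>Each move costs exactly one block, so the number of blocks is a rank function.\<close>

lemma pset_le_card:
  "x \<in> pset_partitions n \<Longrightarrow> y \<in> pset_partitions n \<Longrightarrow> pset_le x y \<Longrightarrow>
    card (fst y) \<le> card (fst x) \<and> (card (fst y) = card (fst x) \<longrightarrow> x = y)"
proof (induction "card (fst x)" arbitrary: x rule: less_induct)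
  case less
  obtain Bs Z where x: "x = (Bs, Z)" by force
  obtain Bs' Z' where y: "y = (Bs', Z')" by force
  show ?case
  proof (cases "x = y")
    case False
    then have "\<exists>x'. x' \<in> pset_partitions n \<and> pset_le x' y \<and> Suc (card (fst x')) = card (fst x)"
    proof -
      note xP = less.prems(1)[unfolded x] and yP = less.prems(2)[unfolded y]
      from pset_le_step[OF xP yP less.prems(3)[unfolded x y] False[unfolded x y]]
      consider A where "A \<in> Bs" "pset_le (absorb_block A (Bs, Z)) y"
        | A B where "A \<in> Bs" "B \<in> Bs" "A \<noteq> B" "pset_le (join_blocks A B (Bs, Z)) y"
        unfolding y by blast
      then show ?thesis
      proof cases
        case 1
        then show ?thesis
          using absorb_block_partition[OF xP] card_absorb_block[OF xP] x
          by (intro exI[of _ "absorb_block A (Bs, Z)"]) simp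
      next
        case 2
        then show ?thesis
          using join_blocks_partition[OF xP] card_join_blocks[OF xP] x
          by (intro exI[of _ "join_blocks A B (Bs, Z)"]) simp
      qed
    qed
    then obtain x' where x': "x' \<in> pset_partitions n" "pset_le x' y" "Suc (card (fst x')) = card (fst x)" by blast
    then have "card (fst x') < card (fst x)" by simp
    then have "card (fst y) \<le> card (fst x')"
      using less.hyps x'(1,2) less.prems(2) by blast
    then show ?thesis using x'(3) by simp
  qed simp
qed

text \<open>One move already uses up the difference in the number of blocks, so it must arrive at
  y.\<close>

lemma pset_le_cover:
  assumes x: "(Bs, Z) \<in> pset_partitions n" and y: "y \<in> pset_partitions n"
    and le: "pset_le (Bs, Z) y" and card: "Suc (card (fst y)) = card Bs"
  shows "(\<exists>A\<in>Bs. y = absorb_block A (Bs, Z)) \<or> (\<exists>A\<in>Bs. \<exists>B\<in>Bs. A \<noteq> B \<and> y = join_blocks A B (Bs, Z))"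
proof -
  have "(Bs, Z) \<noteq> y" using card by auto
  then consider A where "A \<in> Bs" "pset_le (absorb_block A (Bs, Z)) y"
    | A B where "A \<in> Bs" "B \<in> Bs" "A \<noteq> B" "pset_le (join_blocks A B (Bs, Z)) y"
    using pset_le_step[OF x _ _ , of "fst y" "snd y"] y le by auto
  then show ?thesis
  proof cases
    case 1
    then have "absorb_block A (Bs, Z) = y"
      using pset_le_card[OF absorb_block_partition[OF x 1(1)] y 1(2)] card_absorb_block[OF x 1(1)] card
      by simp
    with 1 show ?thesis by blast
  next
    case 2
    then have "join_blocks A B (Bs, Z) = y"
      using pset_le_card[OF join_blocks_partition[OF x 2(1,2)] y 2(4)] card_join_blocks[OF x 2(1-3)] card
      by simp
    with 2 show ?thesis by blast
  qed
qed

section \<open>From ordered to unordered partitions\<close>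

definition forget_order :: "nat set list \<Rightarrow> pset_partition"
  where "forget_order C = (set (butlast C), last C)"

lemma forget_order_snoc [simp]: "forget_order (xs @ [Z]) = (set xs, Z)"
  by (simp add: forget_order_def)

lemma sorted_wrt_disjnt_iff:
  "{} \<notin> set C \<Longrightarrow> sorted_wrt disjnt C \<longleftrightarrow>
    distinct C \<and> (\<forall>A\<in>set C. \<forall>B\<in>set C. A \<noteq> B \<longrightarrow> A \<inter> B = {})"
proof (induction C)
  case (Cons A C)
  have "sorted_wrt disjnt (A # C) \<longleftrightarrow> (\<forall>B\<in>set C. A \<inter> B = {}) \<and> sorted_wrt disjnt C"
    by (simp add: disjnt_def)
  also have "\<dots> \<longleftrightarrow> (\<forall>B\<in>set C. A \<inter> B = {}) \<and> distinct C \<and> (\<forall>X\<in>set C. \<forall>Y\<in>set C. X \<noteq> Y \<longrightarrow> X \<inter> Y = {})"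
    using Cons by simp
  also have "\<dots> \<longleftrightarrow> distinct (A # C) \<and> (\<forall>X\<in>set (A # C). \<forall>Y\<in>set (A # C). X \<noteq> Y \<longrightarrow> X \<inter> Y = {})"
    (is "?L \<longleftrightarrow> ?R")
  proof
    assume ?L
    then have "A \<notin> set C" using Cons.prems by auto
    with \<open>?L\<close> show ?R by (auto simp: Int_commute)
  next
    assume R: ?R
    then have "A \<noteq> B" if "B \<in> set C" for B using that by auto
    with R show ?L by simp
  qed
  finally show ?case .
qed simp

lemma osp_snoc: "C @ [Z] \<in> osp n \<longleftrightarrow> (set C, Z) \<in> pset_partitions n \<and> distinct C \<and> Z \<noteq> {}"
proof -
  have eq: "\<Union> (set C) \<inter> Z = {} \<and> \<Union> (set C) \<union> Z = {1..n} \<longleftrightarrow> Z \<subseteq> {1..n} \<and> \<Union> (set C) = {1..n} - Z"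
    by blast
  have "C @ [Z] \<in> osp n \<longleftrightarrow> {} \<notin> set C \<and> Z \<noteq> {} \<and> sorted_wrt disjnt C \<and>
      (\<Union> (set C) \<inter> Z = {} \<and> \<Union> (set C) \<union> Z = {1..n})"
  proof -
    have "\<Union> (set (C @ [Z])) = \<Union> (set C) \<union> Z" "{} \<notin> set (C @ [Z]) \<longleftrightarrow> {} \<notin> set C \<and> Z \<noteq> {}" by auto
    moreover have "sorted_wrt disjnt (C @ [Z]) \<longleftrightarrow> sorted_wrt disjnt C \<and> \<Union> (set C) \<inter> Z = {}"
      by (simp add: sorted_wrt_disjnt_append disjnt_def)
    ultimately show ?thesis by (simp only: osp_def mem_Collect_eq conj_assoc)
  qed
  also have "\<dots> \<longleftrightarrow> (set C, Z) \<in> pset_partitions n \<and> distinct C \<and> Z \<noteq> {}"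
  proof -
    define U where "U \<longleftrightarrow> Z \<subseteq> {1..n} \<and> \<Union> (set C) = {1..n} - Z"
    define D where "D \<longleftrightarrow> (\<forall>A\<in>set C. \<forall>B\<in>set C. A \<noteq> B \<longrightarrow> A \<inter> B = {})"
    have "(set C, Z) \<in> pset_partitions n \<longleftrightarrow> U \<and> {} \<notin> set C \<and> D"
      unfolding pset_partitions_iff U_def D_def conj_assoc ..
    moreover have "{} \<notin> set C \<Longrightarrow> sorted_wrt disjnt C \<longleftrightarrow> distinct C \<and> D"
      unfolding D_def by (rule sorted_wrt_disjnt_iff)
    ultimately show ?thesis unfolding eq U_def[symmetric] by blast
  qed
  finally show ?thesis .
qed

lemma forget_order_partition:
  assumes "C \<in> osp n" "C \<noteq> []"
  shows "forget_order C \<in> pset_partitions n" "snd (forget_order C) \<noteq> {}"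
    "Suc (card (fst (forget_order C))) = length C"
proof -
  obtain D Z where C: "C = D @ [Z]" using assms(2) by (cases C rule: rev_exhaust) auto
  show "forget_order C \<in> pset_partitions n" "snd (forget_order C) \<noteq> {}"
    "Suc (card (fst (forget_order C))) = length C"
    using assms(1) by (auto simp: C osp_snoc distinct_card)
qed

lemma forget_order_act:
  "C \<noteq> [] \<Longrightarrow> forget_order (map ((`) p) C) = pset_act p (forget_order C)"
  by (simp add: forget_order_def pset_act_def map_butlast[symmetric] last_map)

lemma forget_order_mrg_le: "pset_le (forget_order C) (forget_order (mrg i C))"
proof (cases "Suc i < length C")
  case True
  then obtain pre A B post where C: "C = pre @ A # B # post" "length pre = i" by (rule split_at)
  show ?thesis
  proof (cases post rule: rev_exhaust)
    case Nil
    have "forget_order C = (set (pre @ [A]), B)"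
      using forget_order_snoc[of "pre @ [A]" B] by (simp add: C Nil)
    moreover have "forget_order (mrg i C) = (set pre, A \<union> B)"
      by (simp add: C(1) Nil merge_at_append'[OF C(2)])
    ultimately show ?thesis by (auto simp: pset_le_def)
  next
    case (snoc q Z)
    have "forget_order C = (set (pre @ A # B # q), Z)"
      using forget_order_snoc[of "pre @ A # B # q" Z] by (simp add: C snoc)
    moreover have "forget_order (mrg i C) = (set (pre @ (A \<union> B) # q), Z)"
      using forget_order_snoc[of "pre @ (A \<union> B) # q" Z]
      by (simp add: C(1) snoc merge_at_append'[OF C(2)])
    ultimately show ?thesis by (auto simp: pset_le_def)
  qed
qed (simp add: merge_at_short)

section \<open>The bar complex maps to the order complex\<close>

text \<open>To be used with r one less than the number of blocks. The recursion stops at the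
  one-block partition, the maximum, which is left out of the chain. The flags of sets of cuts that
  arise are those of the barycentric subdivision of a simplex with the cuts as vertices.\<close>

primrec bar_chain :: "nat \<Rightarrow> nat set list \<Rightarrow> (pset_partition list \<Rightarrow>\<^sub>0 'k::field)" where
  "bar_chain 0 C = Poly_Mapping.single [] 1"
| "bar_chain (Suc r) C = basis_map ((#) (forget_order C))
    (\<Sum>i<Suc r. fscale ((- 1) ^ i) (bar_chain r (mrg i C)))"

lemma flin_boundary [simp]: "flin boundary"
  by (simp add: boundary_def)

text \<open>The cone formula: deleting the apex returns the base, and every other face keeps the
  apex and shifts its sign.\<close>

lemma boundary_Cons:
  "boundary (basis_map ((#) x) c) = c - basis_map ((#) x) (boundary c)"
proof (rule flin_eqI[where f = "\<lambda>c. boundary (basis_map ((#) x) c)"])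
  show "flin (\<lambda>c. boundary (basis_map ((#) x) c))"
    by (rule flin_compose[OF flin_boundary flin_basis_map])
  show "flin (\<lambda>c. c - basis_map ((#) x) (boundary c))"
    by (rule flinI) (simp_all add: flin_add[OF flin_boundary] flin_scale[OF flin_boundary]
        basis_map_simps free_vs.scale_right_diff_distrib)
  fix xs
  show "boundary (basis_map ((#) x) (Poly_Mapping.single xs 1)) =
    Poly_Mapping.single xs 1 - basis_map ((#) x) (boundary (Poly_Mapping.single xs 1))"
    by (simp add: boundary_def sum.lessThan_Suc_shift basis_map_simps single_uminus sum_negf
        del: sum.lessThan_Suc)
qed

text \<open>The pair (i, j) with i \<le> j is matched with (j + 1, i), which carries the opposite
  sign.\<close>

lemma alternating_sum_cancel:
  fixes a :: "nat \<Rightarrow> nat \<Rightarrow> ('x \<Rightarrow>\<^sub>0 'k::field)"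
  assumes "\<And>i j. i \<le> j \<Longrightarrow> a i j = a (Suc j) i"
  shows "(\<Sum>i<Suc N. \<Sum>j<N. fscale ((- 1) ^ i) (fscale ((- 1) ^ j) (a i j))) = 0"
proof -
  let ?f = "\<lambda>(i, j). fscale ((- 1) ^ (i + j)) (a i j)"
  let ?S = "{(i, j). i \<le> j \<and> j < N}" and ?T = "{(i, j). j < i \<and> i < Suc N}"
  have fin: "finite ?S" "finite ?T"
    by (rule finite_subset[of _ "{..N} \<times> {..N}"]; auto)+
  have "(\<Sum>i<Suc N. \<Sum>j<N. fscale ((- 1) ^ i) (fscale ((- 1) ^ j) (a i j))) = sum ?f ({..<Suc N} \<times> {..<N})"
    by (simp add: sum.cartesian_product power_add)
  also have "{..<Suc N} \<times> {..<N} = ?S \<union> ?T" by auto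
  also have "sum ?f (?S \<union> ?T) = sum ?f ?S + sum ?f ?T"
    using fin by (intro sum.union_disjoint) auto
  also have "sum ?f ?T = (\<Sum>p\<in>?S. - ?f p)"
    by (rule sum.reindex_bij_witness[of _ "\<lambda>(i, j). (Suc j, i)" "\<lambda>(i, j). (j, i - 1)"])
      (auto simp: assms add.commute dest!: less_imp_Suc_add)
  finally show ?thesis by (simp add: sum_negf)
qed

text \<open>The chain is a cone over a cycle: by induction the boundary of the base is a double sum
  of merges, which vanishes by the simplicial identity. Only the base remains.\<close>

lemma boundary_bar_chain:
  "boundary (bar_chain (Suc r) C :: _ \<Rightarrow>\<^sub>0 'k::field) = (\<Sum>i<Suc r. fscale ((- 1) ^ i) (bar_chain r (mrg i C)))"
proof (induction r arbitrary: C)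
  case 0
  show ?case by (simp add: boundary_Cons) (simp add: boundary_def basis_map_simps)
next
  case (Suc r)
  let ?y = "\<Sum>i<Suc (Suc r). fscale ((- 1) ^ i) (bar_chain (Suc r) (mrg i C)) :: _ \<Rightarrow>\<^sub>0 'k"
  have "boundary ?y = (\<Sum>i<Suc (Suc r). \<Sum>j<Suc r. fscale ((- 1) ^ i) (fscale ((- 1) ^ j)
      (bar_chain r (mrg j (mrg i C)))))"
    by (simp only: flin_sum[OF flin_boundary] flin_scale[OF flin_boundary] Suc.IH free_vs.scale_sum_right)
  also have "\<dots> = 0"
    by (rule alternating_sum_cancel) (simp add: merge_at_merge_at Un_assoc)
  finally have "boundary ?y = 0" .
  then show ?case
    by (simp only: bar_chain.simps(2)[of "Suc r"] boundary_Cons flin_0[OF flin_basis_map] diff_0_right)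
qed

lemma osp_singleton: "C \<in> osp n \<Longrightarrow> length C = 1 \<Longrightarrow> C = [{1..n}]"
  by (cases C) (auto simp: osp_def)

lemma keys_bar_chain:
  "C \<in> osp n \<Longrightarrow> length C = Suc r \<Longrightarrow> xs \<in> Poly_Mapping.keys (bar_chain r C :: _ \<Rightarrow>\<^sub>0 'k::field) \<Longrightarrow>
    length xs = r \<and> sorted_wrt (\<lambda>x y. pset_le x y \<and> x \<noteq> y) xs \<and>
    (\<forall>x\<in>set xs. x \<in> pset_partitions n \<and> pset_le (forget_order C) x \<and> 0 < card (fst x) \<and> card (fst x) \<le> r)"
proof (induction r arbitrary: C xs)
  case (Suc r)
  let ?y = "\<Sum>i<Suc r. fscale ((- 1) ^ i) (bar_chain r (mrg i C)) :: _ \<Rightarrow>\<^sub>0 'k"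
  obtain ys where xs: "xs = forget_order C # ys" and ys: "ys \<in> Poly_Mapping.keys ?y"
    using Suc.prems(3) keys_basis_map[of "(#) (forget_order C)" ?y] by (auto simp del: sum.lessThan_Suc)
  then obtain i where i: "i < Suc r" "ys \<in> Poly_Mapping.keys (fscale ((- 1) ^ i) (bar_chain r (mrg i C)) :: _ \<Rightarrow>\<^sub>0 'k)"
    using Poly_Mapping.keys_sum[of "\<lambda>i. fscale ((- 1) ^ i) (bar_chain r (mrg i C)) :: _ \<Rightarrow>\<^sub>0 'k" "{..<Suc r}"]
    by blast
  then have "ys \<in> Poly_Mapping.keys (bar_chain r (mrg i C) :: _ \<Rightarrow>\<^sub>0 'k)"
    by (auto simp: in_keys_iff)
  moreover have "length (mrg i C) = Suc r" using length_merge_at[of i C] Suc.prems(2) i(1) by simp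
  ultimately have IH: "length ys = r \<and> sorted_wrt (\<lambda>x y. pset_le x y \<and> x \<noteq> y) ys \<and>
    (\<forall>x\<in>set ys. x \<in> pset_partitions n \<and> pset_le (forget_order (mrg i C)) x \<and> 0 < card (fst x) \<and> card (fst x) \<le> r)"
    using Suc.IH[OF osp_mrg[OF Suc.prems(1)]] by blast
  have "C \<noteq> []" using Suc.prems(2) by auto
  note fo = forget_order_partition[OF Suc.prems(1) this]
  have "pset_le (forget_order C) y \<and> forget_order C \<noteq> y" if "y \<in> set ys" for y
    using IH that fo(3) Suc.prems(2) pset_le_trans[OF forget_order_mrg_le] by fastforce
  then show ?case
    using IH fo Suc.prems(2) by (auto simp: xs)
qed simp

lemma bar_chain_act:
  "length C = Suc r \<Longrightarrow>
    bar_chain r (map ((`) p) C) = basis_map (map (pset_act p)) (bar_chain r C :: _ \<Rightarrow>\<^sub>0 'k::field)"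
proof (induction r arbitrary: C)
  case (Suc r)
  have len: "length (mrg i C) = Suc r" if "i < Suc r" for i
    using length_merge_at[of i C] Suc.prems that by simp
  have "C \<noteq> []" using Suc.prems by auto
  have "basis_map (map (pset_act p)) (bar_chain (Suc r) C :: _ \<Rightarrow>\<^sub>0 'k)
      = basis_map ((#) (forget_order (map ((`) p) C))) (basis_map (map (pset_act p))
          (\<Sum>i<Suc r. fscale ((- 1) ^ i) (bar_chain r (mrg i C))))"
    by (simp only: bar_chain.simps basis_map_basis_map list.map forget_order_act[OF \<open>C \<noteq> []\<close>])
  also have "\<dots> = bar_chain (Suc r) (map ((`) p) C)"
    unfolding bar_chain.simps basis_map_simps
    using Suc.IH[OF len] by (intro sum.cong arg_cong[where f = "fscale _"] refl)
      (simp add: map_image_mrg[symmetric])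
  finally show ?case by simp
qed simp

text \<open>In a list of r + 2 blocks \<open>mrg r\<close> unites the last two, so the pointed block
  absorbs the block in front of it.\<close>

primrec absorbing_chain :: "nat \<Rightarrow> nat set list \<Rightarrow> pset_partition list" where
  "absorbing_chain 0 C = []"
| "absorbing_chain (Suc r) C = forget_order C # absorbing_chain r (mrg r C)"

lemma length_absorbing_chain [simp]: "length (absorbing_chain r C) = r"
  by (induction r arbitrary: C) auto

lemma lookup_basis_map_Cons:
  "Poly_Mapping.lookup (basis_map ((#) a) y) (b # c) = (if a = b then Poly_Mapping.lookup y c else 0)"
proof (cases "a = b")
  case True
  then show ?thesis using lookup_basis_map_inj[of "(#) a" y c] by (simp add: inj_def)
next
  case False
  then have "b # c \<notin> Poly_Mapping.keys (basis_map ((#) a) y)"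
    using keys_basis_map[of "(#) a" y] by auto
  with False show ?thesis by (simp add: in_keys_iff)
qed

lemma last_mrg: "Suc (Suc i) < length C \<Longrightarrow> last (mrg i C) = last C"
proof -
  assume "Suc (Suc i) < length C"
  then obtain pre A B post where C: "C = pre @ A # B # post" "length pre = i" "post \<noteq> []"
    using split_at[of i C] by (metis Suc_lessD append_Cons append_Nil append_assoc length_Cons length_append
        less_irrefl list.size(3) add_Suc_right add_0_right)
  then show ?thesis by (simp add: merge_at_append'[OF C(2)])
qed

lemma split_last_two:
  assumes "length C = Suc (Suc r)"
  obtains pre A Z where "C = pre @ [A, Z]" "length pre = r" "mrg r C = pre @ [A \<union> Z]"
proof -
  have "Suc r < length C" using assms by simp
  then obtain pre A Z post where C: "C = pre @ A # Z # post" "length pre = r"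
    by (rule split_at)
  then have "post = []" using assms by simp
  with C that show thesis by (simp add: merge_at_append'[OF C(2)])
qed

text \<open>The order in which the blocks disappear recovers the list, so the matrix of these
  coefficients is diagonal. In each step only the merge at the last place contributes, with sign
  (-1)^r; this gives the product \<open>e\<close>.\<close>

lemma lookup_bar_chain:
  fixes r :: nat
  defines "e \<equiv> \<lambda>r. \<Prod>j<r. (- 1) ^ j"
  shows "C \<in> osp n \<Longrightarrow> C' \<in> osp n \<Longrightarrow> length C = Suc r \<Longrightarrow> length C' = Suc r \<Longrightarrow>
    Poly_Mapping.lookup (bar_chain r C) (absorbing_chain r C') = (if C = C' then e r else (0 :: 'k::field))"
proof (induction r arbitrary: C C')
  case 0
  then show ?case using osp_singleton[of C n] osp_singleton[of C' n] by (simp add: e_def)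
next
  case (Suc r)
  obtain pre A Z where C: "C = pre @ [A, Z]" "mrg r C = pre @ [A \<union> Z]"
    using split_last_two Suc.prems(3) by metis
  obtain pre' A' Z' where C': "C' = pre' @ [A', Z']" "mrg r C' = pre' @ [A' \<union> Z']"
    using split_last_two Suc.prems(4) by metis
  have disj: "A \<inter> Z = {}" "A' \<inter> Z' = {}" "A' \<noteq> {}"
    using Suc.prems(1,2) by (auto simp: C C' osp_def sorted_wrt_disjnt_append sorted_wrt_disjnt_Cons disjnt_def)
  have len: "length (mrg i C) = Suc r" if "i < Suc r" for i
    using length_merge_at[of i C] Suc.prems(3) that by simp
  have len': "length (mrg r C') = Suc r"
    using length_merge_at[of r C'] Suc.prems(4) by simp
  show ?case
  proof (cases "forget_order C = forget_order C'")
    case False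
    then show ?thesis by (auto simp: lookup_basis_map_Cons)
  next
    case True
    then have ZZ: "Z = Z'" by (simp add: C C' forget_order_def)
    \<comment> \<open>A merge at an earlier place leaves the last block Z unchanged, whereas
      \<open>mrg r C'\<close> enlarges it; and A is recovered from A \<union> Z by
      disjointness.\<close>
    have iff: "mrg i C = mrg r C' \<longleftrightarrow> i = r \<and> C = C'" if i: "i < Suc r" for i
    proof (cases "i = r")
      case True
      have "A \<union> Z = A' \<union> Z' \<longleftrightarrow> A = A'" using disj ZZ by blast
      then show ?thesis using True C C' ZZ by auto
    next
      case False
      then have "last (mrg i C) = Z" using last_mrg[of i C] i Suc.prems(3) by (simp add: C(1))
      moreover have "last (mrg r C') = A' \<union> Z'" by (simp add: C'(2))
      moreover have "Z \<noteq> A' \<union> Z'" using disj ZZ by blast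
      ultimately show ?thesis using False by metis
    qed
    have "Poly_Mapping.lookup (bar_chain (Suc r) C) (absorbing_chain (Suc r) C')
        = (\<Sum>i<Suc r. (- 1) ^ i * (if i = r \<and> C = C' then e r else (0 :: 'k)))"
      unfolding bar_chain.simps absorbing_chain.simps lookup_basis_map_Cons lookup_sum' lookup_fscale
      using True Suc.IH[OF osp_mrg[OF Suc.prems(1)] osp_mrg[OF Suc.prems(2)] len len'] iff
      by simp
    also have "\<dots> = (if C = C' then e (Suc r) else 0)"
      by (simp add: e_def mult.commute)
    finally show ?thesis .
  qed
qed

section \<open>Top cycles of the order complex\<close>

definition pointed_partitions :: "nat \<Rightarrow> pset_partition set"
  where "pointed_partitions n = {x \<in> pset_partitions n. snd x \<noteq> {}}"

lemma finite_pointed_partitions [simp]: "finite (pointed_partitions n)"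
  by (simp add: pointed_partitions_def)

text \<open>The number of blocks is tied to the remaining length, so no level is skipped. This
  allows the place of a deleted element to be recognised from a face.\<close>

fun graded_chain :: "nat \<Rightarrow> pset_partition list \<Rightarrow> bool" where
  "graded_chain n [] = True"
| "graded_chain n (x # c) \<longleftrightarrow> x \<in> pointed_partitions n \<and> card (fst x) = Suc (length c) \<and>
    (\<forall>y\<in>set c. pset_le x y) \<and> graded_chain n c"

text \<open>The conditions that a top cycle satisfies on the chains above a fixed chain: every face other
  than the first one cancels.\<close>

definition link_cycle :: "nat \<Rightarrow> nat \<Rightarrow> (pset_partition list \<Rightarrow> 'k::field) \<Rightarrow> bool"
  where "link_cycle n r z \<longleftrightarrow> (\<forall>c. z c \<noteq> 0 \<longrightarrow> graded_chain n c \<and> length c = r) \<and>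
    (\<forall>P Q. P \<noteq> [] \<longrightarrow> (\<Sum>x\<in>pointed_partitions n. z (P @ x # Q)) = 0)"

lemma link_cycle_support: "link_cycle n r z \<Longrightarrow> z c \<noteq> 0 \<Longrightarrow> graded_chain n c \<and> length c = r"
  by (simp add: link_cycle_def)

text \<open>Passing to the link of the first element preserves the conditions at the later places,
  which makes induction on the length possible; the condition at the second place is kept as the
  other conclusion.\<close>

lemma link_cycle_Cons:
  assumes "link_cycle n (Suc r) z"
  shows "link_cycle n r (\<lambda>c. z (x # c))" "(\<Sum>y\<in>pointed_partitions n. z (x # y # Q)) = 0"
proof -
  have 0: "(\<Sum>y\<in>pointed_partitions n. z ((x # P) @ y # Q)) = 0" for P Q
    using assms unfolding link_cycle_def by blast
  from 0[of "[]" Q] show "(\<Sum>y\<in>pointed_partitions n. z (x # y # Q)) = 0" by simp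
  show "link_cycle n r (\<lambda>c. z (x # c))"
    unfolding link_cycle_def
  proof (intro conjI allI impI)
    fix c assume "z (x # c) \<noteq> 0"
    then have "graded_chain n (x # c) \<and> length (x # c) = Suc r" by (rule link_cycle_support[OF assms])
    then show "graded_chain n c" "length c = r" by simp_all
  next
    fix P Q
    show "(\<Sum>y\<in>pointed_partitions n. z (x # P @ y # Q)) = 0" using 0[of P Q] by simp
  qed
qed

lemma pset_le_top: "x \<in> pset_partitions n \<Longrightarrow> pset_le x ({}, {1..n})"
  using pset_partitions_subset[of n] by (auto simp: pset_le_def split: prod.splits)

lemma graded_chain_le:
  assumes g: "graded_chain n (x # absorbing_chain r N)" and N: "N \<in> osp n" "length N = Suc r"
  shows "pset_le x (forget_order N)"
proof (cases r)
  case 0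
  then have "N = [{1..n}]" using osp_singleton N by simp
  moreover have "x \<in> pset_partitions n" using g by (simp add: pointed_partitions_def)
  ultimately show ?thesis using pset_le_top by (simp add: forget_order_def)
next
  case (Suc r')
  then show ?thesis using g by simp
qed

section \<open>Intervals of rank two\<close>

lemma block_in_family:
  assumes P: "(Bs, Z) \<in> pset_partitions n" and G: "G \<in> Bs" and S: "S \<subseteq> insert Z Bs" and sub: "G \<subseteq> \<Union> S"
  shows "G \<in> S" "G \<noteq> Z"
proof -
  have "G \<noteq> {}" using P G unfolding pset_partitions_iff by blast
  then obtain v where v: "v \<in> G" by blast
  have vZ: "v \<notin> Z" using block_not_pointed[OF P G v] by blast
  then show "G \<noteq> Z" using v by blast
  obtain X where X: "X \<in> S" "v \<in> X" using v sub by blast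
  then have "X \<in> Bs" using S vZ by blast
  then show "G \<in> S" using block_unique[OF P _ G X(2) v] X(1) by blast
qed

lemma join_blocks_commute: "join_blocks A B x = join_blocks B A x"
  by (cases x) (simp add: join_blocks_def Un_commute insert_commute)

lemma cover_between_disjoint:
  assumes P: "(Bs, Z) \<in> pset_partitions n" and mem: "A \<in> Bs" "B \<in> Bs" "F \<in> Bs"
    and x: "x \<in> pset_partitions n" "pset_le (Bs, Z) x" "Suc (card (fst x)) = card Bs"
    and le: "pset_le x (insert (A \<union> B) (Bs - {A, B, F}), F \<union> Z)"
  shows "x = absorb_block F (Bs, Z) \<or> x = join_blocks A B (Bs, Z)"
proof -
  consider G where "G \<in> Bs" "x = absorb_block G (Bs, Z)"
    | G H where "G \<in> Bs" "H \<in> Bs" "G \<noteq> H" "x = join_blocks G H (Bs, Z)"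
    using pset_le_cover[OF P x] by blast
  then show ?thesis
  proof cases
    case 1
    then have "G \<subseteq> \<Union> {F, Z}" using le by (simp add: absorb_block_def pset_le_def)
    then have "G = F" using block_in_family[OF P 1(1), of "{F, Z}"] mem by blast
    with 1 show ?thesis by simp
  next
    case 2
    then have "\<exists>N\<in>insert (F \<union> Z) (insert (A \<union> B) (Bs - {A, B, F})). G \<union> H \<subseteq> N"
      using le by (simp add: join_blocks_def pset_le_def)
    then consider "G \<union> H \<subseteq> F \<union> Z" | "G \<union> H \<subseteq> A \<union> B" | N where "N \<in> Bs" "G \<union> H \<subseteq> N" by blast
    then show ?thesis
    proof cases
      case a: 1
      have "G = F" using block_in_family[OF P 2(1), of "{F, Z}"] mem a by blast
      moreover have "H = F" using block_in_family[OF P 2(2), of "{F, Z}"] mem a by blast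
      ultimately show ?thesis using 2(3) by simp
    next
      case a: 2
      have "G \<in> {A, B}" using block_in_family(1)[OF P 2(1), of "{A, B}"] mem a by auto
      moreover have "H \<in> {A, B}" using block_in_family(1)[OF P 2(2), of "{A, B}"] mem a by auto
      ultimately show ?thesis using 2(3,4) join_blocks_commute by auto
    next
      case a: 3
      have "G = N" using block_in_family(1)[OF P 2(1), of "{N}"] a by auto
      moreover have "H = N" using block_in_family(1)[OF P 2(2), of "{N}"] a by auto
      ultimately show ?thesis using 2(3) by simp
    qed
  qed
qed

text \<open>Both blocks end up in the pointed one: either may be absorbed at once, or they are
  joined beforehand. The three middle elements give a relation with three terms.\<close>

lemma cover_between_joined:
  assumes P: "(Bs, Z) \<in> pset_partitions n" and mem: "A \<in> Bs" "B \<in> Bs"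
    and x: "x \<in> pset_partitions n" "pset_le (Bs, Z) x" "Suc (card (fst x)) = card Bs"
    and le: "pset_le x (Bs - {A, B}, A \<union> B \<union> Z)"
  shows "x = absorb_block A (Bs, Z) \<or> x = absorb_block B (Bs, Z) \<or> x = join_blocks A B (Bs, Z)"
proof -
  consider G where "G \<in> Bs" "x = absorb_block G (Bs, Z)"
    | G H where "G \<in> Bs" "H \<in> Bs" "G \<noteq> H" "x = join_blocks G H (Bs, Z)"
    using pset_le_cover[OF P x] by blast
  then show ?thesis
  proof cases
    case 1
    then have "G \<subseteq> \<Union> {A, B, Z}" using le by (auto simp: absorb_block_def pset_le_def)
    then have "G = A \<or> G = B" using block_in_family[OF P 1(1), of "{A, B, Z}"] mem by blast
    with 1 show ?thesis by blast
  next
    case 2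
    then have "\<exists>N\<in>insert (A \<union> B \<union> Z) (Bs - {A, B}). G \<union> H \<subseteq> N"
      using le by (simp add: join_blocks_def pset_le_def)
    then consider "G \<union> H \<subseteq> \<Union> {A, B, Z}" | N where "N \<in> Bs" "G \<union> H \<subseteq> N" by auto
    then show ?thesis
    proof cases
      case a: 1
      have "G = A \<or> G = B" using block_in_family[OF P 2(1), of "{A, B, Z}"] mem a by blast
      moreover have "H = A \<or> H = B" using block_in_family[OF P 2(2), of "{A, B, Z}"] mem a by blast
      ultimately show ?thesis using 2(3,4) join_blocks_commute by auto
    next
      case a: 2
      have "G = N" using block_in_family(1)[OF P 2(1), of "{N}"] a by auto
      moreover have "H = N" using block_in_family(1)[OF P 2(2), of "{N}"] a by auto
      ultimately show ?thesis using 2(3) by simp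
    qed
  qed
qed

lemma link_cycle_middle:
  assumes z: "link_cycle n (Suc (Suc r)) z" and nz: "z (y # x # absorbing_chain r N) \<noteq> 0"
    and N: "N \<in> osp n" "length N = Suc r"
  shows "x \<in> pset_partitions n" "pset_le y x" "Suc (card (fst x)) = card (fst y)" "pset_le x (forget_order N)"
proof -
  have g: "graded_chain n (y # x # absorbing_chain r N)"
    using link_cycle_support[OF z nz] by blast
  then show "x \<in> pset_partitions n" "pset_le y x" "Suc (card (fst x)) = card (fst y)"
    by (simp_all add: pointed_partitions_def)
  from g have "graded_chain n (x # absorbing_chain r N)" by simp
  then show "pset_le x (forget_order N)" by (rule graded_chain_le[OF _ N])
qed

lemma absorb_block_pointed:
  "(Bs, Z) \<in> pset_partitions n \<Longrightarrow> Z \<noteq> {} \<Longrightarrow> A \<in> Bs \<Longrightarrow> absorb_block A (Bs, Z) \<in> pointed_partitions n"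
  using absorb_block_partition[of Bs Z n A] by (simp add: pointed_partitions_def absorb_block_def)

lemma join_blocks_pointed:
  "(Bs, Z) \<in> pset_partitions n \<Longrightarrow> Z \<noteq> {} \<Longrightarrow> A \<in> Bs \<Longrightarrow> B \<in> Bs \<Longrightarrow> join_blocks A B (Bs, Z) \<in> pointed_partitions n"
  using join_blocks_partition[of Bs Z n A B] by (simp add: pointed_partitions_def join_blocks_def)

text \<open>A chain that first joins two blocks is exchanged with chains in which the pointed block absorbs
  the blocks one by one.\<close>

lemma join_chain_relation:
  assumes "link_cycle n (Suc r) z" "pre @ A # B # q @ [Z] \<in> osp n"
    and "length (pre @ A # B # q @ [Z]) = Suc (Suc r)"
  shows "z (forget_order (pre @ A # B # q @ [Z]) # absorbing_chain r (pre @ (A \<union> B) # q @ [Z])) =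
    (- 1) ^ Suc (length q) * (z (absorbing_chain (Suc r) (pre @ A # B # q @ [Z])) +
      z (absorbing_chain (Suc r) (pre @ B # A # q @ [Z])) :: 'k::field)"
  using assms
proof (induction q arbitrary: z r Z rule: rev_induct)
  case Nil
  define r' where "r' = length pre"
  have r: "r = Suc r'" using Nil.prems(3) by (simp add: r'_def)
  let ?Bs = "set (pre @ [A, B])"
  have P: "(?Bs, Z) \<in> pset_partitions n" and dist: "distinct (pre @ [A, B])" and Z: "Z \<noteq> {}"
    using Nil.prems(2) osp_snoc[of "pre @ [A, B]" Z n] by simp_all
  have AB: "A \<in> ?Bs" "B \<in> ?Bs" "A \<noteq> B" using dist by auto
  note ne = union_not_block(2,3)[OF P AB]
  have nZ: "v \<notin> Z" if "v \<in> A \<or> v \<in> B" for v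
    using block_not_pointed[OF P AB(1)] block_not_pointed[OF P AB(2)] that by blast
  have nAB: "v \<notin> B" if "v \<in> A" for v
    using block_unique[OF P AB(1,2) that] AB(3) by blast
  define N where "N = pre @ [A \<union> B \<union> Z]"
  have C: "forget_order (pre @ [A, B, Z]) = (?Bs, Z)" "forget_order (pre @ [B, A, Z]) = (?Bs, Z)"
    using forget_order_snoc[of "pre @ [A, B]" Z] forget_order_snoc[of "pre @ [B, A]" Z]
    by (simp_all add: insert_commute)
  have m1: "mrg (Suc r') (pre @ [A, B, Z]) = pre @ [A, B \<union> Z]" "mrg r' (pre @ [A, B \<union> Z]) = N"
    using merge_at_append'[of "pre @ [A]" "Suc r'" "(\<union>)" B Z "[]"]
      merge_at_append'[of pre r' "(\<union>)" A "B \<union> Z" "[]"] by (simp_all add: r'_def N_def Un_assoc)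
  have m2: "mrg (Suc r') (pre @ [B, A, Z]) = pre @ [B, A \<union> Z]" "mrg r' (pre @ [B, A \<union> Z]) = N"
    using merge_at_append'[of "pre @ [B]" "Suc r'" "(\<union>)" A Z "[]"]
      merge_at_append'[of pre r' "(\<union>)" B "A \<union> Z" "[]"] by (simp_all add: r'_def N_def Un_ac)
  have m3: "mrg r' (pre @ [A \<union> B, Z]) = N"
    using merge_at_append'[of pre r' "(\<union>)" "A \<union> B" Z "[]"] by (simp add: r'_def N_def)
  have N: "N \<in> osp n" "length N = Suc r'"
    using osp_mrg[OF osp_mrg[OF Nil.prems(2), of "Suc r'"], of r'] m1 by (simp_all add: N_def r'_def)
  have foN: "forget_order N = (?Bs - {A, B}, A \<union> B \<union> Z)"
    using dist by (auto simp: N_def)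
  have fa: "forget_order (pre @ [B, A \<union> Z]) = absorb_block A (?Bs, Z)"
    "forget_order (pre @ [A, B \<union> Z]) = absorb_block B (?Bs, Z)"
    "forget_order (pre @ [A \<union> B, Z]) = join_blocks A B (?Bs, Z)"
    using dist forget_order_snoc[of "pre @ [B]" "A \<union> Z"] forget_order_snoc[of "pre @ [A]" "B \<union> Z"]
      forget_order_snoc[of "pre @ [A \<union> B]" Z]
    by (auto simp: absorb_block_def join_blocks_def)
  let ?z = "\<lambda>x. z ((?Bs, Z) # x # absorbing_chain r' N)"
  \<comment> \<open>Absorbing B or A at once gives the two absorbing chains, and joining them gives
    the chain in question.\<close>
  let ?S = "{absorb_block A (?Bs, Z), absorb_block B (?Bs, Z), join_blocks A B (?Bs, Z)}"
  have "sum ?z ?S = sum ?z (pointed_partitions n)"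
  proof (rule sum.mono_neutral_left)
    show "?S \<subseteq> pointed_partitions n"
      using absorb_block_pointed[OF P Z AB(1)] absorb_block_pointed[OF P Z AB(2)]
        join_blocks_pointed[OF P Z AB(1,2)] by (simp only: insert_subset empty_subsetI)
    show "\<forall>x\<in>pointed_partitions n - ?S. ?z x = 0"
    proof (intro ballI, rule ccontr)
      fix x assume x: "x \<in> pointed_partitions n - ?S" "?z x \<noteq> 0"
      note mid = link_cycle_middle[OF Nil.prems(1)[unfolded r] x(2) N]
      have "x \<in> ?S"
        using cover_between_joined[OF P AB(1,2) mid(1,2) _ mid(4)[unfolded foN]] mid(3) by simp
      with x(1) show False by simp
    qed
  qed simp
  also have "\<dots> = 0"
    by (rule link_cycle_Cons(2)[OF Nil.prems(1)[unfolded r]])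
  finally have "sum ?z ?S = 0" .
  moreover have "absorb_block A (?Bs, Z) \<noteq> absorb_block B (?Bs, Z)"
    "absorb_block A (?Bs, Z) \<noteq> join_blocks A B (?Bs, Z)" "absorb_block B (?Bs, Z) \<noteq> join_blocks A B (?Bs, Z)"
  proof -
    have "A \<union> Z \<noteq> B \<union> Z" using ne(1) nAB nZ by blast
    moreover have "A \<union> Z \<noteq> Z" "B \<union> Z \<noteq> Z" using ne nZ by blast+
    ultimately show "absorb_block A (?Bs, Z) \<noteq> absorb_block B (?Bs, Z)"
      "absorb_block A (?Bs, Z) \<noteq> join_blocks A B (?Bs, Z)" "absorb_block B (?Bs, Z) \<noteq> join_blocks A B (?Bs, Z)"
      unfolding absorb_block_def join_blocks_def prod.case prod.inject by blast+
  qed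
  ultimately have "?z (absorb_block A (?Bs, Z)) + (?z (absorb_block B (?Bs, Z)) + ?z (join_blocks A B (?Bs, Z))) = 0"
    by simp
  then have "?z (join_blocks A B (?Bs, Z)) = - (?z (absorb_block B (?Bs, Z)) + ?z (absorb_block A (?Bs, Z)))"
    by (simp only: eq_neg_iff_add_eq_0 ac_simps)
  then show ?case
    by (simp add: r C m1 m2 m3 fa)
next
  case (snoc F q)
  define r' where "r' = Suc (length pre + length q)"
  have r: "r = Suc r'" using snoc.prems(3) by (simp add: r'_def)
  let ?Bs = "set (pre @ A # B # q @ [F])"
  have C_eq: "pre @ A # B # (q @ [F]) @ [Z] = (pre @ A # B # q @ [F]) @ [Z]" by simp
  have P: "(?Bs, Z) \<in> pset_partitions n" and dist: "distinct (pre @ A # B # q @ [F])" and Z: "Z \<noteq> {}"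
    using snoc.prems(2) osp_snoc[of "pre @ A # B # q @ [F]" Z n] by simp_all
  have mem: "A \<in> ?Bs" "B \<in> ?Bs" "F \<in> ?Bs" "A \<noteq> B" "A \<noteq> F" "B \<noteq> F" using dist by auto
  have neF: "F \<noteq> {}" using union_not_block(3)[OF P mem(1,3,5)] .
  have nZ: "v \<notin> Z" if "v \<in> F" for v
    using block_not_pointed[OF P mem(3) that] by blast
  define N where "N = pre @ (A \<union> B) # q @ [F \<union> Z]"
  let ?C1 = "pre @ A # B # q @ [F \<union> Z]" and ?D1 = "pre @ B # A # q @ [F \<union> Z]"
  let ?C = "pre @ A # B # q @ [F, Z]" and ?D = "pre @ B # A # q @ [F, Z]"
  let ?C' = "pre @ (A \<union> B) # q @ [F, Z]"
  have fC: "forget_order ?C = (?Bs, Z)" "forget_order ?D = (?Bs, Z)"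
    using forget_order_snoc[of "pre @ A # B # q @ [F]" Z] forget_order_snoc[of "pre @ B # A # q @ [F]" Z]
    by (simp_all add: insert_commute)
  have m: "mrg (Suc r') ?C = ?C1" "mrg (Suc r') ?D = ?D1" "mrg r' ?C' = N"
    using merge_at_append'[of "pre @ A # B # q" "Suc r'" "(\<union>)" F Z "[]"]
      merge_at_append'[of "pre @ B # A # q" "Suc r'" "(\<union>)" F Z "[]"]
      merge_at_append'[of "pre @ (A \<union> B) # q" r' "(\<union>)" F Z "[]"] by (simp_all add: r'_def N_def)
  have osp_C: "?C \<in> osp n" using snoc.prems(2) by simp
  have osp_C1: "?C1 \<in> osp n" using osp_mrg[OF osp_C, of "Suc r'"] m(1) by simp
  have N: "N \<in> osp n" "length N = Suc r'"
    using osp_mrg[OF osp_C1, of "length pre"] by (simp_all add: N_def r'_def)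
  have foN: "forget_order N = (insert (A \<union> B) (?Bs - {A, B, F}), F \<union> Z)"
    using dist forget_order_snoc[of "pre @ (A \<union> B) # q" "F \<union> Z"] by (auto simp: N_def)
  have fC1: "forget_order ?C1 = absorb_block F (?Bs, Z)"
    using dist forget_order_snoc[of "pre @ A # B # q" "F \<union> Z"] by (auto simp: absorb_block_def)
  have fC': "forget_order ?C' = join_blocks A B (?Bs, Z)"
    using dist forget_order_snoc[of "pre @ (A \<union> B) # q @ [F]" Z] by (auto simp: join_blocks_def)
  let ?z = "\<lambda>x. z ((?Bs, Z) # x # absorbing_chain r' N)"
  let ?S = "{absorb_block F (?Bs, Z), join_blocks A B (?Bs, Z)}"
  have "sum ?z ?S = sum ?z (pointed_partitions n)"
  proof (rule sum.mono_neutral_left)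
    show "?S \<subseteq> pointed_partitions n"
      using absorb_block_pointed[OF P Z mem(3)] join_blocks_pointed[OF P Z mem(1,2)]
      by (simp only: insert_subset empty_subsetI)
    show "\<forall>x\<in>pointed_partitions n - ?S. ?z x = 0"
    proof (intro ballI, rule ccontr)
      fix x assume x: "x \<in> pointed_partitions n - ?S" "?z x \<noteq> 0"
      note mid = link_cycle_middle[OF snoc.prems(1)[unfolded r] x(2) N]
      have "x \<in> ?S"
        using cover_between_disjoint[OF P mem(1,2,3) mid(1,2) _ mid(4)[unfolded foN]] mid(3) by simp
      with x(1) show False by simp
    qed
  qed simp
  also have "\<dots> = 0"
    by (rule link_cycle_Cons(2)[OF snoc.prems(1)[unfolded r]])
  finally have "sum ?z ?S = 0" .
  moreover have "absorb_block F (?Bs, Z) \<noteq> join_blocks A B (?Bs, Z)"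
  proof -
    have "F \<union> Z \<noteq> Z" using neF nZ by blast
    then show ?thesis
      unfolding absorb_block_def join_blocks_def prod.case prod.inject by blast
  qed
  ultimately have rel: "?z (absorb_block F (?Bs, Z)) + ?z (join_blocks A B (?Bs, Z)) = 0"
    by simp
  \<comment> \<open>The relation with two terms exchanges the join with the absorption of F at the
    cost of a sign. In the link of the first element the induction hypothesis applies, with F
    \<union> Z as pointed block.\<close>
  have "?z (absorb_block F (?Bs, Z)) = (- 1) ^ Suc (length q) *
      (z ((?Bs, Z) # absorbing_chain (Suc r') ?C1) + z ((?Bs, Z) # absorbing_chain (Suc r') ?D1))"
    using snoc.IH[OF link_cycle_Cons(1)[OF snoc.prems(1)[unfolded r]], of "F \<union> Z" "(?Bs, Z)"] osp_C1 fC1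
    by (simp add: r'_def N_def del: absorbing_chain.simps)
  with rel show ?case
    by (simp add: r fC m fC')
qed

text \<open>An order of the blocks lifts through a cover: an absorbed block is put back directly in
  front of the pointed one, so that the last merge recovers the given list.\<close>

lemma unabsorb:
  assumes C': "C' \<in> osp n" "C' \<noteq> []" and P: "(Bs, Z) \<in> pset_partitions n" "Z \<noteq> {}" and A: "A \<in> Bs"
    and fo: "forget_order C' = absorb_block A (Bs, Z)"
  obtains C where "C \<in> osp n" "forget_order C = (Bs, Z)" "length C = Suc (length C')" "mrg (length C' - 1) C = C'"
proof -
  obtain D Z' where D: "C' = D @ [Z']" using C'(2) by (cases C' rule: rev_exhaust) auto
  have set: "set D = Bs - {A}" "Z' = A \<union> Z" using fo by (simp_all add: D absorb_block_def)
  have dist: "distinct D" using C'(1) osp_snoc[of D Z' n] by (simp add: D)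
  have "set (D @ [A]) = Bs" "distinct (D @ [A])" using set(1) dist A by auto
  then have "(D @ [A]) @ [Z] \<in> osp n" "forget_order ((D @ [A]) @ [Z]) = (Bs, Z)"
    unfolding osp_snoc forget_order_snoc using P by simp_all
  moreover have "mrg (length C' - 1) ((D @ [A]) @ [Z]) = C'"
    using merge_at_append'[of D "length D" "(\<union>)" A Z "[]"] by (simp add: D set(2))
  ultimately show thesis using that by (simp add: D)
qed

text \<open>The joined block is replaced by its two parts at the same place of the list.\<close>

lemma unjoin:
  assumes C': "C' \<in> osp n" "C' \<noteq> []" and P: "(Bs, Z) \<in> pset_partitions n" "Z \<noteq> {}"
    and AB: "A \<in> Bs" "B \<in> Bs" "A \<noteq> B" and fo: "forget_order C' = join_blocks A B (Bs, Z)"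
  obtains pre q where "C' = pre @ (A \<union> B) # q @ [Z]" "pre @ A # B # q @ [Z] \<in> osp n"
    "forget_order (pre @ A # B # q @ [Z]) = (Bs, Z)"
proof -
  obtain D Z' where D: "C' = D @ [Z']" using C'(2) by (cases C' rule: rev_exhaust) auto
  have set: "set D = insert (A \<union> B) (Bs - {A, B})" "Z' = Z" using fo by (simp_all add: D join_blocks_def)
  have dist: "distinct D" using C'(1) osp_snoc[of D Z' n] by (simp add: D)
  obtain pre q where D': "D = pre @ (A \<union> B) # q" using set(1) by (metis insertI1 split_list)
  have nb: "A \<union> B \<notin> Bs" by (rule union_not_block(1)[OF P(1) AB])
  have rest: "set pre \<union> set q = Bs - {A, B}" 
  proof -
    have "insert (A \<union> B) (set pre \<union> set q) = insert (A \<union> B) (Bs - {A, B})" using set(1) by (simp add: D')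
    moreover have "A \<union> B \<notin> set pre \<union> set q" using dist by (simp add: D')
    ultimately show ?thesis using nb by (simp add: insert_ident)
  qed
  have "set (pre @ A # B # q) = Bs" "distinct (pre @ A # B # q)"
    using rest dist AB by (auto simp: D')
  then have "(pre @ A # B # q) @ [Z] \<in> osp n" "forget_order ((pre @ A # B # q) @ [Z]) = (Bs, Z)"
    unfolding osp_snoc forget_order_snoc using P by simp_all
  then show thesis using that[of pre q] by (simp add: D D' set(2))
qed

text \<open>In the link of each first element the values on absorbing chains vanish again: the first
  step is an absorption, and the whole chain is absorbing, or it is a join, which
  \<open>join_chain_relation\<close> reduces to two absorbing chains.\<close>

lemma link_cycle_eq_0:
  assumes "0 < n" "link_cycle n r z" "\<And>C. C \<in> osp n \<Longrightarrow> length C = Suc r \<Longrightarrow> z (absorbing_chain r C) = 0"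
  shows "z c = (0 :: 'k::field)"
  using assms(2,3)
proof (induction r arbitrary: z c)
  case 0
  have "[{1..n}] \<in> osp n" using assms(1) by (simp add: osp_def)
  then have "z [] = 0" using 0(2)[of "[{1..n}]"] by simp
  then show ?case using link_cycle_support[OF 0(1), of c] by auto
next
  case (Suc r)
  have 0: "z (x # absorbing_chain r C') = 0" if C': "C' \<in> osp n" "length C' = Suc r" for x C'
  proof (rule ccontr)
    assume nz: "z (x # absorbing_chain r C') \<noteq> 0"
    have g: "graded_chain n (x # absorbing_chain r C')" using link_cycle_support[OF Suc.prems(1) nz] by blast
    obtain Bs Z where x: "x = (Bs, Z)" by force
    have P: "(Bs, Z) \<in> pset_partitions n" "Z \<noteq> {}" and card: "card Bs = Suc r"
      using g by (simp_all add: x pointed_partitions_def)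
    have le: "pset_le (Bs, Z) (forget_order C')" using graded_chain_le[OF g C'] by (simp add: x)
    have ne: "C' \<noteq> []" using C'(2) by auto
    note fo = forget_order_partition[OF C'(1) ne]
    have "Suc (card (fst (forget_order C'))) = card Bs" using fo(3) C'(2) card by simp
    from pset_le_cover[OF P(1) fo(1) le this]
    consider A where "A \<in> Bs" "forget_order C' = absorb_block A (Bs, Z)"
      | A B where "A \<in> Bs" "B \<in> Bs" "A \<noteq> B" "forget_order C' = join_blocks A B (Bs, Z)" by blast
    then show False
    proof cases
      case 1
      obtain C where C: "C \<in> osp n" "forget_order C = (Bs, Z)" "length C = Suc (length C')" "mrg (length C' - 1) C = C'"
        by (rule unabsorb[OF C'(1) ne P 1])
      have "absorbing_chain (Suc r) C = x # absorbing_chain r C'"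
        using C(2,4) C'(2) by (simp add: x)
      then show False using Suc.prems(2)[OF C(1)] C(3) C'(2) nz by simp
    next
      case 2
      obtain pre q where C: "C' = pre @ (A \<union> B) # q @ [Z]" "pre @ A # B # q @ [Z] \<in> osp n"
        "forget_order (pre @ A # B # q @ [Z]) = (Bs, Z)"
        by (rule unjoin[OF C'(1) ne P 2])
      let ?C = "pre @ A # B # q @ [Z]" and ?D = "pre @ B # A # q @ [Z]"
      have len: "length ?C = Suc (Suc r)" "length ?D = Suc (Suc r)" using C'(2) C(1) by simp_all
      have "?D \<in> osp n"
        using C(2) osp_snoc[of "pre @ A # B # q" Z n] osp_snoc[of "pre @ B # A # q" Z n]
        by (auto simp: insert_commute)
      then have "z (absorbing_chain (Suc r) ?D) = 0" using Suc.prems(2) len by blast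
      moreover have "z (absorbing_chain (Suc r) ?C) = 0" using Suc.prems(2)[OF C(2) len(1)] .
      ultimately show False
        using join_chain_relation[OF Suc.prems(1) C(2) len(1)] nz C(1,3) x
        by (simp del: absorbing_chain.simps)
    qed
  qed
  have "z (x # c') = 0" for x c'
    using Suc.IH[OF link_cycle_Cons(1)[OF Suc.prems(1), of x]] 0 by blast
  moreover have "z [] = 0" using link_cycle_support[OF Suc.prems(1), of "[]"] by auto
  ultimately show ?case by (cases c) auto
qed

lemma graded_chain_nth: "graded_chain n c \<Longrightarrow> j < length c \<Longrightarrow>
    c ! j \<in> pointed_partitions n \<and> card (fst (c ! j)) = length c - j"
  by (induction c arbitrary: j) (auto simp: nth_Cons split: nat.splits)

text \<open>The numbers of blocks reveal where an element has been deleted. Thus the coefficient of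
  the face P @ Q in the boundary collects only the chains with an element between P and Q, all with
  the same sign.\<close>

lemma link_cycle_boundary:
  assumes keys: "\<And>xs. xs \<in> Poly_Mapping.keys z \<Longrightarrow> graded_chain n xs \<and> length xs = r"
    and z: "boundary z = (0 :: _ \<Rightarrow>\<^sub>0 'k::field)"
  shows "(\<Sum>x\<in>pointed_partitions n. Poly_Mapping.lookup z (P @ x # Q)) = 0"
proof (cases "\<exists>x0. P @ x0 # Q \<in> Poly_Mapping.keys z")
  case False
  then show ?thesis by (intro sum.neutral) (auto simp: in_keys_iff)
next
  case True
  then obtain x0 where x0: "graded_chain n (P @ x0 # Q)" "length (P @ x0 # Q) = r" using keys by blast
  let ?del = "\<lambda>i xs. take i xs @ drop (Suc i) xs"
  let ?I = "(\<lambda>x. P @ x # Q) ` pointed_partitions n"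
  \<comment> \<open>If the places differed, the entry now at the smaller of them would have the
    wrong number of blocks.\<close>
  have unique: "i = length P" if xs: "graded_chain n xs" "length xs = r" "i < r" "?del i xs = P @ Q" for i xs
  proof (rule linorder_cases[of i "length P"])
    assume i: "i < length P"
    have "xs ! Suc i = ?del i xs ! i" using xs(2,3) i x0(2) by (simp add: nth_append)
    also have "\<dots> = (P @ x0 # Q) ! i" unfolding xs(4) using i by (simp add: nth_append)
    finally have "card (fst (xs ! Suc i)) = r - i"
      using graded_chain_nth[OF x0(1), of i] x0(2) i by simp
    moreover have "card (fst (xs ! Suc i)) = r - Suc i"
      using graded_chain_nth[OF xs(1), of "Suc i"] xs(2) x0(2) i by simp
    ultimately show ?thesis using i x0(2) by simp
  next
    assume i: "length P < i"
    have "xs ! length P = ?del i xs ! length P" using xs(2,3) i by (simp add: nth_append)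
    also have "\<dots> = (P @ x0 # Q) ! Suc (length P)" unfolding xs(4) by (simp add: nth_append)
    finally have "xs ! length P = (P @ x0 # Q) ! Suc (length P)" .
    moreover have "Q \<noteq> []" "r - Suc (length P) = length Q" using x0(2) i xs(3) by auto
    ultimately have "card (fst (xs ! length P)) = r - Suc (length P)"
      using graded_chain_nth[OF x0(1), of "Suc (length P)"] x0(2) i xs(3) by simp
    moreover have "card (fst (xs ! length P)) = r - length P"
      using graded_chain_nth[OF xs(1), of "length P"] xs(2,3) i by simp
    ultimately show ?thesis using i xs(3) by simp
  qed simp
  have inner: "Poly_Mapping.lookup (\<Sum>i<length xs. Poly_Mapping.single (?del i xs) ((- 1) ^ i)) (P @ Q)
      = (if xs \<in> ?I then (- 1) ^ length P else (0 :: 'k))" if "xs \<in> Poly_Mapping.keys z" for xs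
  proof -
    have xs: "graded_chain n xs" "length xs = r" using keys[OF that] by simp_all
    have P: "length P < r" using x0(2) by simp
    have "?del (length P) xs = P @ Q \<longleftrightarrow> xs \<in> ?I"
    proof
      assume "?del (length P) xs = P @ Q"
      then have "take (length P) xs = P" "drop (Suc (length P)) xs = Q"
        using xs(2) P by (simp_all add: append_eq_append_conv)
      then have "xs = P @ xs ! length P # Q" using id_take_nth_drop[of "length P" xs] xs(2) P by simp
      moreover have "xs ! length P \<in> pointed_partitions n"
        using graded_chain_nth[OF xs(1)] xs(2) P by simp
      ultimately show "xs \<in> ?I" by (rule image_eqI)
    qed auto
    moreover have "Poly_Mapping.lookup (\<Sum>i<length xs. Poly_Mapping.single (?del i xs) ((- 1) ^ i)) (P @ Q)
        = (\<Sum>i<r. if i = length P then (if ?del (length P) xs = P @ Q then (- 1) ^ length P else 0) else (0 :: 'k))"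
      unfolding lookup_sum' xs(2)
    proof (rule sum.cong)
      fix i assume "i \<in> {..<r}"
      then have "?del i xs \<noteq> P @ Q" if "i \<noteq> length P" using unique[OF xs, of i] that by blast
      then show "Poly_Mapping.lookup (Poly_Mapping.single (?del i xs) ((- 1) ^ i)) (P @ Q)
          = (if i = length P then (if ?del (length P) xs = P @ Q then (- 1) ^ length P else 0) else (0 :: 'k))"
        by (cases "i = length P") (simp_all add: lookup_single when_def)
    qed simp
    ultimately show ?thesis using P by simp
  qed
  have fin: "finite (Poly_Mapping.keys z)" by simp
  have "0 = Poly_Mapping.lookup (boundary z) (P @ Q)" using z by simp
  also have "\<dots> = (\<Sum>xs\<in>Poly_Mapping.keys z. Poly_Mapping.lookup z xs * (if xs \<in> ?I then (- 1) ^ length P else 0))"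
    unfolding boundary_def lookup_lin_ext[OF fin order_refl] using inner by (intro sum.cong) simp_all
  also have "\<dots> = (\<Sum>xs\<in>Poly_Mapping.keys z \<inter> ?I. Poly_Mapping.lookup z xs * (- 1) ^ length P)"
    by (subst sum.inter_restrict[OF fin]) (intro sum.cong, auto)
  also have "\<dots> = (\<Sum>xs\<in>?I. Poly_Mapping.lookup z xs * (- 1) ^ length P)"
    by (intro sum.mono_neutral_left) (auto simp: in_keys_iff)
  also have "\<dots> = (\<Sum>x\<in>pointed_partitions n. Poly_Mapping.lookup z (P @ x # Q) * (- 1) ^ length P)"
    by (subst sum.reindex) (auto simp: inj_on_def)
  also have "\<dots> = (\<Sum>x\<in>pointed_partitions n. Poly_Mapping.lookup z (P @ x # Q)) * (- 1) ^ length P"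
    by (simp add: sum_distrib_right)
  finally show ?thesis by simp
qed

section \<open>Top homology of the filter\<close>

context pointed_type
begin

abbreviation proper_filter :: "pset_partition set"
  where "proper_filter \<equiv> pset_filter lam m n - {pset_top n}"

lemma pset_type_card:
  assumes "pset_type x = (lam, m)"
  shows "card (fst x) = size lam" "card (snd x) = m"
  using assms by (auto simp: pset_type_def split: prod.splits)

lemma pset_filter_facts:
  assumes x: "x \<in> pset_filter lam m n"
  shows "x \<in> pointed_partitions n" "card (fst x) \<le> size lam"
    "card (fst x) = size lam \<Longrightarrow> pset_type x = (lam, m)"
proof -
  obtain y where y: "x \<in> pset_partitions n" "y \<in> pset_partitions n" "pset_type y = (lam, m)" "pset_le y x"
    using x by (auto simp: pset_filter_def)
  note card = pset_type_card[OF y(3)] and le = pset_le_card[OF y(2,1,4)]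
  have "snd y \<noteq> {}" using card(2) m_pos by auto
  moreover have "snd y \<subseteq> snd x" using y(4) by (auto simp: pset_le_def split: prod.splits)
  ultimately show "x \<in> pointed_partitions n" using y(1) by (auto simp: pointed_partitions_def)
  show "card (fst x) \<le> size lam" using le card(1) by simp
  show "pset_type x = (lam, m)" if "card (fst x) = size lam" using le card(1) that y(3) by simp
qed

lemma proper_filter_card:
  assumes "x \<in> proper_filter"
  shows "0 < card (fst x)"
proof (rule ccontr)
  assume "\<not> 0 < card (fst x)"
  moreover obtain Bs Z where x: "x = (Bs, Z)" by force
  moreover have P: "(Bs, Z) \<in> pset_partitions n"
    using assms pset_filter_facts(1)[of x] by (simp add: x pointed_partitions_def)
  ultimately have "Bs = {}" using pset_partitions_finite[OF P] by simp
  with P have "x = pset_top n" unfolding x pset_top_def pset_partitions_iff by auto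
  with assms show False by simp
qed

lemma osp_type_iff:
  assumes "C \<in> osp n" "C \<noteq> []"
  shows "C \<in> osp_type \<longleftrightarrow> pset_type (forget_order C) = (lam, m)"
proof -
  obtain D Z where C: "C = D @ [Z]" using assms(2) by (cases C rule: rev_exhaust) auto
  have "distinct D" using assms(1) by (simp add: C osp_snoc)
  then show ?thesis
    using assms(1) by (auto simp: C osp_type_def pset_type_def mset_set_set)
qed

text \<open>The number of non-pointed blocks drops in each step and stays positive below the
  maximum, so a chain as long as this number permits has no gaps.\<close>

lemma strict_chain_graded:
  assumes "sorted_wrt (\<lambda>x y. pset_le x y \<and> x \<noteq> y) (x # c)" "set (x # c) \<subseteq> proper_filter"
  shows "length c < card (fst x) \<and> (card (fst x) \<le> Suc (length c) \<longrightarrow> graded_chain n (x # c))"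
  using assms
proof (induction c arbitrary: x)
  case Nil
  then show ?case using proper_filter_card[of x] pset_filter_facts(1)[of x] by auto
next
  case (Cons y c)
  have "pset_le x y" "x \<noteq> y" using Cons.prems(1) by simp_all
  moreover have "x \<in> pset_partitions n" "y \<in> pset_partitions n"
    using Cons.prems(2) pset_filter_facts(1)[of x] pset_filter_facts(1)[of y]
    by (simp_all add: pointed_partitions_def)
  ultimately have less: "card (fst y) < card (fst x)"
    using pset_le_card[of x n y] by linarith
  have IH: "length c < card (fst y) \<and> (card (fst y) \<le> Suc (length c) \<longrightarrow> graded_chain n (y # c))"
    using Cons.IH[of y] Cons.prems by simp
  have "graded_chain n (x # y # c)" if "card (fst x) \<le> Suc (length (y # c))"
  proof -
    have "graded_chain n (y # c)" using IH less that by simp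
    moreover have "card (fst x) = Suc (length (y # c))" using IH less that by simp
    moreover have "x \<in> pointed_partitions n" using Cons.prems(2) pset_filter_facts(1)[of x] by simp
    moreover have "\<forall>w\<in>set (y # c). pset_le x w" using Cons.prems(1) by simp
    ultimately show ?thesis by (subst graded_chain.simps(2)) blast
  qed
  then show ?case using IH less by simp
qed

lemma top_simplices:
  assumes "xs \<in> order_simplices proper_filter pset_le (int (size lam) - 1)"
  shows "graded_chain n xs" "length xs = size lam" "set xs \<subseteq> proper_filter"
proof -
  have xs: "set xs \<subseteq> proper_filter" "sorted_wrt (\<lambda>x y. pset_le x y \<and> x \<noteq> y) xs" "length xs = size lam"
    using assms by (auto simp: order_simplices_def)
  then show "length xs = size lam" "set xs \<subseteq> proper_filter" by simp_all
  show "graded_chain n xs"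
  proof (cases xs)
    case (Cons x c)
    then have "card (fst x) \<le> Suc (length c)" using xs(1,3) pset_filter_facts(2)[of x] by simp
    then show ?thesis using strict_chain_graded[of x c] xs(1,2) Cons by simp
  qed simp
qed

text \<open>Hence there are no boundaries in top degree, and the homology is the space of cycles
  itself.\<close>

lemma no_larger_simplices: "order_simplices proper_filter pset_le (int (size lam)) = {}"
proof -
  have False if "xs \<in> order_simplices proper_filter pset_le (int (size lam))" for xs
  proof -
    have xs: "set xs \<subseteq> proper_filter" "sorted_wrt (\<lambda>x y. pset_le x y \<and> x \<noteq> y) xs" "length xs = Suc (size lam)"
      using that by (auto simp: order_simplices_def)
    then obtain x c where Cons: "xs = x # c" by (cases xs) auto
    then show False
      using strict_chain_graded[of x c] xs pset_filter_facts(2)[of x] by simp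
  qed
  then show ?thesis by blast
qed

definition top_cycles :: "(pset_partition list \<Rightarrow>\<^sub>0 'k::field) set"
  where "top_cycles = {z \<in> chain_space proper_filter pset_le (int (size lam) - 1). boundary z = 0}"

lemma top_cycles_support:
  assumes "z \<in> top_cycles" "Poly_Mapping.lookup z xs \<noteq> 0"
  shows "graded_chain n xs" "length xs = size lam" "set xs \<subseteq> proper_filter"
proof -
  have "xs \<in> Poly_Mapping.keys z" using assms(2) by (simp add: in_keys_iff)
  then have "xs \<in> order_simplices proper_filter pset_le (int (size lam) - 1)"
    using assms(1) unfolding top_cycles_def chain_space_def by blast
  then show "graded_chain n xs" "length xs = size lam" "set xs \<subseteq> proper_filter"
    by (rule top_simplices)+
qed

lemma top_cycles_face:
  assumes "z \<in> (top_cycles :: (_ \<Rightarrow>\<^sub>0 'k::field) set)"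
  shows "(\<Sum>x\<in>pointed_partitions n. Poly_Mapping.lookup z (P @ x # Q)) = 0"
proof (rule link_cycle_boundary)
  show "boundary z = 0" using assms by (simp add: top_cycles_def)
  fix xs assume "xs \<in> Poly_Mapping.keys z"
  then show "graded_chain n xs \<and> length xs = size lam"
    using top_cycles_support[OF assms, of xs] by (simp add: in_keys_iff)
qed

lemma top_cycles_link_cycle:
  assumes "z \<in> (top_cycles :: (_ \<Rightarrow>\<^sub>0 'k::field) set)"
  shows "link_cycle n (size lam) (Poly_Mapping.lookup z)"
  using top_cycles_support[OF assms] top_cycles_face[OF assms] by (simp add: link_cycle_def)

lemma n_pos: "0 < n"
  using m_pos total by simp

lemma absorbing_chain_type:
  assumes z: "z \<in> top_cycles" and C: "C \<in> osp n" "length C = Suc (size lam)"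
    and nz: "Poly_Mapping.lookup z (absorbing_chain (size lam) C) \<noteq> 0"
  shows "C \<in> osp_type"
proof (cases "size lam")
  \<comment> \<open>Here the chain is empty and its support says nothing about C, but only one
    partition is left.\<close>
  case 0
  then have "C = [{1..n}]" using osp_singleton C by simp
  moreover have "lam = {#}" "m = n" using 0 total by simp_all
  ultimately have "map card C = [] @ [m] \<and> mset [] = lam" by simp
  then show ?thesis using C(1) unfolding osp_type_def by blast
next
  case (Suc r)
  have ne: "C \<noteq> []" using C(2) by auto
  have "forget_order C \<in> pset_filter lam m n"
    using top_cycles_support(3)[OF z nz] by (simp add: Suc)
  moreover have "card (fst (forget_order C)) = size lam"
    using forget_order_partition(3)[OF C(1) ne] C(2) by simp
  ultimately show ?thesis
    using pset_filter_facts(3) osp_type_iff[OF C(1) ne] by simp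
qed

lemma last_osp_type: "C \<in> osp_type \<Longrightarrow> card (last C) = m"
proof -
  assume "C \<in> osp_type"
  then obtain v where v: "map card C = v @ [m]" by (auto simp: osp_type_def)
  then have "C \<noteq> []" by auto
  then have "card (last C) = last (map card C)" by (simp add: last_map)
  with v show ?thesis by simp
qed

lemma card_union_larger:
  assumes P: "(Bs, Z) \<in> pset_partitions n" and A: "A \<in> Bs"
  shows "card Z < card (A \<union> Z)"
proof (rule psubset_card_mono)
  have "A \<subseteq> {1..n}" "Z \<subseteq> {1..n}" using P A pset_partitions_subset[of n] by auto
  then show "finite (A \<union> Z)" by (meson finite_UnI finite_atLeastAtMost finite_subset)
  have "A \<noteq> {}" using P A unfolding pset_partitions_iff by blast
  then obtain v where v: "v \<in> A" by blast
  then have "v \<notin> Z" using block_not_pointed[OF P A] by blast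
  with v show "Z \<subset> A \<union> Z" by blast
qed

text \<open>By the knapsack property the type determines which block of the merged partition is split.\<close>

lemma split_unique:
  assumes knapsack: "inj_on sum_mset {A. A \<subseteq># lam}"
    and C0: "C0 \<in> osp_type" and k: "size lam = Suc r" and i: "i \<le> r"
    and x: "x \<in> pointed_partitions n" "pset_type x = (lam, m)" "pset_le x (forget_order (mrg i C0))"
  shows "\<exists>C\<in>osp n. length C = Suc (Suc r) \<and> mrg i C = mrg i C0 \<and> forget_order C = x"
proof -
  let ?R = "mrg i C0"
  have C0': "C0 \<in> osp n" "length C0 = Suc (Suc r)"
    using C0 length_osp_type[OF C0] k by (auto simp: osp_type_def)
  have R: "?R \<in> osp n" "length ?R = Suc r"
    using osp_mrg[OF C0'(1)] length_merge_at[of i C0] C0'(2) i by simp_all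
  then have Rne: "?R \<noteq> []" by auto
  note fR = forget_order_partition[OF R(1) Rne]
  obtain Bs Z where xe: "x = (Bs, Z)" by force
  have P: "(Bs, Z) \<in> pset_partitions n" "Z \<noteq> {}" using x(1) by (simp_all add: xe pointed_partitions_def)
  have type: "image_mset card (mset_set Bs) = lam" "card Z = m" "card Bs = Suc r"
    using x(2) pset_type_card[OF x(2)] k by (simp_all add: xe pset_type_def)
  \<comment> \<open>The size of the last block tells whether the pointed block has grown, which
    happens only for i = r. This matches the kind of cover with the merging position.\<close>
  have lastR: "m < card (last ?R)" if "i = r"
  proof -
    obtain pre A Z0 where C: "C0 = pre @ [A, Z0]" "mrg r C0 = pre @ [A \<union> Z0]"
      using split_last_two[OF C0'(2)] by metis
    have "(set (pre @ [A]), Z0) \<in> pset_partitions n"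
      using C0'(1) osp_snoc[of "pre @ [A]" Z0 n] by (simp add: C(1))
    then have "card Z0 < card (A \<union> Z0)" by (rule card_union_larger) simp
    then show ?thesis using last_osp_type[OF C0] C that by simp
  qed
  have lastR': "card (last ?R) = m" if "i < r"
    using last_mrg[of i C0] C0'(2) that last_osp_type[OF C0] by simp
  have "Suc (card (fst (forget_order ?R))) = card Bs" using fR(3) R(2) type(3) by simp
  from pset_le_cover[OF P(1) fR(1) x(3)[unfolded xe] this]
  consider A where "A \<in> Bs" "forget_order ?R = absorb_block A (Bs, Z)"
    | A B where "A \<in> Bs" "B \<in> Bs" "A \<noteq> B" "forget_order ?R = join_blocks A B (Bs, Z)" by blast
  then show ?thesis
  proof cases
    case 1
    have "last ?R = A \<union> Z" using 1(2) by (simp add: forget_order_def absorb_block_def)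
    then have "i = r" using card_union_larger[OF P(1) 1(1)] type(2) lastR' i by fastforce
    obtain C where C: "C \<in> osp n" "forget_order C = (Bs, Z)" "length C = Suc (length ?R)" "mrg (length ?R - 1) C = ?R"
      by (rule unabsorb[OF R(1) Rne P 1])
    then show ?thesis using R(2) \<open>i = r\<close> xe by (intro bexI[of _ C]) simp_all
  next
    case 2
    have "last ?R = Z" using 2(4) by (simp add: forget_order_def join_blocks_def)
    then have "i < r" using lastR type(2) i by fastforce
    obtain pre q where C: "?R = pre @ (A \<union> B) # q @ [Z]" "pre @ A # B # q @ [Z] \<in> osp n"
      "forget_order (pre @ A # B # q @ [Z]) = (Bs, Z)"
      by (rule unjoin[OF R(1) Rne P 2])
    have "Suc i < length C0" using C0'(2) i by simp
    then obtain pre0 A0 B0 post0 where C0e: "C0 = pre0 @ A0 # B0 # post0" "length pre0 = i"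
      by (rule split_at)
    have Re: "?R = pre0 @ (A0 \<union> B0) # post0" by (simp add: C0e(1) merge_at_append'[OF C0e(2)])
    have "post0 \<noteq> []" using C0'(2) C0e \<open>i < r\<close> by auto
    then obtain q0 Z0 where q0: "post0 = q0 @ [Z0]" by (cases post0 rule: rev_exhaust) auto
    have eq: "pre @ (A \<union> B) # q = pre0 @ (A0 \<union> B0) # q0" using Re C(1) q0 by simp
    have distR: "distinct (pre @ (A \<union> B) # q)"
      using R(1) C(1) osp_snoc[of "pre @ (A \<union> B) # q" Z n] by simp
    have len: "length (pre @ A # B # q @ [Z]) = Suc (Suc r)" using R(2) C(1) by simp
    show ?thesis
    proof (cases "A \<union> B = A0 \<union> B0")
      case True
      have "pre = pre0"
      proof -
        have "length pre < length (pre @ (A \<union> B) # q)" "(pre @ (A \<union> B) # q) ! length pre = A \<union> B"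
          by simp_all
        moreover have "length pre0 < length (pre @ (A \<union> B) # q)" unfolding eq by simp
        moreover have "(pre @ (A \<union> B) # q) ! length pre0 = A0 \<union> B0" by (subst eq) simp
        ultimately have "length pre = length pre0" using nth_eq_iff_index_eq[OF distR] True by metis
        with eq show ?thesis by simp
      qed
      then have "mrg i (pre @ A # B # q @ [Z]) = ?R" using C(1) C0e(2) merge_at_append'[of pre i] by simp
      then show ?thesis using C(2,3) len xe by (intro bexI[of _ "pre @ A # B # q @ [Z]"]) simp_all
    next
      \<comment> \<open>Now A \<union> B would be an old block of C0. Its size alone and the sizes
        of A and B together would be two submultisets of \<open>lam\<close> with the same
        sum.\<close>
      case False
      have "A \<union> B \<in> set (pre0 @ (A0 \<union> B0) # q0)" using eq by (metis in_set_conv_decomp)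
      with False have "A \<union> B \<in> set (pre0 @ A0 # B0 # q0)" by auto
      moreover have "C0 = (pre0 @ A0 # B0 # q0) @ [Z0]" by (simp add: C0e q0)
      moreover obtain v where v: "map card C0 = v @ [m]" "mset v = lam" using C0 by (auto simp: osp_type_def)
      ultimately have "card (A \<union> B) \<in># lam" by auto
      moreover have fin: "finite Bs" by (rule pset_partitions_finite[OF P(1)])
      moreover have "{#card A, card B#} \<subseteq># lam"
      proof -
        have "mset_set {A, B} \<subseteq># mset_set Bs" using fin 2(1,2) by (intro subset_imp_msubset_mset_set) auto
        then have "image_mset card (mset_set {A, B}) \<subseteq># lam"
          unfolding type(1)[symmetric] by (rule image_mset_subseteq_mono)
        with 2(3) show ?thesis by simp
      qed
      moreover have "card (A \<union> B) = card A + card B"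
      proof (rule card_Un_disjoint)
        have "A \<subseteq> {1..n}" "B \<subseteq> {1..n}" using P 2 pset_partitions_subset[of n] by auto
        then show "finite A" "finite B" by (meson finite_atLeastAtMost finite_subset)+
        show "A \<inter> B = {}" using block_unique[OF P(1) 2(1,2)] 2(3) by blast
      qed
      ultimately have "{#card (A \<union> B)#} = {#card A, card B#}"
        by (intro inj_onD[OF knapsack]) simp_all
      then have "size {#card (A \<union> B)#} = size {#card A, card B#}" by (rule arg_cong)
      then show ?thesis by simp
    qed
  qed
qed

lemma two_neq_0':
  assumes "of_nat (fact n) \<noteq> (0 :: 'k::field)" "size lam = Suc r"
  shows "(2 :: 'k) \<noteq> 0"
proof -
  obtain v where v: "mset v = lam" by (metis ex_mset)
  have "length (v @ [m]) \<le> sum_list (v @ [m])"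
    by (rule length_le_sum_list[OF word_facts(1)[OF v]])
  then have "2 \<le> n" using word_facts(2,3)[OF v] assms(2) by simp
  then show ?thesis by (rule two_neq_0[OF assms(1)])
qed

text \<open>The face condition at the first place, on chains that continue with the absorbing chain
  of R, is a sum over unordered partitions. By \<open>split_unique\<close> these are the partitions
  underlying the ordered ones that merge to R at i, which turns it into the cycle condition of the
  bar complex.\<close>

lemma sum_absorbing_chains:
  fixes z :: "pset_partition list \<Rightarrow>\<^sub>0 'k::field"
  assumes knapsack: "inj_on sum_mset {A. A \<subseteq># lam}" and inv: "of_nat (fact n) \<noteq> (0 :: 'k)"
    and z: "z \<in> top_cycles" and k: "size lam = Suc r" and i: "i \<le> r"
  shows "(\<Sum>C | C \<in> osp_type \<and> mrg i C = R. Poly_Mapping.lookup z (absorbing_chain (Suc r) C)) = 0"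
proof -
  define F where "F = {C \<in> osp n. length C = Suc (Suc r) \<and> mrg i C = R}"
  define g where "g C = Poly_Mapping.lookup z (absorbing_chain (Suc r) C)" for C
  define h where "h x = Poly_Mapping.lookup z (x # absorbing_chain r R)" for x
  have finF: "finite F" unfolding F_def by (rule finite_subset[of _ "osp n"]) auto
  have gtype: "C \<in> osp_type" if "C \<in> F" "g C \<noteq> 0" for C
    using absorbing_chain_type[OF z, of C] that k by (simp add: F_def g_def)
  have "sum g {C. C \<in> osp_type \<and> mrg i C = R} = sum g F"
  proof (rule sum.mono_neutral_left[OF finF])
    show "{C. C \<in> osp_type \<and> mrg i C = R} \<subseteq> F"
    proof
      fix C assume "C \<in> {C. C \<in> osp_type \<and> mrg i C = R}"
      then show "C \<in> F" using length_osp_type[of C] k by (simp add: F_def osp_type_def)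
    qed
    show "\<forall>C\<in>F - {C. C \<in> osp_type \<and> mrg i C = R}. g C = 0" using gtype by (auto simp: F_def)
  qed
  also have "sum g F = 0"
  proof (cases "\<exists>C0\<in>F. g C0 \<noteq> 0")
    case False
    then show ?thesis by (intro sum.neutral) blast
  next
    case True
    \<comment> \<open>A nonzero coefficient provides a partition of the right type over R, which
      \<open>split_unique\<close> needs as a reference.\<close>
    then obtain C0 where C0: "C0 \<in> F" "C0 \<in> osp_type" using gtype by blast
    have R_eq: "mrg i C0 = R" and C0': "C0 \<in> osp n" "length C0 = Suc (Suc r)" using C0(1) by (simp_all add: F_def)
    have R: "R \<in> osp n" "length R = Suc r"
      using osp_mrg[OF C0'(1), of i] length_merge_at[of i C0] C0'(2) i unfolding R_eq[symmetric] by simp_all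
    have link: "link_cycle n (Suc r) (Poly_Mapping.lookup z)"
      using top_cycles_link_cycle[OF z] k by simp
    have "sum h (forget_order ` F) = sum h (pointed_partitions n)"
    proof (rule sum.mono_neutral_left)
      show "forget_order ` F \<subseteq> pointed_partitions n"
      proof
        fix x assume "x \<in> forget_order ` F"
        then obtain C where "C \<in> F" "x = forget_order C" by blast
        moreover from this have "C \<in> osp n" "C \<noteq> []" by (auto simp: F_def)
        ultimately show "x \<in> pointed_partitions n"
          using forget_order_partition[of C n] by (simp add: pointed_partitions_def)
      qed
      show "\<forall>x\<in>pointed_partitions n - forget_order ` F. h x = 0"
      proof (intro ballI, rule ccontr)
        fix x assume x: "x \<in> pointed_partitions n - forget_order ` F" "h x \<noteq> 0"
        have s: "graded_chain n (x # absorbing_chain r R)" "x \<in> pset_filter lam m n"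
          using top_cycles_support[OF z, of "x # absorbing_chain r R"] x(2) by (simp_all add: h_def)
        have "card (fst x) = size lam" using s(1) k by simp
        then have "pset_type x = (lam, m)" by (rule pset_filter_facts(3)[OF s(2)])
        moreover have "pset_le x (forget_order (mrg i C0))"
          using graded_chain_le[OF s(1) R] R_eq by simp
        ultimately obtain C where "C \<in> osp n" "length C = Suc (Suc r)" "mrg i C = mrg i C0" "forget_order C = x"
          using split_unique[OF knapsack C0(2) k i, of x] x(1) by blast
        then have "x \<in> forget_order ` F" unfolding F_def using R_eq by blast
        with x(1) show False by simp
      qed
    qed simp
    also have "\<dots> = 0" using top_cycles_face[OF z, of "[]" "absorbing_chain r R"] by (simp add: h_def)
    finally have sum_h: "sum h (forget_order ` F) = 0" .
    show ?thesis
    \<comment> \<open>For i = r the pointed block grows, and C is recovered from R and its unordered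
      partition. Otherwise two blocks are joined, and both of their orders have the same underlying
      partition.\<close>
    proof (cases "i = r")
      case True
      have "inj_on forget_order F"
      proof (rule inj_onI)
        fix C C' assume C: "C \<in> F" "C' \<in> F" "forget_order C = forget_order C'"
        have len: "length C = Suc (Suc r)" "length C' = Suc (Suc r)" using C(1,2) by (simp_all add: F_def)
        obtain pre A Z where 1: "C = pre @ [A, Z]" "mrg r C = pre @ [A \<union> Z]"
          using split_last_two[OF len(1)] by metis
        obtain pre' A' Z' where 2: "C' = pre' @ [A', Z']" "mrg r C' = pre' @ [A' \<union> Z']"
          using split_last_two[OF len(2)] by metis
        have "Z = Z'" using C(3) by (simp add: 1 2 forget_order_def)
        moreover have "pre = pre'" "A \<union> Z = A' \<union> Z'" using C(1,2) True 1 2 by (auto simp: F_def)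
        moreover have "A \<inter> Z = {}" "A' \<inter> Z' = {}"
          using C(1,2) by (auto simp: F_def 1 2 osp_def sorted_wrt_disjnt_append sorted_wrt_disjnt_Cons disjnt_def)
        ultimately have "A = A'" by blast
        with \<open>Z = Z'\<close> \<open>pre = pre'\<close> show "C = C'" by (simp add: 1 2)
      qed
      then have "sum h (forget_order ` F) = (\<Sum>C\<in>F. h (forget_order C))"
        by (simp add: sum.reindex)
      also have "\<dots> = sum g F"
        by (rule sum.cong) (auto simp: F_def g_def h_def True)
      finally show ?thesis using sum_h by simp
    next
      case False
      then have ir: "i < r" using i by simp
      have "Suc i < length R" using R(2) ir by simp
      then obtain pre E b post where R': "R = pre @ E # b # post" "length pre = i" by (rule split_at)
      obtain q Z where qZ: "b # post = q @ [Z]" by (cases "b # post" rule: rev_exhaust) auto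
      have Re: "R = pre @ E # q @ [Z]" using R'(1) qZ by simp
      have form: "\<exists>A B. C = pre @ A # B # q @ [Z] \<and> A \<union> B = E" if C: "C \<in> F" for C
      proof -
        have "Suc i < length C" "mrg i C = R" using C ir by (simp_all add: F_def)
        then obtain pre' A B post' where C': "C = pre' @ A # B # post'" "length pre' = i" by (metis split_at)
        have "pre' @ (A \<union> B) # post' = pre @ E # q @ [Z]"
          using \<open>mrg i C = R\<close> Re by (simp add: C'(1) merge_at_append'[OF C'(2)])
        then have "pre' = pre \<and> (A \<union> B) # post' = E # q @ [Z]"
          using C'(2) R'(2) by (subst (asm) append_eq_append_conv) auto
        then show ?thesis using C'(1) by auto
      qed
      have swap: "swp i C \<in> F" "forget_order (swp i C) = forget_order C" "swp i C \<noteq> C"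
        "h (forget_order C) = (- 1) ^ Suc (length q) * (g C + g (swp i C))" if C: "C \<in> F" for C
      proof -
        obtain A B where AB: "C = pre @ A # B # q @ [Z]" "A \<union> B = E" using form[OF C] by blast
        have s: "swp i C = pre @ B # A # q @ [Z]" using AB(1) R'(2) by simp
        have osp_C: "C \<in> osp n" "length C = Suc (Suc r)" using C by (simp_all add: F_def)
        have o: "(set (pre @ A # B # q), Z) \<in> pset_partitions n \<and> distinct (pre @ A # B # q) \<and> Z \<noteq> {}"
          using osp_C(1) osp_snoc[of "pre @ A # B # q" Z n] by (simp add: AB(1))
        have "set (pre @ B # A # q) = set (pre @ A # B # q)" by auto
        moreover have "distinct (pre @ B # A # q)" using o by auto
        ultimately have "(pre @ B # A # q) @ [Z] \<in> osp n" using o unfolding osp_snoc by (simp only: not_False_eq_True simp_thms)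
        moreover have "mrg i (pre @ B # A # q @ [Z]) = R"
          by (simp add: merge_at_append'[OF R'(2)] Re AB(2)[symmetric] Un_commute)
        ultimately show "swp i C \<in> F" using osp_C(2) s AB(1) by (simp add: F_def)
        show "forget_order (swp i C) = forget_order C"
          unfolding s unfolding AB(1)
          using forget_order_snoc[of "pre @ A # B # q" Z] forget_order_snoc[of "pre @ B # A # q" Z]
          by (simp add: insert_commute)
        have "A \<noteq> B" using o by auto
        then show "swp i C \<noteq> C" unfolding s unfolding AB(1) by simp
        show "h (forget_order C) = (- 1) ^ Suc (length q) * (g C + g (swp i C))"
          using join_chain_relation[OF link, of pre A B q Z] osp_C
          unfolding h_def g_def s unfolding AB(1) Re AB(2)[symmetric] by blast
      qed
      have fiber: "{C \<in> F. forget_order C = forget_order C1} = {C1, swp i C1}" if C1: "C1 \<in> F" for C1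
      proof (intro equalityI subsetI)
        fix C assume "C \<in> {C \<in> F. forget_order C = forget_order C1}"
        then have C: "C \<in> F" "forget_order C = forget_order C1" by simp_all
        obtain A B where AB: "C = pre @ A # B # q @ [Z]" using form[OF C(1)] by blast
        obtain A1 B1 where AB1: "C1 = pre @ A1 # B1 # q @ [Z]" using form[OF C1] by blast
        have "distinct C" "distinct C1" using C(1) C1 osp_distinct by (auto simp: F_def)
        moreover have "set (pre @ A # B # q) = set (pre @ A1 # B1 # q)"
          using C(2) forget_order_snoc[of "pre @ A # B # q" Z] forget_order_snoc[of "pre @ A1 # B1 # q" Z]
          by (simp add: AB AB1)
        moreover have "set (pre @ A # B # q) - (set pre \<union> set q) = {A, B}" if "distinct (pre @ A # B # q)" for A B
          using that by auto
        ultimately have "{A, B} = {A1, B1}"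
          by (metis AB AB1 append_Cons append_assoc distinct_append)
        then have "A = A1 \<and> B = B1 \<or> A = B1 \<and> B = A1" by (simp add: doubleton_eq_iff)
        then show "C \<in> {C1, swp i C1}" using AB AB1 R'(2) by auto
      qed (use C1 swap[OF C1] in auto)
      \<comment> \<open>Every y has two orders, so this is twice a vanishing sum. By the chain
        relation it is also, up to sign, twice the sum of all g C, and 2 can be cancelled.\<close>
      have "(\<Sum>C\<in>F. h (forget_order C)) = (\<Sum>y\<in>forget_order ` F. \<Sum>C\<in>{C \<in> F. forget_order C = y}. h (forget_order C))"
        by (rule sum.image_gen[OF finF])
      also have "\<dots> = (\<Sum>y\<in>forget_order ` F. 2 * h y)"
      proof (rule sum.cong)
        fix y assume "y \<in> forget_order ` F"
        then obtain C1 where C1: "C1 \<in> F" "y = forget_order C1" by blast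
        show "(\<Sum>C\<in>{C \<in> F. forget_order C = y}. h (forget_order C)) = 2 * h y"
        proof -
          have "{C \<in> F. forget_order C = y} = {C1, swp i C1}"
            unfolding C1(2) by (rule fiber[OF C1(1)])
          moreover have "h (forget_order (swp i C1)) = h y" "h (forget_order C1) = h y"
            by (simp_all only: swap(2)[OF C1(1)] C1(2))
          moreover have "C1 \<noteq> swp i C1" by (rule not_sym[OF swap(3)[OF C1(1)]])
          ultimately show ?thesis by (simp only: mult_2 sum.insert finite.intros insert_iff empty_iff
            simp_thms sum.empty add_0_right)
        qed
      qed simp
      also have "\<dots> = 0" using sum_h by (simp add: sum_distrib_left[symmetric])
      finally have "0 = (\<Sum>C\<in>F. (- 1) ^ Suc (length q) * (g C + g (swp i C)))"
        using swap(4) by (simp cong: sum.cong)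
      also have "\<dots> = (- 1) ^ Suc (length q) * (sum g F + (\<Sum>C\<in>F. g (swp i C)))"
        by (simp only: sum_distrib_left[symmetric] sum.distrib)
      also have "(\<Sum>C\<in>F. g (swp i C)) = sum g F"
        by (rule sum.reindex_bij_witness[of _ "swp i" "swp i"]) (use swap(1) in auto)
      finally have "(- 1) ^ Suc (length q) * (2 * sum g F) = 0" by (simp only: mult_2)
      moreover have "(- 1 :: 'k) ^ Suc (length q) \<noteq> 0" by simp
      ultimately have "2 * sum g F = 0" by (metis mult_eq_0_iff)
      then show ?thesis using two_neq_0'[OF inv k] by (metis mult_eq_0_iff)
    qed
  qed
  finally show ?thesis by (simp add: g_def)
qed

definition bar_map :: "(nat set list \<Rightarrow>\<^sub>0 'k::field) \<Rightarrow> (pset_partition list \<Rightarrow>\<^sub>0 'k)"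
  where "bar_map = lin_ext (bar_chain (size lam))"

lemma flin_bar_map [simp]: "flin bar_map"
  by (simp add: bar_map_def)

lemma lookup_bar_map:
  assumes x: "Poly_Mapping.keys x \<subseteq> osp_type" and C: "C \<in> osp n" "length C = Suc (size lam)"
  shows "Poly_Mapping.lookup (bar_map x) (absorbing_chain (size lam) C)
    = Poly_Mapping.lookup x C * (\<Prod>j<size lam. (- 1) ^ j :: 'k::field)"
proof -
  have "Poly_Mapping.lookup (bar_map x) (absorbing_chain (size lam) C)
    = (\<Sum>D\<in>osp_type. if D = C then Poly_Mapping.lookup x C * (\<Prod>j<size lam. (- 1) ^ j) else 0)"
    unfolding bar_map_def lookup_lin_ext[OF finite_osp_type x]
  proof (rule sum.cong)
    fix D assume D: "D \<in> osp_type"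
    then have "D \<in> osp n" by (simp add: osp_type_def)
    then have "Poly_Mapping.lookup (bar_chain (size lam) D) (absorbing_chain (size lam) C)
        = (if D = C then \<Prod>j<size lam. (- 1) ^ j else (0 :: 'k))"
      by (rule lookup_bar_chain[OF _ C(1) length_osp_type[OF D] C(2)])
    then show "Poly_Mapping.lookup x D * Poly_Mapping.lookup (bar_chain (size lam) D) (absorbing_chain (size lam) C)
      = (if D = C then Poly_Mapping.lookup x C * (\<Prod>j<size lam. (- 1) ^ j) else 0)"
      by simp
  qed simp
  then show ?thesis using x by (auto simp: in_keys_iff)
qed

text \<open>By \<open>boundary_bar_chain\<close> the boundary of the image is an alternating sum
  over the merges of x, and each of these vanishes separately.\<close>

lemma bar_map_cycle:
  assumes x: "x \<in> cyc (Suc (size lam)) osp_type"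
  shows "bar_map x \<in> (top_cycles :: (_ \<Rightarrow>\<^sub>0 'k::field) set)"
proof -
  have keys: "Poly_Mapping.keys x \<subseteq> osp_type" using x by (simp add: cyc_def)
  have "Poly_Mapping.keys (bar_map x) \<subseteq> order_simplices proper_filter pset_le (int (size lam) - 1)"
  proof
    fix xs assume "xs \<in> Poly_Mapping.keys (bar_map x)"
    then obtain C where C: "C \<in> Poly_Mapping.keys x" "xs \<in> Poly_Mapping.keys (bar_chain (size lam) C :: _ \<Rightarrow>\<^sub>0 'k)"
      unfolding bar_map_def using keys_lin_ext[of "bar_chain (size lam)" x] by blast
    have T: "C \<in> osp_type" using C(1) keys by blast
    then have osp_C: "C \<in> osp n" "length C = Suc (size lam)" using length_osp_type by (simp_all add: osp_type_def)
    have ne: "C \<noteq> []" using osp_C(2) by auto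
    note kb = keys_bar_chain[OF osp_C C(2)]
    have "y \<in> proper_filter" if "y \<in> set xs" for y
    proof -
      have y: "y \<in> pset_partitions n" "pset_le (forget_order C) y" "0 < card (fst y)" using kb that by simp_all
      have "pset_type (forget_order C) = (lam, m)" using T osp_type_iff[OF osp_C(1) ne] by simp
      then have "y \<in> pset_filter lam m n"
        using y(1,2) forget_order_partition(1)[OF osp_C(1) ne] by (auto simp: pset_filter_def)
      moreover have "y \<noteq> pset_top n" using y(3) by (auto simp: pset_top_def)
      ultimately show ?thesis by simp
    qed
    then show "xs \<in> order_simplices proper_filter pset_le (int (size lam) - 1)"
      using kb by (auto simp: order_simplices_def)
  qed
  moreover have "boundary (bar_map x) = 0"
  proof (cases "size lam")
    case 0
    have "boundary (bar_map x) = lin_ext (\<lambda>C. 0) x"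
      unfolding bar_map_def 0 boundary_def lin_ext_lin_ext by (rule lin_ext_cong) simp_all
    then show ?thesis by (simp add: lin_ext_def)
  next
    case (Suc r)
    have "boundary (bar_map x) = lin_ext (\<lambda>C. boundary (bar_chain (Suc r) C)) x"
      unfolding bar_map_def Suc boundary_def lin_ext_lin_ext ..
    also have "\<dots> = lin_ext (\<lambda>C. \<Sum>i<Suc r. fscale ((- 1) ^ i) (bar_chain r (mrg i C))) x"
      by (simp only: boundary_bar_chain)
    also have "\<dots> = (\<Sum>i<Suc r. fscale ((- 1) ^ i) (lin_ext (bar_chain r) (basis_map (mrg i) x)))"
      unfolding lin_ext_basis_map
    proof (rule flin_eqI[where f = "lin_ext _"])
      show "flin (\<lambda>v. \<Sum>i<Suc r. fscale ((- 1) ^ i) (lin_ext (\<lambda>C. bar_chain r (mrg i C)) v))"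
        by (rule flinI) (simp_all only: lin_ext_simps free_vs.scale_right_distrib sum.distrib
            free_vs.scale_sum_right fscale_simps mult.commute)
    qed (simp_all del: sum.lessThan_Suc)
    also have "\<dots> = 0"
    proof (rule sum.neutral, rule ballI)
      fix i assume "i \<in> {..<Suc r}"
      then have "basis_map (mrg i) x = 0" using x Suc by (simp add: cyc_def)
      then show "fscale ((- 1) ^ i) (lin_ext (bar_chain r) (basis_map (mrg i) x)) = (0 :: _ \<Rightarrow>\<^sub>0 'k)"
        by (simp add: lin_ext_simps)
    qed
    finally show ?thesis .
  qed
  ultimately show ?thesis by (simp add: top_cycles_def chain_space_def)
qed

lemma top_cycles_diff: "z \<in> top_cycles \<Longrightarrow> w \<in> top_cycles \<Longrightarrow> z - w \<in> top_cycles"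
proof -
  assume zw: "z \<in> top_cycles" "w \<in> top_cycles"
  have "Poly_Mapping.keys (z - w) \<subseteq> Poly_Mapping.keys z \<union> Poly_Mapping.keys w"
    by (auto simp: in_keys_iff lookup_minus)
  with zw show ?thesis
    by (auto simp: top_cycles_def chain_space_def flin_diff[OF flin_boundary])
qed

text \<open>The coefficients on absorbing chains, suitably normalised, define x. The difference of z
  and the image of x vanishes on all absorbing chains, hence everywhere by
  \<open>link_cycle_eq_0\<close>.\<close>

lemma bar_map_surj:
  assumes knapsack: "inj_on sum_mset {A. A \<subseteq># lam}" and inv: "of_nat (fact n) \<noteq> (0 :: 'k::field)"
    and z: "z \<in> (top_cycles :: (_ \<Rightarrow>\<^sub>0 'k) set)"
  shows "\<exists>x\<in>cyc (Suc (size lam)) osp_type. z = bar_map x"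
proof -
  \<comment> \<open>The diagonal coefficient of \<open>lookup_bar_chain\<close>, a product of signs
    and therefore invertible.\<close>
  define e :: 'k where "e = (\<Prod>j<size lam. (- 1) ^ j)"
  have e: "e \<noteq> 0" by (simp add: e_def)
  let ?g = "\<lambda>C. Poly_Mapping.lookup z (absorbing_chain (size lam) C)"
  define y where "y = (\<Sum>C\<in>osp_type. Poly_Mapping.single C (?g C))"
  define x where "x = fscale (inverse e) y"
  have look: "Poly_Mapping.lookup y C = (if C \<in> osp_type then ?g C else 0)" for C
    unfolding y_def lookup_sum' by (simp add: lookup_single when_def)
  have keys_y: "Poly_Mapping.keys y \<subseteq> osp_type" using look by (auto simp: in_keys_iff split: if_splits)
  have keys_x: "Poly_Mapping.keys x \<subseteq> osp_type" using keys_y by (auto simp: x_def in_keys_iff)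
  have "basis_map (mrg i) y = 0" if i: "i < size lam" for i
  proof -
    obtain r where k: "size lam = Suc r" using i by (cases "size lam") auto
    have "Poly_Mapping.lookup (basis_map (mrg i) y) R = 0" for R
    proof -
      have "Poly_Mapping.lookup (basis_map (mrg i) y) R = (\<Sum>C | C \<in> osp_type \<and> mrg i C = R. ?g C)"
        unfolding lookup_basis_map[OF finite_osp_type keys_y] by (rule sum.cong) (auto simp: look)
      then show ?thesis
        using sum_absorbing_chains[OF knapsack inv z k, of i R] i k by simp
    qed
    then show ?thesis by (intro poly_mapping_eqI) simp
  qed
  then have x: "x \<in> cyc (Suc (size lam)) osp_type"
    using keys_x by (auto simp: cyc_def x_def basis_map_simps)
  let ?w = "z - bar_map x"
  have w: "?w \<in> top_cycles" by (rule top_cycles_diff[OF z bar_map_cycle[OF x]])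
  have "Poly_Mapping.lookup ?w (absorbing_chain (size lam) C) = 0" if C: "C \<in> osp n" "length C = Suc (size lam)" for C
  proof -
    have "?g C = Poly_Mapping.lookup y C" using look absorbing_chain_type[OF z C] by auto
    then show ?thesis
      using lookup_bar_map[OF keys_x C] e by (simp add: lookup_minus x_def e_def[symmetric])
  qed
  then have "Poly_Mapping.lookup ?w c = 0" for c
    by (rule link_cycle_eq_0[OF n_pos top_cycles_link_cycle[OF w]])
  then have "?w = 0" by (intro poly_mapping_eqI) simp
  then have "z = bar_map x" by simp
  with x show ?thesis by blast
qed

theorem homology_iso:
  assumes knapsack: "inj_on sum_mset {A. A \<subseteq># lam}" and inv: "of_nat (fact n) \<noteq> (0 :: 'k::field)"
  shows "sym_module_iso n
    (fmodule (cyc (Suc (size lam)) osp_type) perm_act :: ('k, nat set list \<Rightarrow>\<^sub>0 'k) sym_module)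
    (reduced_homology proper_filter pset_le pset_act (int (size lam) - 1))"
proof -
  let ?Z = "cyc (Suc (size lam)) osp_type :: (nat set list \<Rightarrow>\<^sub>0 'k) set"
  let ?H = "reduced_homology proper_filter pset_le pset_act (int (size lam) - 1)
    :: ('k, (pset_partition list \<Rightarrow>\<^sub>0 'k) set) sym_module"
  have "chain_space proper_filter pset_le (int (size lam)) = {0 :: pset_partition list \<Rightarrow>\<^sub>0 'k}"
    by (auto simp: chain_space_def no_larger_simplices)
  then have W: "boundary ` chain_space proper_filter pset_le (int (size lam) - 1 + 1)
      = {0 :: pset_partition list \<Rightarrow>\<^sub>0 'k}"
    by (simp add: flin_0[OF flin_boundary])
  \<comment> \<open>The boundaries form the zero space, so every coset is a singleton.\<close>
  have space: "space ?H = (\<lambda>z. {z}) ` top_cycles"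
    unfolding reduced_homology_def quotient_module_def W top_cycles_def by auto
  have add: "add ?H {v} {w} = {v + w}" for v w
    unfolding reduced_homology_def quotient_module_def by simp
  have scale: "scale ?H c {v} = {fscale c v}" for c v
    unfolding reduced_homology_def quotient_module_def W by simp
  have act: "act ?H p {v} = {basis_map (map (pset_act p)) v}" for p v
    unfolding reduced_homology_def quotient_module_def by simp
  have keys: "Poly_Mapping.keys x \<subseteq> osp_type" if "x \<in> ?Z" for x using that by (simp add: cyc_def)
  have "inj_on bar_map ?Z"
  proof (rule inj_onI)
    fix x y assume xy: "x \<in> ?Z" "y \<in> ?Z" "bar_map x = bar_map y"
    have "Poly_Mapping.lookup x C = Poly_Mapping.lookup y C" if C: "C \<in> osp_type" for C
      using lookup_bar_map[OF keys[OF xy(1)], of C] lookup_bar_map[OF keys[OF xy(2)], of C]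
        xy(3) C length_osp_type[OF C] by (simp add: osp_type_def)
    moreover have "Poly_Mapping.lookup x C = Poly_Mapping.lookup y C" if "C \<notin> osp_type" for C
      using keys[OF xy(1)] keys[OF xy(2)] that by (metis in_keys_iff subsetD)
    ultimately show "x = y" by (intro poly_mapping_eqI) blast
  qed
  moreover have "bar_map ` ?Z = top_cycles"
    using bar_map_cycle bar_map_surj[OF knapsack inv] by blast
  ultimately have "bij_betw (\<lambda>x. {bar_map x}) ?Z (space ?H)"
    unfolding space bij_betw_def inj_on_def by auto
  moreover have "bar_map (perm_act p x) = basis_map (map (pset_act p)) (bar_map x)" if x: "x \<in> ?Z" for p x
    unfolding bar_map_def perm_act_def lin_ext_basis_map basis_map_lin_ext
    using keys[OF x] length_osp_type by (intro lin_ext_cong bar_chain_act) auto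
  ultimately show ?thesis
    unfolding sym_module_iso_def fmodule_sel
    by (intro exI[of _ "\<lambda>x. {bar_map x}"] conjI)
      (simp_all add: add scale act flin_add[OF flin_bar_map] flin_scale[OF flin_bar_map])
qed

end

theorem theorem10p3:
  fixes lam :: "nat multiset" and m n k :: nat
  assumes "pointed_knapsack lam m n"
    and "m > 0"
    and "k = size lam"
    and "of_nat (fact n) \<noteq> (0 :: 'k::field)"
  shows "sym_module_iso n
    (reduced_homology (pset_filter lam m n - {pset_top n}) pset_le pset_act (int k - 1)
      :: ('k, (pset_partition list \<Rightarrow>\<^sub>0 'k) set) sym_module)
    (direct_sum (V_comps lam m n) (\<lambda>d. specht_module n (border_strip d)))"
proof -
  have knapsack: "inj_on sum_mset {A. A \<subseteq># lam}"
    using assms(1) by (simp add: pointed_knapsack_def)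
  interpret pointed_type lam m n
    using assms(1,2) by unfold_locales (simp_all add: pointed_knapsack_def)
  let ?X = "fmodule (cyc (Suc (size lam)) osp_type) perm_act :: ('k, nat set list \<Rightarrow>\<^sub>0 'k) sym_module"
  let ?S = "\<lambda>d. fmodule (cyc (length d) (ospc n d)) perm_act :: ('k, nat set list \<Rightarrow>\<^sub>0 'k) sym_module"
  have closed: "closed_module n (?S d)" for d
    by (rule closed_fmodule[OF stable_cyc[OF ospc_map]])
  have "sym_module_iso n (reduced_homology proper_filter pset_le pset_act (int k - 1)) ?X"
    unfolding assms(3)
    by (rule sym_module_iso_sym[OF homology_iso[OF knapsack assms(4)]
          closed_fmodule[OF stable_cyc[OF osp_type_map]]])
  moreover have "sym_module_iso n ?X (direct_sum (V_comps lam m n) ?S)"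
  proof (rule sym_module_iso_sym[OF cycles_direct_sum[OF knapsack assms(4)]])
    show "closed_module n (direct_sum (V_comps lam m n) ?S)"
      using closed unfolding closed_module_def direct_sum_sel
      by (auto simp: restrict_PiE_iff PiE_iff)
  qed
  moreover have "sym_module_iso n (direct_sum (V_comps lam m n) ?S)
      (direct_sum (V_comps lam m n) (\<lambda>d. specht_module n (border_strip d)))"
    using specht_iso[OF assms(4)] V_comps_facts[OF knapsack] closed
    by (intro sym_module_iso_direct_sum) auto
  ultimately show ?thesis
    by (blast intro: sym_module_iso_trans)
qed

end
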